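(* Let $u=(u_1,\dots,u_d)\in W_0^{1,\boldsymbol p}(\Omega)$ be a weak solution of problem $(\mathcal P)$. Then $u_k\in L^\infty(\Omega)$ for every $k=1,\dots,d$.
   Context: Standing setting. $\Omega\subset\mathbb{R}^N$ is a bounded domain, $N\ge 2$, $d\ge1$ is an integer, $p_1,\dots,p_d>1$, $\boldsymbol p=(p_1,\dots,p_d)$, $\overline p=\max\{p_1,\dots,p_d\}$, and $W_0^{1,\boldsymbol p}(\Omega)=W_0^{1,p_1}(\Omega)\times\cdots\times W_0^{1,p_d}(\Omega)$ with norm $\|u\|=\sum_k\|\nabla u_k\|_{L^{p_k}}$. $p_k^*=Np_k/(N-p_k)$ if $N>p_k$ and $p_k^*=\infty$ otherwise. For each $k$, $A_k:\Omega\times\mathbb{R}\to\mathbb{R}$ is $C^1$-Carathéodory ($A_k(\cdot,s)$ measurable for every $s$, $A_k(x,\cdot)\in C^1$ for a.e. $x$), and there are constants $C_0,\nu>0$ with, for a.e. $x$ and all $s\in\mathbb{R}$: (a.1) $|A_k(x,s)|,|D_sA_k(x,s)|\le C_0$; (a.2) $A_k(x,s)\ge\nu$. $G:\Omega\times\mathbb{R}^d\to\mathbb{R}$ is $C^1$-Carathéodory with $G(x,0)=0$, $G_{s_k}(x,0)=0$; write $g_k(x,s)=G_{s_k}(x,s)=\partial G/\partial s_k$. (g.1) There are $C>0$ and $q_k\in(p_k,p_k^* )$ with $|g_k(x,s)|\le C\big(1+|s_k|^{q_k-1}+\sum_{j\ne k}|s_j|^{q_j(q_k-1)/q_k}\big)$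 for a.e. $x$, all $s\in\mathbb{R}^d$, all $k$. There are $R>0$, $\mu>\overline p$, $\gamma\in(0,\mu-\overline p)$ such that for a.e. $x$: (g.2) $s\in\mathbb{R}^d$, $|s|\ge R\Rightarrow 0<\mu G(x,s)\le\sum_{k=1}^d s_k g_k(x,s)$; (a.3) $s\in\mathbb{R}$, $|s|\ge R\Rightarrow 0\le sD_sA_k(x,s)\le\gamma A_k(x,s)$ for each $k$. Problem $(\mathcal P)$: $-\mathrm{div}(A_k(x,u_k)|\nabla u_k|^{p_k-2}\nabla u_k)+\frac1{p_k}D_sA_k(x,u_k)|\nabla u_k|^{p_k}=g_k(x,u)$ in $\Omega$, $u_k=0$ on $\partial\Omega$, $k=1,\dots,d$. A weak solution is $u\in W_0^{1,\boldsymbol p}(\Omega)$ with $\int_\Omega A_k(x,u_k)|\nabla u_k|^{p_k-2}\nabla u_k\cdot\nabla v_k+\frac1{p_k}\int_\Omega D_sA_k(x,u_k)|\nabla u_k|^{p_k}v_k=\int_\Omega g_k(x,u)v_k$ for every $v\in C_c^\infty(\Omega;\mathbb{R}^d)$ and every $k$. *)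

theory Defs
  imports "HOL-Analysis.Analysis"
begin

fun iter_pd :: "'n::finite list \<Rightarrow> (real^'n \<Rightarrow> real) \<Rightarrow> real^'n \<Rightarrow> real" where
  "iter_pd [] f = f"
| "iter_pd (i # is) f = (\<lambda>x. deriv (\<lambda>t. iter_pd is f (x + t *\<^sub>R axis i 1)) 0)"

definition smooth_fun :: "(real^'n::finite \<Rightarrow> real) \<Rightarrow> bool" where
  "smooth_fun f \<longleftrightarrow>
     (\<forall>is. continuous_on UNIV (iter_pd is f)) \<and>
     (\<forall>is x i. (\<lambda>t. iter_pd is f (x + t *\<^sub>R axis i 1)) differentiable (at 0))"

definition tsupp :: "(real^'n::finite \<Rightarrow> real) \<Rightarrow> (real^'n) set" where
  "tsupp f = closure {x. f x \<noteq> 0}"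

definition test_fun :: "(real^'n::finite) set \<Rightarrow> (real^'n \<Rightarrow> real) \<Rightarrow> bool" where
  "test_fun \<Omega> \<phi> \<longleftrightarrow> smooth_fun \<phi> \<and> compact (tsupp \<phi>) \<and> tsupp \<phi> \<subseteq> \<Omega>"

definition grad_fun :: "(real^'n::finite \<Rightarrow> real) \<Rightarrow> real^'n \<Rightarrow> real^'n" where
  "grad_fun \<phi> x = (\<chi> i. iter_pd [i] \<phi> x)"

definition Lp_fun :: "(real^'n::finite) set \<Rightarrow> real \<Rightarrow> (real^'n \<Rightarrow> real) \<Rightarrow> bool" where
  "Lp_fun \<Omega> p f \<longleftrightarrow> set_borel_measurable lebesgue \<Omega> f \<and>
     set_integrable lebesgue \<Omega> (\<lambda>x. \<bar>f x\<bar> powr p)"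

definition weak_grad :: "(real^'n::finite) set \<Rightarrow> (real^'n \<Rightarrow> real) \<Rightarrow> (real^'n \<Rightarrow> real^'n) \<Rightarrow> bool" where
  "weak_grad \<Omega> f Df \<longleftrightarrow>
     (\<forall>\<phi>. test_fun \<Omega> \<phi> \<longrightarrow> (\<forall>i.
        set_integrable lebesgue \<Omega> (\<lambda>x. f x * iter_pd [i] \<phi> x) \<and>
        set_integrable lebesgue \<Omega> (\<lambda>x. Df x $ i * \<phi> x) \<and>
        (LINT x:\<Omega>|lebesgue. f x * iter_pd [i] \<phi> x) = - (LINT x:\<Omega>|lebesgue. Df x $ i * \<phi> x)))"

definition W1p :: "(real^'n::finite) set \<Rightarrow> real \<Rightarrow> (real^'n \<Rightarrow> real) \<Rightarrow> (real^'n \<Rightarrow> real^'n) \<Rightarrow> bool" where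
  "W1p \<Omega> p f Df \<longleftrightarrow> Lp_fun \<Omega> p f \<and> set_borel_measurable lebesgue \<Omega> Df \<and>
     Lp_fun \<Omega> p (\<lambda>x. norm (Df x)) \<and> weak_grad \<Omega> f Df"

definition W01p :: "(real^'n::finite) set \<Rightarrow> real \<Rightarrow> (real^'n \<Rightarrow> real) \<Rightarrow> (real^'n \<Rightarrow> real^'n) \<Rightarrow> bool" where
  "W01p \<Omega> p f Df \<longleftrightarrow> W1p \<Omega> p f Df \<and>
     (\<exists>\<phi>::nat \<Rightarrow> real^'n \<Rightarrow> real. (\<forall>n. test_fun \<Omega> (\<phi> n)) \<and>
        (\<lambda>n. LINT x:\<Omega>|lebesgue. \<bar>\<phi> n x - f x\<bar> powr p) \<longlonglongrightarrow> 0 \<and>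
        (\<lambda>n. LINT x:\<Omega>|lebesgue. norm (grad_fun (\<phi> n) x - Df x) powr p) \<longlonglongrightarrow> 0)"

definition Linf_fun :: "(real^'n::finite) set \<Rightarrow> (real^'n \<Rightarrow> real) \<Rightarrow> bool" where
  "Linf_fun \<Omega> f \<longleftrightarrow> set_borel_measurable lebesgue \<Omega> f \<and>
     (\<exists>C. AE x in lebesgue. x \<in> \<Omega> \<longrightarrow> \<bar>f x\<bar> \<le> C)"

end

theory Submission
  imports Defs
begin

text \<open>
  Testing the \<open>k\<close>-th equation with the truncation \<open>sgn(u\<^sub>k) min((\<bar>u\<^sub>k\<bar> - h)\<^sup>+, m)\<close>, \<open>h \<ge> R\<close>, the term with
  \<open>D\<^sub>sA\<^sub>k\<close> has a sign by (a.3), so the Sobolev inequality and \<open>m \<rightarrow> \<infinity>\<close> give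
  \<open>\<integral> ((\<bar>u\<^sub>k\<bar> - h)\<^sup>+) powr q\<^sub>k \<le> K (\<nu>\<^sup>-\<^sup>1 \<integral> \<bar>g\<^sub>k(x,u)\<bar> (\<bar>u\<^sub>k\<bar> - h)\<^sup>+) powr (q\<^sub>k/p\<^sub>k)\<close>.
  With the levels \<open>h\<^sub>k\<^sub>,\<^sub>n = L powr (1/q\<^sub>k) (2 - 2 powr (-n))\<close> condition (g.1) bounds the right-hand side by
  \<open>U\<^sub>n = \<Sum>\<^sub>k \<integral> ((\<bar>u\<^sub>k\<bar> - h\<^sub>k\<^sub>,\<^sub>n)\<^sup>+) powr q\<^sub>k\<close>, which yields
  \<open>U\<^sub>n\<^sub>+\<^sub>1 \<le> C b\<^sup>n U\<^sub>n powr (1 + \<delta>)\<close> with constants independent of \<open>L\<close>, because \<open>q\<^sub>k > p\<^sub>k\<close>. Since \<open>U\<^sub>0 \<rightarrow> 0\<close> as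
  \<open>L \<rightarrow> \<infinity>\<close>, the sequence \<open>U\<^sub>n\<close> tends to 0 for large \<open>L\<close>, so that \<open>\<bar>u\<^sub>k\<bar> \<le> 2 L powr (1/q\<^sub>k)\<close>.

  The truncations are limits of analytic functions of \<open>u\<^sub>k\<close>, and an analytic function vanishing at 0
  maps the approximating test functions to test functions; no chain rule for weak gradients
  is needed. The subcritical Sobolev inequality follows by averaging
  \<open>\<phi>(x) = - \<integral>\<^sub>0\<^sup>T \<nabla>\<phi>(x + tz) \<bullet> z dt\<close> over \<open>z\<close> in a ball that avoids the origin.
\<close>

section \<open>Smooth functions and directional derivatives\<close>

text \<open>The coefficient of the test function in the D_sA_k term is only integrable, being of
  size \<open>norm (Du k x) powr p k\<close>. Limits of test functions therefore pass through the
  equation only when they are uniformly bounded, and this forces the cap \<open>m\<close> on top of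
  the cut at \<open>h\<close>. The estimate obtained is uniform in the cap, so the cap can be
  removed afterwards. Condition (g.1) couples the components, so none of them can be iterated alone:
  the product of g_k with the excess of u_k is controlled only by the sum over all components. What
  makes this work is the special exponent: \<open>q j * (q k - 1) / q k\<close> turns the powers of
  \<open>\<bar>u j\<bar>\<close> into powers of \<open>\<bar>u j\<bar> powr q j\<close> with the
  same exponent \<open>(q k - 1) / q k\<close> for every \<open>j\<close>, and this exponent is
  complementary to the \<open>1 / q k\<close> of the excess. The product is then linear in the
  quantity that is summed. The strict bound of q_k by the critical exponent enters as integrability
  at \<open>t = 0\<close> of a power of \<open>t\<close> in the averaged ray representation.\<close>

declare iter_pd.simps(2) [simp del]

lemma smooth_fun_continuous: "smooth_fun f \<Longrightarrow> continuous_on UNIV f"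
  unfolding smooth_fun_def by (metis iter_pd.simps(1))

lemma smooth_fun_continuous_partial: "smooth_fun f \<Longrightarrow> continuous_on UNIV (iter_pd [i] f)"
  unfolding smooth_fun_def by blast

lemma smooth_fun_continuous_grad: "smooth_fun f \<Longrightarrow> continuous_on UNIV (grad_fun f)"
  unfolding grad_fun_def
  by (rule continuous_on_vec_lambda) (metis smooth_fun_continuous_partial)

lemma has_real_derivative_iter_pd:
  assumes "smooth_fun f"
  shows "((\<lambda>t. iter_pd is f (x + t *\<^sub>R axis i 1)) has_real_derivative iter_pd (i # is) f x) (at 0)"
proof -
  have "(\<lambda>t. iter_pd is f (x + t *\<^sub>R axis i 1)) differentiable at 0"
    using assms unfolding smooth_fun_def by blast
  then show ?thesis by (simp add: DERIV_deriv_iff_real_differentiable iter_pd.simps(2))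
qed

lemma has_real_derivative_along_axis:
  assumes "smooth_fun f"
  shows "((\<lambda>t. f (x + t *\<^sub>R axis i 1)) has_real_derivative iter_pd [i] f (x + s *\<^sub>R axis i 1)) (at s)"
proof -
  have "((\<lambda>t. f (x + s *\<^sub>R axis i 1 + t *\<^sub>R axis i 1)) has_real_derivative
      iter_pd [i] f (x + s *\<^sub>R axis i 1)) (at (s - s))"
    using has_real_derivative_iter_pd[OF assms, of "[]"] by simp
  then have "((\<lambda>t. f (x + s *\<^sub>R axis i 1 + (t - s) *\<^sub>R axis i 1)) has_real_derivative
      iter_pd [i] f (x + s *\<^sub>R axis i 1)) (at s)"
    using DERIV_shift[of "\<lambda>t. f (x + s *\<^sub>R axis i 1 + t *\<^sub>R axis i 1)" _ s "-s"] by simp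
  moreover have "x + s *\<^sub>R axis i 1 + (t - s) *\<^sub>R axis i 1 = x + t *\<^sub>R axis i 1" for t
    by (simp add: algebra_simps)
  ultimately show ?thesis by simp
qed

text \<open>The increment is taken one coordinate at a time. Each move along an axis is a
  one-dimensional mean value estimate, and every intermediate point differs from \<open>x\<close>
  componentwise by at most \<open>h\<close>, so the closeness of the partial derivatives applies
  there. The set \<open>I\<close> records the coordinates already moved.\<close>

lemma smooth_fun_partial_increment:
  fixes f :: "real^'n::finite \<Rightarrow> real"
  assumes f: "smooth_fun f"
    and close: "\<And>i y. norm (y - x) \<le> norm h \<Longrightarrow> \<bar>iter_pd [i] f y - iter_pd [i] f x\<bar> \<le> e"
    and "finite I"
  shows "\<bar>f (x + (\<Sum>i\<in>I. h $ i *\<^sub>R axis i 1)) - f x - (\<Sum>i\<in>I. iter_pd [i] f x * h $ i)\<bar>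
      \<le> e * card I * norm h"
  using \<open>finite I\<close>
proof induction
  case empty
  then show ?case by simp
next
  case (insert i I)
  define y where "y = x + (\<Sum>i\<in>I. h $ i *\<^sub>R axis i 1)"
  define G where "G = (\<lambda>s. f (y + s *\<^sub>R axis i 1) - s * iter_pd [i] f x)"
  have e0: "e \<ge> 0" using close[of x i] by simp
  have "norm (G (h $ i) - G 0) \<le> e * norm (h $ i - 0)"
  proof (rule field_differentiable_bound[of "closed_segment 0 (h $ i)" G
          "\<lambda>s. iter_pd [i] f (y + s *\<^sub>R axis i 1) - iter_pd [i] f x"])
    fix s assume s: "s \<in> closed_segment 0 (h $ i)"
    then show "(G has_field_derivative (iter_pd [i] f (y + s *\<^sub>R axis i 1) - iter_pd [i] f x))
        (at s within closed_segment 0 (h $ i))"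
      unfolding G_def
      using DERIV_diff[OF has_real_derivative_along_axis[OF f] DERIV_cmult_right[OF DERIV_ident, of "iter_pd [i] f x"]]
      by (simp add: has_field_derivative_at_within)
    have s': "\<bar>s\<bar> \<le> \<bar>h $ i\<bar>" using s by (auto simp: closed_segment_eq_real_ivl split: if_splits)
    have "norm (y + s *\<^sub>R axis i 1 - x) \<le> norm h"
    proof (rule norm_le_componentwise_cart)
      fix j
      have "(y + s *\<^sub>R axis i 1 - x) $ j = (if j \<in> I then h $ j else 0) + (if i = j then s else 0)"
        unfolding y_def using insert
        by (simp add: axis_def sum_component if_distrib[of "(*) _"] sum.delta cong: if_cong)
      then show "norm ((y + s *\<^sub>R axis i 1 - x) $ j) \<le> norm (h $ j)"
        using insert s' by auto
    qed
    then show "norm (iter_pd [i] f (y + s *\<^sub>R axis i 1) - iter_pd [i] f x) \<le> e"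
      using close by simp
  qed auto
  also have "\<dots> \<le> e * norm h" using component_le_norm_cart[of h i] e0 by (simp add: mult_left_mono)
  finally have "\<bar>f (y + h $ i *\<^sub>R axis i 1) - f y - iter_pd [i] f x * h $ i\<bar> \<le> e * norm h"
    unfolding G_def by (simp add: algebra_simps)
  then show ?case using insert unfolding y_def
    by (simp add: algebra_simps)
qed

lemma smooth_fun_has_derivative:
  fixes f :: "real^'n::finite \<Rightarrow> real"
  assumes f: "smooth_fun f"
  shows "(f has_derivative (\<lambda>h. grad_fun f x \<bullet> h)) (at x)"
proof -
  have "((\<lambda>y. norm (f y - f x - grad_fun f x \<bullet> (y - x)) / norm (y - x)) \<longlongrightarrow> 0) (at x)"
  proof (rule tendstoI)
    fix e :: real assume "e > 0"
    \<comment> \<open>The \<open>CARD('n)\<close> coordinate moves contribute \<open>e'\<close>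
      each, in total \<open>e / 2\<close> times the length of the increment; the spare half makes
      the final inequality strict.\<close>
    define e' where "e' = e / (2 * real CARD('n))"
    have e': "e' > 0" using \<open>e > 0\<close> by (simp add: e'_def)
    have "\<forall>\<^sub>F y in nhds x. \<forall>i. dist (iter_pd [i] f y) (iter_pd [i] f x) < e'"
    proof (rule eventually_all_finite)
      fix i
      have "isCont (iter_pd [i] f) x"
        using smooth_fun_continuous_partial[OF f, of i] by (simp add: continuous_on_eq_continuous_at)
      then show "\<forall>\<^sub>F y in nhds x. dist (iter_pd [i] f y) (iter_pd [i] f x) < e'"
        using e' unfolding isCont_def tendsto_at_iff_tendsto_nhds by (rule tendstoD)
    qed
    then obtain d where d: "d > 0"
      "\<And>y i. dist y x < d \<Longrightarrow> dist (iter_pd [i] f y) (iter_pd [i] f x) < e'"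
      unfolding eventually_nhds_metric by blast
    have "norm (norm (f y - f x - grad_fun f x \<bullet> (y - x)) / norm (y - x)) < e"
      if y: "y \<noteq> x" "dist y x < d" for y
    proof -
      define h where "h = y - x"
      have h: "(\<Sum>i\<in>UNIV. h $ i *\<^sub>R axis i 1) = h"
        by (simp add: basis_expansion flip: scalar_mult_eq_scaleR)
      have "\<bar>f (x + (\<Sum>i\<in>UNIV. h $ i *\<^sub>R axis i 1)) - f x - (\<Sum>i\<in>UNIV. iter_pd [i] f x * h $ i)\<bar>
          \<le> e' * card (UNIV :: 'n set) * norm h"
        using y by (intro smooth_fun_partial_increment[OF f])
          (auto simp: h_def dist_norm intro!: less_imp_le[OF d(2)[unfolded dist_real_def]])
      then have "\<bar>f y - f x - grad_fun f x \<bullet> h\<bar> \<le> e' * CARD('n) * norm h"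
        unfolding h by (simp add: h_def inner_vec_def grad_fun_def)
      also have "\<dots> < e * norm h" using y \<open>e > 0\<close> by (simp add: e'_def h_def)
      finally show ?thesis using y by (simp add: h_def field_simps)
    qed
    then show "\<forall>\<^sub>F y in at x. dist (norm (f y - f x - grad_fun f x \<bullet> (y - x)) / norm (y - x)) 0 < e"
      unfolding eventually_at using d(1) by auto
  qed
  then show ?thesis
    by (simp add: has_derivative_iff_norm bounded_linear_inner_right)
qed

lemma smooth_fun_has_directional_derivative:
  fixes f :: "real^'n::finite \<Rightarrow> real"
  assumes "smooth_fun f"
  shows "((\<lambda>t. f (x + t *\<^sub>R z)) has_real_derivative grad_fun f (x + s *\<^sub>R z) \<bullet> z) (at s)"
proof -
  have "((f \<circ> (\<lambda>t. x + t *\<^sub>R z)) has_derivative (\<lambda>h. grad_fun f (x + s *\<^sub>R z) \<bullet> h) \<circ> (\<lambda>t. t *\<^sub>R z)) (at s)"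
    by (intro diff_chain_at smooth_fun_has_derivative[OF assms]) (auto intro!: derivative_eq_intros)
  moreover have "(\<lambda>h. grad_fun f (x + s *\<^sub>R z) \<bullet> h) \<circ> (\<lambda>t. t *\<^sub>R z) = (*) (grad_fun f (x + s *\<^sub>R z) \<bullet> z)"
    by (auto simp: o_def)
  ultimately show ?thesis
    by (simp add: o_def has_field_derivative_def)
qed

lemma partial_eqI:
  assumes "((\<lambda>t. f (x + t *\<^sub>R axis i 1)) has_real_derivative D) (at 0)"
  shows "iter_pd [i] f x = D"
  using DERIV_imp_deriv[OF assms] by (simp add: iter_pd.simps(2))

text \<open>Smoothness quantifies over all iterated partial derivatives, for which composites have
  no manageable closed form. A set of continuous functions closed under partial derivatives contains
  all of them at once.\<close>

lemma smooth_funI_coinduct: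
  assumes f: "f \<in> S"
    and cont: "\<And>g. g \<in> S \<Longrightarrow> continuous_on UNIV g"
    and partial: "\<And>g i. g \<in> S \<Longrightarrow>
      \<exists>g'\<in>S. \<forall>x. ((\<lambda>t. g (x + t *\<^sub>R axis i 1)) has_real_derivative g' x) (at 0)"
  shows "smooth_fun f"
proof -
  have S: "iter_pd is f \<in> S" for "is"
  proof (induction "is")
    case Nil
    then show ?case using f by simp
  next
    case (Cons i "is")
    then obtain g' where g': "g' \<in> S"
      "\<And>x. ((\<lambda>t. iter_pd is f (x + t *\<^sub>R axis i 1)) has_real_derivative g' x) (at 0)"
      using partial by blast
    then have "iter_pd (i # is) f = g'" by (auto simp: iter_pd.simps(2) intro!: DERIV_imp_deriv)
    then show ?case using g' by simp
  qed
  then show ?thesis unfolding smooth_fun_def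
    using cont partial[OF S] by (meson real_differentiable_def)
qed

section \<open>The Sobolev inequality for test functions\<close>

text \<open>Convexity of the power, deduced from Young's inequality with the exponents
  \<open>q\<close> and \<open>q / (q - 1)\<close>, so that the boundary point 0 needs no
  differentiation.\<close>

lemma powr_above_tangent:
  fixes y m q :: real
  assumes "q > 1" "y \<ge> 0" "m \<ge> 0"
  shows "m powr q + q * m powr (q - 1) * (y - m) \<le> y powr q"
proof -
  have "y * m powr (q - 1) \<le> y powr q / q + (m powr (q - 1)) powr (q / (q - 1)) / (q / (q - 1))"
    using assms by (intro Youngs_inequality) (auto simp: field_simps)
  also have "(m powr (q - 1)) powr (q / (q - 1)) = m powr q"
    using assms by (simp add: powr_powr)
  finally have "q * (y * m powr (q - 1)) \<le> q * (y powr q / q + m powr q / (q / (q - 1)))"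
    using assms by (intro mult_left_mono) auto
  also have "\<dots> = y powr q + (q - 1) * m powr q"
    using assms by (simp add: field_simps)
  also have "m powr q = m powr (q - 1) * m"
    using assms by (cases "m = 0") (auto simp: powr_diff)
  finally show ?thesis
    using \<open>m powr q = m powr (q - 1) * m\<close> by (simp add: algebra_simps)
qed

text \<open>Jensen's inequality for a measure that is not normalised: the tangent inequality is
  integrated at the mean value \<open>I / V\<close>, where the linear term vanishes. A null space
  has no mean and is treated apart.\<close>

lemma (in finite_measure) integral_powr_le:
  fixes f :: "'a \<Rightarrow> real"
  assumes q: "q > 1" and f: "integrable M f" "integrable M (\<lambda>x. f x powr q)" and nonneg: "\<And>x. f x \<ge> 0"
  shows "(\<integral>x. f x \<partial>M) powr q \<le> measure M (space M) powr (q - 1) * (\<integral>x. f x powr q \<partial>M)"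
proof -
  define V where "V = measure M (space M)"
  define I where "I = (\<integral>x. f x \<partial>M)"
  have I0: "I \<ge> 0" unfolding I_def using nonneg by simp
  consider "V = 0" | "V > 0" unfolding V_def by (metis measure_nonneg less_eq_real_def)
  then show ?thesis
  proof cases
    case 1
    then have "emeasure M (space M) = 0" unfolding V_def by (simp add: emeasure_eq_measure)
    then have "AE x in M. f x = 0" by (auto intro!: AE_I[where N="space M"])
    then have "I = 0" unfolding I_def by (subst integral_cong_AE[where g="\<lambda>_. 0"]) (use f in auto)
    then show ?thesis using q nonneg by (simp add: I_def)
  next
    case 2
    define m where "m = I / V"
    have m: "m \<ge> 0" "I = m * V" using 2 I0 by (auto simp: m_def)
    have "(\<integral>x. m powr q + q * m powr (q - 1) * (f x - m) \<partial>M) \<le> (\<integral>x. f x powr q \<partial>M)"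
      using f q nonneg m by (intro integral_mono powr_above_tangent) auto
    also have "(\<integral>x. m powr q + q * m powr (q - 1) * (f x - m) \<partial>M) = m powr q * V"
      using f m by (simp add: V_def[symmetric] I_def[symmetric])
    finally have "V powr (q - 1) * (m powr q * V) \<le> V powr (q - 1) * (\<integral>x. f x powr q \<partial>M)"
      by (intro mult_left_mono) auto
    moreover have "V powr (q - 1) * (m powr q * V) = I powr q"
      using m 2 by (simp add: powr_mult powr_diff)
    ultimately show ?thesis by (simp add: V_def I_def)
  qed
qed

lemma nn_integral_powr_interval:
  fixes T b :: real
  assumes "T > 0" "b > -1"
  shows "(\<integral>\<^sup>+t. ennreal (indicator {0<..<T} t * t powr b) \<partial>lborel) = ennreal (T powr (b + 1) / (b + 1))"
proof -
  have "((\<lambda>t. t powr b) has_integral (T powr (b + 1) / (b + 1))) {0..T}"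
    using assms by (intro has_integral_powr_from_0) auto
  then have "((\<lambda>t. t powr b) has_integral (T powr (b + 1) / (b + 1))) {0<..<T}"
    by (simp add: has_integral_Icc_iff_Ioo)
  then have "((\<lambda>t. indicator {0<..<T} t * t powr b) has_integral (T powr (b + 1) / (b + 1))) UNIV"
    by (subst (asm) has_integral_restrict_UNIV[symmetric])
       (auto elim!: back_subst[where P="\<lambda>f. (f has_integral _) UNIV"] simp: fun_eq_iff indicator_def)
  then show ?thesis by (intro nn_integral_has_integral_lborel) auto
qed

text \<open>Jensen's inequality for the measure with density \<open>t powr - \<kappa>\<close>,
  applied to \<open>b t * t powr \<kappa>\<close>. The gain is the factor
  \<open>t powr (\<kappa> * (q - 1))\<close>, which later compensates the singularity at
  \<open>t = 0\<close> created by averaging over small balls. The bound \<open>B\<close> serves only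
  integrability and does not enter the constant.\<close>

lemma weighted_integral_powr_le:
  fixes b :: "real \<Rightarrow> real"
  assumes T: "T > 0" and k: "0 \<le> \<kappa>" "\<kappa> < 1" and q: "q > 1"
    and meas[measurable]: "b \<in> borel_measurable borel"
    and b: "\<And>t. 0 \<le> b t" "\<And>t. b t \<le> B"
  shows "(LINT t:{0<..<T}|lborel. b t) powr q
     \<le> (T powr (1 - \<kappa>) / (1 - \<kappa>)) powr (q - 1) * (LINT t:{0<..<T}|lborel. t powr (\<kappa> * (q - 1)) * b t powr q)"
proof -
  define W where "W = T powr (1 - \<kappa>) / (1 - \<kappa>)"
  define M where "M = density lborel (\<lambda>t. ennreal (indicator {0<..<T} t * t powr - \<kappa>))"
  have W: "W \<ge> 0" unfolding W_def using k by simp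
  have em: "emeasure M (space M) = ennreal W"
    unfolding M_def W_def using nn_integral_powr_interval[of T "- \<kappa>"] T k
    by (simp add: emeasure_density)
  interpret M: finite_measure M by standard (simp add: em)
  have [measurable_cong]: "sets M = sets borel" by (simp add: M_def)
  have mV: "measure M (space M) = W" using em W by (simp add: measure_def)
  define f where "f = (\<lambda>t. indicator {0<..<T} t * (b t * t powr \<kappa>))"
  have B: "B \<ge> 0" using b order_trans by blast
  have [measurable]: "f \<in> borel_measurable M" by (simp add: f_def)
  have f: "0 \<le> f t" "f t \<le> B * T powr \<kappa>" for t
    using b[of t] B T k by (auto simp: f_def indicator_def intro!: mult_mono powr_mono2)
  have "(\<integral>t. f t \<partial>M) powr q \<le> measure M (space M) powr (q - 1) * (\<integral>t. f t powr q \<partial>M)"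
  proof (rule M.integral_powr_le[OF q])
    show "integrable M f" by (rule M.integrable_const_bound[where B="B * T powr \<kappa>"]) (use f in auto)
    show "integrable M (\<lambda>t. f t powr q)"
      by (rule M.integrable_const_bound[where B="(B * T powr \<kappa>) powr q"]) (use f q in \<open>auto intro!: powr_mono2\<close>)
  qed (use f in auto)
  moreover have "(\<integral>t. f t \<partial>M) = (LINT t:{0<..<T}|lborel. b t)"
    unfolding M_def set_lebesgue_integral_def
    by (subst integral_density)
       (auto intro!: Bochner_Integration.integral_cong simp: f_def indicator_def powr_minus)
  moreover have "(\<integral>t. f t powr q \<partial>M) = (LINT t:{0<..<T}|lborel. t powr (\<kappa> * (q - 1)) * b t powr q)"
    unfolding M_def set_lebesgue_integral_def
    by (subst integral_density)
       (auto intro!: Bochner_Integration.integral_cong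
             simp: f_def indicator_def powr_mult powr_powr b algebra_simps simp flip: powr_add)
  ultimately show ?thesis unfolding mV W_def by simp
qed

lemma nn_integral_lborel_affine:
  fixes f :: "'a::euclidean_space \<Rightarrow> ennreal"
  assumes [measurable]: "f \<in> borel_measurable borel" and t: "t > 0"
  shows "(\<integral>\<^sup>+z. f (x + t *\<^sub>R z) \<partial>lborel) = ennreal (t powr - real DIM('a)) * (\<integral>\<^sup>+z. f z \<partial>lborel)"
proof -
  have "(\<integral>\<^sup>+z. f z \<partial>lborel) = ennreal (t ^ DIM('a)) * (\<integral>\<^sup>+z. f (x + t *\<^sub>R z) \<partial>lborel)"
    using t by (subst lborel_affine[of t x])
      (auto simp: nn_integral_density nn_integral_distr nn_integral_cmult)
  then have "ennreal (t powr - real DIM('a)) * (\<integral>\<^sup>+z. f z \<partial>lborel)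
      = ennreal (t powr - real DIM('a) * t ^ DIM('a)) * (\<integral>\<^sup>+z. f (x + t *\<^sub>R z) \<partial>lborel)"
    using t by (simp add: ennreal_mult mult.assoc)
  also have "t powr - real DIM('a) * t ^ DIM('a) = 1"
    using t by (simp add: powr_minus powr_realpow)
  finally show ?thesis by simp
qed

section \<open>Integrability and supports of test functions\<close>

lemma continuous_compact_support_bounded:
  fixes f :: "'a::euclidean_space \<Rightarrow> 'b::real_normed_vector"
  assumes "continuous_on UNIV f" "compact K" "\<And>x. x \<notin> K \<Longrightarrow> f x = 0"
  obtains B where "B \<ge> 0" "\<And>x. norm (f x) \<le> B"
proof -
  have "bounded (f ` K)"
    using assms by (intro compact_imp_bounded compact_continuous_image) (auto intro: continuous_on_subset)
  then obtain B where "\<And>x. x \<in> K \<Longrightarrow> norm (f x) \<le> B" by (auto simp: bounded_iff)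
  then have "norm (f x) \<le> max B 0" for x using assms(3)[of x] by (cases "x \<in> K") force+
  then show ?thesis using that[of "max B 0"] by simp
qed

lemma continuous_compact_support_integrable:
  fixes f :: "'a::euclidean_space \<Rightarrow> real"
  assumes "continuous_on UNIV f" "compact K" "\<And>x. x \<notin> K \<Longrightarrow> f x = 0"
  shows "integrable lborel f"
proof -
  obtain B where B: "\<And>x. norm (f x) \<le> B" using continuous_compact_support_bounded[OF assms] by metis
  have [measurable]: "K \<in> sets borel" "f \<in> borel_measurable borel"
    using assms by (auto intro: borel_compact borel_measurable_continuous_onI)
  have "integrable lborel (\<lambda>x. indicat_real K x * B)"
    using emeasure_compact_finite[OF assms(2)] by (intro integrable_mult_left integrable_real_indicator) auto
  then show ?thesis
  proof (rule Bochner_Integration.integrable_bound)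
    have "norm (f x) \<le> norm (indicat_real K x * B)" for x
      using B[of x] assms(3)[of x] by (cases "x \<in> K") auto
    then show "AE x in lborel. norm (f x) \<le> norm (indicat_real K x * B)" by simp
  qed simp
qed

lemma test_fun_smooth: "test_fun \<Omega> \<phi> \<Longrightarrow> smooth_fun \<phi>"
  and test_fun_compact: "test_fun \<Omega> \<phi> \<Longrightarrow> compact (tsupp \<phi>)"
  and test_fun_subset: "test_fun \<Omega> \<phi> \<Longrightarrow> tsupp \<phi> \<subseteq> \<Omega>"
  by (auto simp: test_fun_def)

lemma eq_0_outside_tsupp: "x \<notin> tsupp \<phi> \<Longrightarrow> \<phi> x = 0"
  unfolding tsupp_def using closure_subset[of "{x. \<phi> x \<noteq> 0}"] by blast

lemma grad_eq_0_outside_tsupp: 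
  assumes "x \<notin> tsupp \<phi>"
  shows "grad_fun \<phi> x = 0"
proof -
  have "iter_pd [i] \<phi> x = 0" for i
  proof (rule partial_eqI)
    have "open (- tsupp \<phi>)" by (auto simp: tsupp_def)
    then obtain e where e: "e > 0" "\<And>y. dist y x < e \<Longrightarrow> y \<notin> tsupp \<phi>"
      using assms unfolding open_dist by (metis ComplD ComplI)
    have "((\<lambda>t. 0) has_real_derivative 0) (at (0::real))" by simp
    then show "((\<lambda>t. \<phi> (x + t *\<^sub>R axis i 1)) has_real_derivative 0) (at 0)"
      by (rule has_field_derivative_transform_within[OF _ \<open>e > 0\<close>])
         (simp_all add: eq_0_outside_tsupp e dist_norm)
  qed
  then show ?thesis by (simp add: grad_fun_def vec_eq_iff)
qed

lemma test_fun_continuous: "test_fun \<Omega> \<phi> \<Longrightarrow> continuous_on UNIV \<phi>"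
  and test_fun_continuous_grad: "test_fun \<Omega> \<phi> \<Longrightarrow> continuous_on UNIV (grad_fun \<phi>)"
  by (auto simp: test_fun_def intro: smooth_fun_continuous smooth_fun_continuous_grad)

lemma powr_le_if_powr_le_powr:
  fixes a b p r :: real
  assumes "a powr p \<le> b" "a \<ge> 0" "p > 0" "r \<ge> 0"
  shows "a powr r \<le> b powr (r / p)"
proof -
  have "a powr r = (a powr p) powr (r / p)" using assms by (simp add: powr_powr)
  also have "\<dots> \<le> b powr (r / p)" using assms by (intro powr_mono2) auto
  finally show ?thesis .
qed

text \<open>The average \<open>a\<close> over \<open>z\<close> is split as
  \<open>a powr (q - p) * a powr p\<close>. Jensen bounds \<open>a powr p\<close> by the averaged
  p-th power. In the first factor this average is enlarged to the integral over the whole space, at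
  the price \<open>t powr - N\<close> of the change of variables, with \<open>N\<close> the
  dimension; in the second it is kept, since integrating it over \<open>x\<close> later produces no
  further power of \<open>t\<close>.\<close>

lemma average_powr_le:
  fixes F :: "'a::euclidean_space \<Rightarrow> real"
  assumes F: "continuous_on UNIV F" "compact K" "\<And>x. x \<notin> K \<Longrightarrow> F x = 0" "\<And>x. F x \<ge> 0"
    and E: "finite_measure nE" "nE = density lborel (indicator E)" "E \<in> sets borel"
    and p: "1 < p" "p < q" and t: "t > 0"
  shows "(\<integral>z. F (x + t *\<^sub>R z) \<partial>nE) powr q
     \<le> (measure nE (space nE) powr (p - 1)) powr (q / p) * (\<integral>y. F y powr p \<partial>lborel) powr ((q - p) / p)
        * t powr (- real DIM('a) * (q - p) / p) * (\<integral>z. F (x + t *\<^sub>R z) powr p \<partial>nE)"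
proof -
  interpret nE: finite_measure nE by fact
  define a S V J where "a = (\<integral>z. F (x + t *\<^sub>R z) \<partial>nE)" and "S = (\<integral>z. F (x + t *\<^sub>R z) powr p \<partial>nE)"
    and "V = measure nE (space nE) powr (p - 1)" and "J = (\<integral>y. F y powr p \<partial>lborel)"
  obtain B where B: "B \<ge> 0" "\<And>x. norm (F x) \<le> B" using continuous_compact_support_bounded[OF F(1-3)] by metis
  have [measurable]: "F \<in> borel_measurable borel" using F by (intro borel_measurable_continuous_onI)
  have [measurable_cong]: "sets nE = sets borel" by (simp add: E)
  have iJ: "integrable lborel (\<lambda>y. F y powr p)"
    by (rule continuous_compact_support_integrable[of _ K])
       (use F p in \<open>auto intro: continuous_on_powr' continuous_on_const\<close>)
  have iS: "integrable nE (\<lambda>z. F (x + t *\<^sub>R z) powr p)"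
    by (rule nE.integrable_const_bound[where B="B powr p"])
       (use F B p in \<open>auto intro!: powr_mono2 simp: abs_le_iff\<close>)
  have ia: "integrable nE (\<lambda>z. F (x + t *\<^sub>R z))"
    by (rule nE.integrable_const_bound[where B=B]) (use B in auto)
  have nn: "a \<ge> 0" "S \<ge> 0" "V \<ge> 0" "J \<ge> 0" using F by (auto simp: a_def S_def V_def J_def)
  have "ennreal S = (\<integral>\<^sup>+z. ennreal (F (x + t *\<^sub>R z) powr p) \<partial>nE)"
    unfolding S_def by (rule nn_integral_eq_integral[symmetric, OF iS]) simp
  also have "\<dots> = (\<integral>\<^sup>+z. indicator E z * ennreal (F (x + t *\<^sub>R z) powr p) \<partial>lborel)"
    using E(3) unfolding E(2) by (subst nn_integral_density) auto
  also have "\<dots> \<le> (\<integral>\<^sup>+z. ennreal (F (x + t *\<^sub>R z) powr p) \<partial>lborel)"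
    by (intro nn_integral_mono) (auto simp: indicator_def)
  also have "\<dots> = ennreal (t powr - real DIM('a)) * (\<integral>\<^sup>+z. ennreal (F z powr p) \<partial>lborel)"
    using t by (intro nn_integral_lborel_affine) auto
  also have "(\<integral>\<^sup>+z. ennreal (F z powr p) \<partial>lborel) = ennreal J"
    unfolding J_def by (rule nn_integral_eq_integral[OF iJ]) simp
  finally have SJ: "S \<le> t powr - real DIM('a) * J"
    using nn by (simp flip: ennreal_mult')
  have aS: "a powr p \<le> V * S"
    unfolding a_def S_def V_def using ia iS F p by (intro nE.integral_powr_le) auto
  have "a powr (q - p) \<le> (V * S) powr ((q - p) / p)"
    using aS nn p by (intro powr_le_if_powr_le_powr) auto
  also have "\<dots> \<le> (V * (t powr - real DIM('a) * J)) powr ((q - p) / p)"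
    using SJ nn p by (intro powr_mono2 mult_left_mono) auto
  finally have "a powr (q - p) * a powr p \<le> (V * (t powr - real DIM('a) * J)) powr ((q - p) / p) * (V * S)"
    using aS by (intro mult_mono) auto
  also have "\<dots> = (V powr ((q - p) / p) * V) * J powr ((q - p) / p) * t powr (- real DIM('a) * (q - p) / p) * S"
    using nn by (simp add: powr_mult powr_powr algebra_simps)
  also have "V powr ((q - p) / p) * V = V powr (q / p)"
  proof (cases "V = 0")
    case False
    then have "V powr ((q - p) / p) * V powr 1 = V powr (q / p)"
      using p unfolding powr_add[symmetric] by (simp add: field_simps)
    then show ?thesis using False nn by simp
  qed simp
  also have "a powr (q - p) * a powr p = a powr q"
    using p by (simp flip: powr_add)
  finally show ?thesis by (simp add: a_def S_def V_def J_def)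
qed

text \<open>Since \<open>norm z \<ge> 1\<close> and the diameter of \<Omega> is below
  \<open>T\<close>, the point \<open>x + T z\<close> lies outside \<Omega>, where
  \<open>\<phi>\<close> vanishes. The fundamental theorem on the ray then bounds
  \<open>\<phi> x\<close>, with the factor 3 coming from \<open>norm z \<le> 3\<close>. Integrating
  over \<open>z\<close> and exchanging the integrals gives the claim.\<close>

lemma test_fun_le_average:
  fixes \<phi> :: "real^'n::finite \<Rightarrow> real"
  assumes \<phi>: "test_fun \<Omega> \<phi>" and T: "T > 0" "\<And>x y. x \<in> \<Omega> \<Longrightarrow> y \<in> \<Omega> \<Longrightarrow> norm (x - y) < T"
    and E: "finite_measure nE" "nE = density lborel (indicator E)" "E \<in> sets borel"
      "\<And>z. z \<in> E \<Longrightarrow> 1 \<le> norm z" "\<And>z. z \<in> E \<Longrightarrow> norm z \<le> 3"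
    and x: "x \<in> \<Omega>"
  shows "measure nE (space nE) * \<bar>\<phi> x\<bar>
    \<le> 3 * (LINT t:{0<..<T}|lborel. (\<integral>z. norm (grad_fun \<phi> (x + t *\<^sub>R z)) \<partial>nE))"
proof -
  interpret nE: finite_measure nE by fact
  interpret P: pair_sigma_finite lborel nE ..
  have [measurable_cong]: "sets nE = sets borel" by (simp add: E)
  note [measurable] = E(3)
  define F where "F = (\<lambda>x. norm (grad_fun \<phi> x))"
  have contF: "continuous_on UNIV F" unfolding F_def
    using test_fun_continuous_grad[OF \<phi>] by (intro continuous_intros)
  then have [measurable]: "F \<in> borel_measurable borel" by (rule borel_measurable_continuous_onI)
  obtain B where B: "B \<ge> 0" "\<And>x. norm (F x) \<le> B"
    using continuous_compact_support_bounded[OF contF test_fun_compact[OF \<phi>]]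
    by (metis F_def grad_eq_0_outside_tsupp norm_zero)
  define a where "a = (\<lambda>t. \<integral>z. F (x + t *\<^sub>R z) \<partial>nE)"
  have [measurable]: "a \<in> borel_measurable borel" unfolding a_def by measurable
  have F0: "F y \<ge> 0" for y by (simp add: F_def)
  have FB: "F y \<le> B" for y using B(2)[of y] F0[of y] by simp
  have ia: "integrable nE (\<lambda>z. F (x + t *\<^sub>R z))" for t
    by (rule nE.integrable_const_bound[where B=B]) (use B in auto)
  have a0: "a t \<ge> 0" for t unfolding a_def using F0 by simp
  have aB: "a t \<le> B * measure nE (space nE)" for t
    unfolding a_def using integral_mono[OF ia[of t], of "\<lambda>_. B"] FB by (simp add: mult.commute)
  have line: "ennreal \<bar>\<phi> x\<bar> \<le> (\<integral>\<^sup>+t. indicator {0<..<T} t * ennreal (3 * F (x + t *\<^sub>R z)) \<partial>lborel)" if z: "z \<in> E" for z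
  proof -
    define f where "f = (\<lambda>t. grad_fun \<phi> (x + t *\<^sub>R z) \<bullet> z)"
    have cf: "continuous_on {0..T} f" unfolding f_def
      by (intro continuous_intros continuous_on_compose2[OF test_fun_continuous_grad[OF \<phi>]]) auto
    have d: "((\<lambda>t. \<phi> (x + t *\<^sub>R z)) has_vector_derivative f t) (at t within {0..T})" for t
      using smooth_fun_has_directional_derivative[OF test_fun_smooth[OF \<phi>], of x z t]
      by (auto simp: f_def has_real_derivative_iff_has_vector_derivative intro: has_vector_derivative_at_within)
    have fF: "\<bar>f t\<bar> \<le> 3 * F (x + t *\<^sub>R z)" for t
      using Cauchy_Schwarz_ineq2[of "grad_fun \<phi> (x + t *\<^sub>R z)" z] mult_left_mono[OF E(5)[OF z] F0[of "x + t *\<^sub>R z"]]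
      by (simp add: f_def F_def mult.commute)
    have "norm ((x + T *\<^sub>R z) - x) \<ge> T" using E(4)[OF z] T by simp
    then have "x + T *\<^sub>R z \<notin> \<Omega>" using T(2)[OF _ x] by force
    then have "\<phi> (x + T *\<^sub>R z) = 0" using test_fun_subset[OF \<phi>] by (auto intro: eq_0_outside_tsupp)
    then have I: "integrable lborel (\<lambda>t. indicator {0..T} t *\<^sub>R f t)" "(\<integral>t. indicator {0..T} t *\<^sub>R f t \<partial>lborel) = - \<phi> x"
      using has_bochner_integral_FTC_Icc[OF less_imp_le[OF T(1)] d cf]
      by (auto simp: has_bochner_integral_iff)
    then have "\<bar>\<phi> x\<bar> \<le> (\<integral>t. norm (indicator {0..T} t *\<^sub>R f t) \<partial>lborel)"
      using integral_norm_bound[of lborel "\<lambda>t. indicator {0..T} t *\<^sub>R f t"] by simp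
    then have "ennreal \<bar>\<phi> x\<bar> \<le> (\<integral>\<^sup>+t. ennreal (norm (indicator {0..T} t *\<^sub>R f t)) \<partial>lborel)"
      by (subst nn_integral_eq_integral[OF integrable_norm[OF I(1)]]) (auto intro: ennreal_leI)
    also have "\<dots> \<le> (\<integral>\<^sup>+t. indicator {0<..<T} t * ennreal (3 * F (x + t *\<^sub>R z)) \<partial>lborel)"
    proof (rule nn_integral_mono_AE)
      show "AE t in lborel. ennreal (norm (indicator {0..T} t *\<^sub>R f t))
          \<le> indicator {0<..<T} t * ennreal (3 * F (x + t *\<^sub>R z))"
        using AE_lborel_singleton[of 0] AE_lborel_singleton[of T]
        by eventually_elim (use fF in \<open>auto simp: indicator_def intro!: ennreal_leI\<close>)
    qed
    finally show ?thesis .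
  qed
  have "ennreal (measure nE (space nE) * \<bar>\<phi> x\<bar>) = (\<integral>\<^sup>+z. ennreal \<bar>\<phi> x\<bar> \<partial>nE)"
    by (simp add: nE.emeasure_eq_measure ennreal_mult mult.commute)
  also have "\<dots> \<le> (\<integral>\<^sup>+z. (\<integral>\<^sup>+t. indicator {0<..<T} t * ennreal (3 * F (x + t *\<^sub>R z)) \<partial>lborel) \<partial>nE)"
  proof (rule nn_integral_mono_AE)
    have "AE z in nE. z \<in> E" unfolding E(2) by (subst AE_density) (auto simp: indicator_def)
    then show "AE z in nE. ennreal \<bar>\<phi> x\<bar> \<le> (\<integral>\<^sup>+t. indicator {0<..<T} t * ennreal (3 * F (x + t *\<^sub>R z)) \<partial>lborel)"
      by eventually_elim (rule line)
  qed
  also have "\<dots> = (\<integral>\<^sup>+t. (\<integral>\<^sup>+z. indicator {0<..<T} t * ennreal (3 * F (x + t *\<^sub>R z)) \<partial>nE) \<partial>lborel)"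
    by (rule P.Fubini') measurable
  also have "\<dots> = (\<integral>\<^sup>+t. ennreal (indicator {0<..<T} t * (3 * a t)) \<partial>lborel)"
  proof (rule nn_integral_cong)
    fix t :: real
    have "(\<integral>\<^sup>+z. indicator {0<..<T} t * ennreal (3 * F (x + t *\<^sub>R z)) \<partial>nE)
       = indicator {0<..<T} t * (\<integral>\<^sup>+z. ennreal (3 * F (x + t *\<^sub>R z)) \<partial>nE)"
      by (rule nn_integral_cmult) measurable
    also have "(\<integral>\<^sup>+z. ennreal (3 * F (x + t *\<^sub>R z)) \<partial>nE) = ennreal (3 * a t)"
      using ia[of t] F0 unfolding a_def by (subst nn_integral_eq_integral) auto
    finally show "(\<integral>\<^sup>+z. indicator {0<..<T} t * ennreal (3 * F (x + t *\<^sub>R z)) \<partial>nE)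
        = ennreal (indicator {0<..<T} t * (3 * a t))"
      by (auto simp: indicator_def)
  qed
  also have "\<dots> = ennreal (\<integral>t. indicator {0<..<T} t * (3 * a t) \<partial>lborel)"
  proof (rule nn_integral_eq_integral)
    have "integrable lborel (\<lambda>t. indicat_real {0<..<T} t * (3 * (B * measure nE (space nE))))"
      using T(1) by (intro integrable_mult_left integrable_real_indicator) auto
    then show "integrable lborel (\<lambda>t. indicator {0<..<T} t * (3 * a t))"
      by (rule Bochner_Integration.integrable_bound)
         (use a0 aB B in \<open>auto simp: indicator_def abs_mult abs_of_nonneg\<close>)
  qed (use a0 in auto)
  also have "(\<integral>t. indicator {0<..<T} t * (3 * a t) \<partial>lborel) = 3 * (LINT t:{0<..<T}|lborel. a t)"
    unfolding set_lebesgue_integral_def by (subst integral_mult_right_zero[symmetric]) (simp add: mult_ac)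
  finally have "measure nE (space nE) * \<bar>\<phi> x\<bar> \<le> 3 * (LINT t:{0<..<T}|lborel. a t)"
    by (subst (asm) ennreal_le_iff) (auto simp: set_lebesgue_integral_def a0 intro!: integral_nonneg_AE)
  then show ?thesis by (simp add: a_def F_def)
qed


text \<open>The hypothesis \<open>subcritical\<close> is the inequality between \<open>q\<close> and
  the critical exponent in a form free of case distinctions: for \<open>p < N\<close> it reads
  \<open>q * (N - p) < N * p\<close>, and for \<open>p \<ge> N\<close> it always holds.\<close>

theorem sobolev_test_fun:
  fixes \<Omega> :: "(real^'n::finite) set"
  assumes \<Omega>: "bounded \<Omega>" and p: "1 < p" "p < q" and subcritical: "real CARD('n) * (q - p) / p < q"
  obtains K where "K \<ge> 0"
    "\<And>\<phi>. test_fun \<Omega> \<phi> \<Longrightarrow>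
      (\<integral>x. \<bar>\<phi> x\<bar> powr q \<partial>lborel) \<le> K * (\<integral>x. norm (grad_fun \<phi> x) powr p \<partial>lborel) powr (q / p)"
proof -
  obtain r where r: "r > 0" "\<And>x. x \<in> \<Omega> \<Longrightarrow> norm x < r"
    using bounded_pos_less \<Omega> by blast
  define T where "T = 2 * r"
  have T: "T > 0" "\<And>x y. x \<in> \<Omega> \<Longrightarrow> y \<in> \<Omega> \<Longrightarrow> norm (x - y) < T"
    using r(1) r(2) norm_triangle_ineq4 unfolding T_def by (force, smt (verit, best))
  \<comment> \<open>Any vector of norm 2 would do, here along an arbitrary axis: the unit ball
    around it stays at distance 1 from the origin and has positive volume.\<close>
  define e :: "real^'n" where "e = 2 *\<^sub>R axis undefined 1"
  define E where "E = ball e 1"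
  have ne: "norm e = 2" by (simp add: e_def)
  have E: "1 \<le> norm z" "norm z \<le> 3" if "z \<in> E" for z
    using that norm_triangle_ineq2[of e z] norm_triangle_ineq2[of z e] ne
    by (auto simp: E_def dist_norm norm_minus_commute)
  have E_meas[measurable]: "E \<in> sets borel" by (simp add: E_def)
  define nE where "nE = density lborel (indicator E)"
  have emE: "emeasure nE (space nE) = emeasure lborel E"
    by (simp add: nE_def emeasure_density)
  have fin: "finite_measure nE"
    by standard (use emeasure_lborel_ball_finite[of e 1] in \<open>simp add: emE E_def\<close>)
  interpret nE: finite_measure nE by fact
  interpret P: pair_sigma_finite lborel nE ..
  have [measurable_cong]: "sets nE = sets borel" by (simp add: nE_def)
  define V where "V = measure nE (space nE)"
  have V: "V > 0" unfolding V_def measure_def emE unfolding measure_def[symmetric]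
    by (simp add: E_def content_ball_pos)
  define N where "N = real CARD('n)"
  \<comment> \<open>\<open>c\<close> is the threshold above which \<open>\<kappa>\<close> makes the
    final exponent \<open>\<beta>\<close> larger than -1, and subcriticality is exactly
    \<open>c < 1\<close>. So \<open>\<kappa>\<close> can be taken halfway between
    \<open>max 0 c\<close> and 1.\<close>
  define c where "c = (N * (q - p) / p - 1) / (q - 1)"
  define \<kappa> where "\<kappa> = (max 0 c + 1) / 2"
  have "c < 1" using subcritical p by (simp add: c_def N_def field_simps)
  then have \<kappa>: "0 \<le> \<kappa>" "\<kappa> < 1" "c < \<kappa>" by (auto simp: \<kappa>_def)
  define \<beta> where "\<beta> = \<kappa> * (q - 1) - N * (q - p) / p"
  have \<beta>: "\<beta> > -1" using \<kappa>(3) p by (simp add: c_def \<beta>_def field_simps)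
  define W where "W = (T powr (1 - \<kappa>) / (1 - \<kappa>)) powr (q - 1)"
  define c1 where "c1 = (3 / V) powr q * W * (V powr (p - 1)) powr (q / p)"
  define c2 where "c2 = T powr (\<beta> + 1) / (\<beta> + 1)"
  have c12: "c1 \<ge> 0" "c2 \<ge> 0" using \<beta> by (auto simp: c1_def c2_def W_def)
  have "(\<integral>x. \<bar>\<phi> x\<bar> powr q \<partial>lborel)
      \<le> (c1 * c2 * V) * (\<integral>x. norm (grad_fun \<phi> x) powr p \<partial>lborel) powr (q / p)"
    if \<phi>: "test_fun \<Omega> \<phi>" for \<phi>
  proof -
    define F where "F = (\<lambda>x. norm (grad_fun \<phi> x))"
    have contF: "continuous_on UNIV F" unfolding F_def
      using test_fun_continuous_grad[OF \<phi>] by (intro continuous_intros)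
    have F0: "F y \<ge> 0" for y by (simp add: F_def)
    have Fsupp: "F y = 0" if "y \<notin> tsupp \<phi>" for y
      using grad_eq_0_outside_tsupp[OF that] by (simp add: F_def)
    have [measurable]: "F \<in> borel_measurable borel" using contF by (rule borel_measurable_continuous_onI)
    obtain B where B: "B \<ge> 0" "\<And>x. norm (F x) \<le> B"
      using continuous_compact_support_bounded[OF contF test_fun_compact[OF \<phi>] Fsupp] by metis
    have FB: "F y \<le> B" for y using B(2)[of y] F0[of y] by simp
    have iF: "integrable nE (\<lambda>z. F (x + t *\<^sub>R z))" for x t
      by (rule nE.integrable_const_bound[where B=B]) (use B in auto)
    have iFp: "integrable nE (\<lambda>z. F (x + t *\<^sub>R z) powr p)" for x t
      by (rule nE.integrable_const_bound[where B="B powr p"]) (use FB F0 p in \<open>auto intro!: powr_mono2\<close>)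
    have iJ: "integrable lborel (\<lambda>y. F y powr p)"
      by (rule continuous_compact_support_integrable[OF _ test_fun_compact[OF \<phi>]])
         (use contF F0 Fsupp p in \<open>auto intro: continuous_on_powr' continuous_on_const\<close>)
    define J where "J = (\<integral>y. F y powr p \<partial>lborel)"
    have J0: "J \<ge> 0" unfolding J_def by simp
    have nnJ: "(\<integral>\<^sup>+y. ennreal (F y powr p) \<partial>lborel) = ennreal J"
      unfolding J_def by (rule nn_integral_eq_integral[OF iJ]) simp
    define c3 where "c3 = c1 * J powr ((q - p) / p)"
    \<comment> \<open>Pointwise form of the inequality: the weight of Jensen in \<open>t\<close> and
      the singular power from the average over \<open>z\<close> combine to
      \<open>t powr \<beta>\<close>. It is stated with nonnegative integrals so that Tonelli applies
      without integrability proofs.\<close>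
    have pt: "ennreal (\<bar>\<phi> x\<bar> powr q) \<le> (\<integral>\<^sup>+t. ennreal c3 * (ennreal (indicator {0<..<T} t * t powr \<beta>)
        * (\<integral>\<^sup>+z. ennreal (F (x + t *\<^sub>R z) powr p) \<partial>nE)) \<partial>lborel)" for x
    proof (cases "x \<in> \<Omega>")
      case False
      then have "\<phi> x = 0" using test_fun_subset[OF \<phi>] by (auto intro: eq_0_outside_tsupp)
      then show ?thesis by simp
    next
      case True
      define a where "a = (\<lambda>t. \<integral>z. F (x + t *\<^sub>R z) \<partial>nE)"
      define S where "S = (\<lambda>t. \<integral>z. F (x + t *\<^sub>R z) powr p \<partial>nE)"
      have [measurable]: "a \<in> borel_measurable borel" unfolding a_def by measurable
      have a0: "a t \<ge> 0" for t unfolding a_def using F0 by simp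
      have aB: "a t \<le> B * V" for t
        unfolding a_def V_def using integral_mono[OF iF[of x t], of "\<lambda>_. B"] FB by (simp add: mult.commute)
      have BV: "B * V \<ge> 0" using B V by simp
      have aq: "a t powr q \<le> (V powr (p - 1)) powr (q / p) * J powr ((q - p) / p) * t powr (- N * (q - p) / p) * S t"
        if "t > 0" for t
        using average_powr_le[OF contF test_fun_compact[OF \<phi>] Fsupp F0 fin nE_def E_meas p that, of x]
        by (simp add: a_def S_def V_def J_def N_def)
      have "V * \<bar>\<phi> x\<bar> \<le> 3 * (LINT t:{0<..<T}|lborel. a t)"
        using test_fun_le_average[OF \<phi> T fin nE_def E_meas E True] by (simp add: a_def V_def F_def)
      then have "\<bar>\<phi> x\<bar> \<le> 3 / V * (LINT t:{0<..<T}|lborel. a t)" using V by (simp add: field_simps)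
      then have "\<bar>\<phi> x\<bar> powr q \<le> (3 / V * (LINT t:{0<..<T}|lborel. a t)) powr q"
        using p by (intro powr_mono2) auto
      also have "\<dots> = (3 / V) powr q * (LINT t:{0<..<T}|lborel. a t) powr q"
        by (rule powr_mult)
      also have "\<dots> \<le> (3 / V) powr q * (W * (LINT t:{0<..<T}|lborel. t powr (\<kappa> * (q - 1)) * a t powr q))"
        unfolding W_def using T(1) \<kappa> p a0 aB
        by (intro mult_left_mono weighted_integral_powr_le[where B="B * V"]) auto
      finally have "ennreal (\<bar>\<phi> x\<bar> powr q) \<le> ennreal ((3 / V) powr q * W) *
          ennreal (LINT t:{0<..<T}|lborel. t powr (\<kappa> * (q - 1)) * a t powr q)"
        by (subst ennreal_mult'[symmetric]) (auto simp: W_def mult.assoc intro!: ennreal_leI)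
      also have "ennreal (LINT t:{0<..<T}|lborel. t powr (\<kappa> * (q - 1)) * a t powr q)
          = (\<integral>\<^sup>+t. ennreal (indicator {0<..<T} t * (t powr (\<kappa> * (q - 1)) * a t powr q)) \<partial>lborel)"
        unfolding set_lebesgue_integral_def real_scaleR_def
      proof (rule nn_integral_eq_integral[symmetric])
        have "integrable lborel (\<lambda>t. indicat_real {0<..<T} t * (T powr (\<kappa> * (q - 1)) * (B * V) powr q))"
          using T(1) by (intro integrable_mult_left integrable_real_indicator) auto
        then show "integrable lborel (\<lambda>t. indicat_real {0<..<T} t * (t powr (\<kappa> * (q - 1)) * a t powr q))"
          by (rule Bochner_Integration.integrable_bound)
             (use a0 aB p \<kappa> in \<open>auto simp: indicator_def intro!: mult_mono powr_mono2\<close>)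
      qed auto
      also have "ennreal ((3 / V) powr q * W) * (\<integral>\<^sup>+t. ennreal (indicator {0<..<T} t * (t powr (\<kappa> * (q - 1)) * a t powr q)) \<partial>lborel)
         = (\<integral>\<^sup>+t. ennreal ((3 / V) powr q * W) * ennreal (indicator {0<..<T} t * (t powr (\<kappa> * (q - 1)) * a t powr q)) \<partial>lborel)"
        by (rule nn_integral_cmult[symmetric]) measurable
      also have "\<dots> \<le> (\<integral>\<^sup>+t. ennreal c3 * (ennreal (indicator {0<..<T} t * t powr \<beta>)
        * (\<integral>\<^sup>+z. ennreal (F (x + t *\<^sub>R z) powr p) \<partial>nE)) \<partial>lborel)"
      proof (rule nn_integral_mono)
        fix t :: real
        have S: "(\<integral>\<^sup>+z. ennreal (F (x + t *\<^sub>R z) powr p) \<partial>nE) = ennreal (S t)"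
          unfolding S_def by (rule nn_integral_eq_integral[OF iFp]) simp
        have "(3 / V) powr q * W * (indicator {0<..<T} t * (t powr (\<kappa> * (q - 1)) * a t powr q))
           \<le> c3 * ((indicator {0<..<T} t * t powr \<beta>) * S t)"
        proof (cases "t \<in> {0<..<T}")
          case True
          then have "(3 / V) powr q * W * (t powr (\<kappa> * (q - 1)) * a t powr q) \<le>
              (3 / V) powr q * W * (t powr (\<kappa> * (q - 1)) *
              ((V powr (p - 1)) powr (q / p) * J powr ((q - p) / p) * t powr (- N * (q - p) / p) * S t))"
            by (intro mult_left_mono aq) (auto simp: W_def)
          also have "\<dots> = c3 * ((t powr (\<kappa> * (q - 1)) * t powr (- N * (q - p) / p)) * S t)"
            by (simp add: c3_def c1_def mult_ac)
          also have "t powr (\<kappa> * (q - 1)) * t powr (- N * (q - p) / p) = t powr \<beta>"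
            by (simp add: \<beta>_def powr_add[symmetric])
          finally show ?thesis using True by simp
        qed simp
        then show "ennreal ((3 / V) powr q * W) * ennreal (indicator {0<..<T} t * (t powr (\<kappa> * (q - 1)) * a t powr q))
           \<le> ennreal c3 * (ennreal (indicator {0<..<T} t * t powr \<beta>)
        * (\<integral>\<^sup>+z. ennreal (F (x + t *\<^sub>R z) powr p) \<partial>nE))"
          unfolding S using c12
          by (simp flip: ennreal_mult' add: W_def c3_def ennreal_leI)
      qed
      finally show ?thesis .
    qed
    have "ennreal (\<integral>x. \<bar>\<phi> x\<bar> powr q \<partial>lborel) = (\<integral>\<^sup>+x. ennreal (\<bar>\<phi> x\<bar> powr q) \<partial>lborel)"
    proof (rule nn_integral_eq_integral[symmetric])
      show "integrable lborel (\<lambda>x. \<bar>\<phi> x\<bar> powr q)"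
        by (rule continuous_compact_support_integrable[OF _ test_fun_compact[OF \<phi>]])
           (use p in \<open>auto intro!: continuous_on_powr' continuous_on_rabs test_fun_continuous[OF \<phi>] simp: eq_0_outside_tsupp\<close>)
    qed simp
    \<comment> \<open>Integration over \<open>x\<close> is moved innermost. By translation
      invariance it gives \<open>J\<close> for every \<open>t\<close> and \<open>z\<close>, so that
      only the volume \<open>V\<close> and the integral of \<open>t powr \<beta>\<close>
      remain.\<close>
    also have "\<dots> \<le> (\<integral>\<^sup>+x. (\<integral>\<^sup>+t. ennreal c3 * (ennreal (indicator {0<..<T} t * t powr \<beta>)
        * (\<integral>\<^sup>+z. ennreal (F (x + t *\<^sub>R z) powr p) \<partial>nE)) \<partial>lborel) \<partial>lborel)"
      by (intro nn_integral_mono pt)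
    also have "\<dots> = (\<integral>\<^sup>+t. (\<integral>\<^sup>+x. ennreal c3 * (ennreal (indicator {0<..<T} t * t powr \<beta>)
        * (\<integral>\<^sup>+z. ennreal (F (x + t *\<^sub>R z) powr p) \<partial>nE)) \<partial>lborel) \<partial>lborel)"
      by (rule lborel_pair.Fubini'[symmetric]) measurable
    also have "\<dots> = (\<integral>\<^sup>+t. ennreal c3 * (ennreal (indicator {0<..<T} t * t powr \<beta>)
        * (ennreal V * ennreal J)) \<partial>lborel)"
    proof (rule nn_integral_cong)
      fix t :: real
      have "(\<integral>\<^sup>+x. (\<integral>\<^sup>+z. ennreal (F (x + t *\<^sub>R z) powr p) \<partial>nE) \<partial>lborel)
          = (\<integral>\<^sup>+z. (\<integral>\<^sup>+x. ennreal (F (x + t *\<^sub>R z) powr p) \<partial>lborel) \<partial>nE)"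
        by (rule P.Fubini'[symmetric]) measurable
      also have "\<dots> = (\<integral>\<^sup>+z. ennreal J \<partial>nE)"
      proof (rule nn_integral_cong)
        fix z
        show "(\<integral>\<^sup>+x. ennreal (F (x + t *\<^sub>R z) powr p) \<partial>lborel) = ennreal J"
          using nn_integral_lborel_affine[of "\<lambda>y. ennreal (F y powr p)" 1 "t *\<^sub>R z"] nnJ
          by (simp add: add.commute)
      qed
      also have "\<dots> = ennreal V * ennreal J"
        by (simp add: nE.emeasure_eq_measure V_def mult.commute)
      finally show "(\<integral>\<^sup>+x. ennreal c3 * (ennreal (indicator {0<..<T} t * t powr \<beta>)
        * (\<integral>\<^sup>+z. ennreal (F (x + t *\<^sub>R z) powr p) \<partial>nE)) \<partial>lborel) = ennreal c3 * (ennreal (indicator {0<..<T} t * t powr \<beta>)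
        * (ennreal V * ennreal J))"
        by (simp add: nn_integral_cmult)
    qed
    also have "\<dots> = ennreal c3 * (ennreal c2 * (ennreal V * ennreal J))"
      using nn_integral_powr_interval[OF T(1) \<beta>]
      by (simp add: nn_integral_cmult nn_integral_multc c2_def)
    also have "\<dots> = ennreal (c3 * (c2 * (V * J)))"
      using c12 V J0 by (simp add: ennreal_mult c3_def)
    finally have "(\<integral>x. \<bar>\<phi> x\<bar> powr q \<partial>lborel) \<le> c3 * (c2 * (V * J))"
      using c12 V J0 by (subst (asm) ennreal_le_iff) (auto simp: c3_def)
    also have "\<dots> = (c1 * c2 * V) * (J powr ((q - p) / p) * J)"
      by (simp add: c3_def mult_ac)
    also have "J powr ((q - p) / p) * J = J powr (q / p)"
    proof (cases "J = 0")
      case False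
      then have "J powr ((q - p) / p) * J powr 1 = J powr (q / p)"
        using p unfolding powr_add[symmetric] by (simp add: field_simps)
      then show ?thesis using False J0 by simp
    qed simp
    finally show ?thesis by (simp add: J_def F_def)
  qed
  then show thesis using that[of "c1 * c2 * V"] c12 V by simp
qed

section \<open>Smooth truncations\<close>

text \<open>Analytic substitutes for the Heaviside function and the positive part. They are chosen
  because the derivative of \<open>softplus\<close> is \<open>logistic\<close> and that of
  \<open>logistic\<close> is a polynomial in \<open>logistic\<close>, so differentiating composites
  never leaves a small explicit class.\<close>

definition logistic :: "real \<Rightarrow> real" where "logistic y = 1 / (1 + exp (- y))"
definition softplus :: "real \<Rightarrow> real" where "softplus y = ln (1 + exp y)"

lemma one_plus_exp_pos: "1 + exp (y::real) > 0" "1 + exp (y::real) \<noteq> 0"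
  using exp_gt_zero[of y] by linarith+

lemma logistic_bounds: "0 \<le> logistic y" "logistic y \<le> 1"
  using one_plus_exp_pos[of "- y"] by (auto simp: logistic_def)

lemma has_real_derivative_logistic:
  "(logistic has_real_derivative logistic y * (1 - logistic y)) (at y)"
  unfolding logistic_def using one_plus_exp_pos[of "- y"]
  by (auto intro!: derivative_eq_intros simp: field_simps power2_eq_square)

lemma has_real_derivative_softplus: "(softplus has_real_derivative logistic y) (at y)"
proof -
  have "exp y / (1 + exp y) = logistic y"
    unfolding logistic_def using one_plus_exp_pos[of y] one_plus_exp_pos[of "- y"]
    by (simp add: field_simps exp_minus)
  then show ?thesis unfolding softplus_def using one_plus_exp_pos[of y]
    by (auto intro!: derivative_eq_intros)
qed

lemmas has_real_derivative_logistic_comp [derivative_intros] =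
  DERIV_chain2[OF has_real_derivative_logistic]
lemmas has_real_derivative_softplus_comp [derivative_intros] =
  DERIV_chain2[OF has_real_derivative_softplus]

text \<open>The difference is the logarithm of \<open>(1 + exp y) / (1 + exp x)\<close>, a number
  between 1 and \<open>exp (y - x)\<close>. These two bounds keep the smooth truncations below their
  cap for every steepness.\<close>

lemma softplus_diff_bounds:
  assumes "x \<le> y"
  shows "0 \<le> softplus y - softplus x" "softplus y - softplus x \<le> y - x"
proof -
  have "softplus y - softplus x = ln ((1 + exp y) / (1 + exp x))"
    by (simp add: softplus_def ln_div one_plus_exp_pos)
  moreover have "1 \<le> (1 + exp y) / (1 + exp x)" using assms one_plus_exp_pos[of x] by simp
  moreover have "(1 + exp y) / (1 + exp x) \<le> exp (y - x)"
    using assms one_plus_exp_pos[of x] by (simp add: exp_diff field_simps)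
  ultimately show "0 \<le> softplus y - softplus x" "softplus y - softplus x \<le> y - x"
    by (auto simp: ln_ge_zero) (metis exp_gt_zero ln_exp ln_mono less_le_trans zero_less_one)
qed

text \<open>The identity \<open>softplus y - y = softplus (- y)\<close> reduces everything to
  \<open>y \<le> 0\<close>, where \<open>1 + exp y\<close> lies between 1 and 2. As the error is
  uniform in \<open>y\<close>, rescaling by \<open>n\<close> divides it by \<open>n\<close>.\<close>

lemma softplus_approx: "\<bar>softplus y - max y 0\<bar> \<le> ln 2"
proof -
  have *: "softplus y - y = softplus (- y)"
    using one_plus_exp_pos[of y] one_plus_exp_pos[of "- y"] ln_div[of "1 + exp y" "exp y"]
    by (simp add: softplus_def exp_minus add_divide_distrib inverse_eq_divide add.commute)
  have **: "0 \<le> softplus z \<and> softplus z \<le> ln 2" if "z \<le> 0" for z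
    unfolding softplus_def using that by (auto simp: one_plus_exp_pos)
  show ?thesis
  proof (cases "y \<ge> 0")
    case True
    then show ?thesis using * **[of "- y"] by simp
  next
    case False
    then show ?thesis using **[of y] by simp
  qed
qed

lemma softplus_scaled_tendsto: "(\<lambda>n. softplus (real (Suc n) * y) / real (Suc n)) \<longlonglongrightarrow> max y 0"
proof (rule LIMSEQ_I)
  fix r :: real assume r: "r > 0"
  obtain N where N: "ln 2 / r < real N" using reals_Archimedean2 by blast
  have "norm (softplus (real (Suc n) * y) / real (Suc n) - max y 0) < r" if "n \<ge> N" for n
  proof -
    have "max (real (Suc n) * y) 0 = real (Suc n) * max y 0"
      by (auto simp: max_def zero_le_mult_iff mult_le_0_iff)
    then have "softplus (real (Suc n) * y) / real (Suc n) - max y 0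
        = (softplus (real (Suc n) * y) - max (real (Suc n) * y) 0) / real (Suc n)"
      by (simp add: field_simps)
    then have "norm (softplus (real (Suc n) * y) / real (Suc n) - max y 0) \<le> ln 2 / real (Suc n)"
      using softplus_approx[of "real (Suc n) * y"] by (simp add: divide_right_mono)
    also have "\<dots> < r" using N that r by (simp add: field_simps) (smt (verit, best) mult_left_mono of_nat_mono)
    finally show ?thesis .
  qed
  then show "\<exists>N. \<forall>n\<ge>N. norm (softplus (real (Suc n) * y) / real (Suc n) - max y 0) < r" by blast
qed

text \<open>The value 1/2 at 0 is \<open>logistic 0\<close>, so that rescaled logistic functions
  converge at every point and level sets of the solution need no separate treatment.\<close>

definition half_step :: "real \<Rightarrow> real" where
  "half_step y = (if y > 0 then 1 else if y = 0 then 1 / 2 else 0)"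

lemma logistic_at_top: "(logistic \<longlongrightarrow> 1) at_top"
proof -
  have "((\<lambda>y. 1 / (1 + exp (- y))) \<longlongrightarrow> 1 / (1 + (0::real))) at_top"
    by (intro tendsto_intros filterlim_compose[OF exp_at_bot] filterlim_uminus_at_bot_at_top) auto
  then show ?thesis by (simp add: logistic_def[abs_def])
qed

lemma logistic_uminus: "logistic (- y) = 1 - logistic y"
  unfolding logistic_def using one_plus_exp_pos[of y] one_plus_exp_pos[of "- y"]
  by (simp add: field_simps flip: exp_add)

lemma logistic_scaled_tendsto: "(\<lambda>n. logistic (real (Suc n) * y)) \<longlonglongrightarrow> half_step y"
proof -
  have pos: "(\<lambda>n. logistic (real (Suc n) * y)) \<longlonglongrightarrow> 1" if "y > 0" for y
  proof (rule filterlim_compose[OF logistic_at_top])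
    have "filterlim (\<lambda>n. y * real (Suc n)) at_top sequentially"
      by (rule filterlim_tendsto_pos_mult_at_top[OF tendsto_const that])
         (use filterlim_real_sequentially in \<open>simp add: filterlim_sequentially_Suc[of real, symmetric]\<close>)
    then show "filterlim (\<lambda>n. real (Suc n) * y) at_top sequentially" by (simp add: mult.commute)
  qed
  consider "y > 0" | "y = 0" | "y < 0" by linarith
  then show ?thesis
  proof cases
    case 3
    then have "(\<lambda>n. 1 - logistic (real (Suc n) * - y)) \<longlonglongrightarrow> 1 - 1"
      by (intro tendsto_intros pos) auto
    then show ?thesis using 3 by (simp add: logistic_uminus half_step_def)
  qed (use pos in \<open>auto simp: half_step_def logistic_def\<close>)
qed

text \<open>\<open>trunc h M\<close> is the odd function \<open>sgn s * min (max (\<bar>s\<bar> - h) 0) M\<close>, \<open>dtrunc h M\<close> its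
  derivative, with value 1/2 at the kinks; both are pointwise limits of analytic functions.\<close>

definition trunc :: "real \<Rightarrow> real \<Rightarrow> real \<Rightarrow> real" where
  "trunc h M s = max (s - h) 0 - max (s - h - M) 0 - max (- s - h) 0 + max (- s - h - M) 0"
definition dtrunc :: "real \<Rightarrow> real \<Rightarrow> real \<Rightarrow> real" where
  "dtrunc h M s = half_step (s - h) - half_step (s - h - M) + half_step (- s - h) - half_step (- s - h - M)"
definition trunc_approx :: "real \<Rightarrow> real \<Rightarrow> real \<Rightarrow> real \<Rightarrow> real" where
  "trunc_approx m h M s = (softplus (m * (s - h)) - softplus (m * (s - h - M))
     - softplus (m * (- s - h)) + softplus (m * (- s - h - M))) / m"
definition dtrunc_approx :: "real \<Rightarrow> real \<Rightarrow> real \<Rightarrow> real \<Rightarrow> real" where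
  "dtrunc_approx m h M s = logistic (m * (s - h)) - logistic (m * (s - h - M))
     + logistic (m * (- s - h)) - logistic (m * (- s - h - M))"

section \<open>Bounds and limits of the truncations\<close>

lemma trunc_approx_0 [simp]: "trunc_approx m h M 0 = 0"
  by (simp add: trunc_approx_def)

lemma has_real_derivative_trunc_approx:
  assumes "m > 0"
  shows "(trunc_approx m h M has_real_derivative dtrunc_approx m h M s) (at s)"
  unfolding trunc_approx_def dtrunc_approx_def using assms
  by (auto intro!: derivative_eq_intros simp: field_simps)

lemma abs_trunc_approx_le:
  assumes "m > 0" "M \<ge> 0"
  shows "\<bar>trunc_approx m h M s\<bar> \<le> M"
proof -
  have "\<bar>softplus (m * (s - h)) - softplus (m * (s - h - M)) - (softplus (m * (- s - h)) - softplus (m * (- s - h - M)))\<bar> \<le> m * M"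
    using softplus_diff_bounds[of "m * (s - h - M)" "m * (s - h)"]
      softplus_diff_bounds[of "m * (- s - h - M)" "m * (- s - h)"] assms
    by (auto simp: mult_left_mono abs_le_iff algebra_simps)
  then show ?thesis using assms by (simp add: trunc_approx_def field_simps abs_le_iff)
qed

lemma abs_dtrunc_approx_le: "\<bar>dtrunc_approx m h M s\<bar> \<le> 2"
  using logistic_bounds[of "m * (s - h)"] logistic_bounds[of "m * (s - h - M)"]
    logistic_bounds[of "m * (- s - h)"] logistic_bounds[of "m * (- s - h - M)"]
  unfolding dtrunc_approx_def by linarith

lemma trunc_approx_tendsto: "(\<lambda>n. trunc_approx (real (Suc n)) h M s) \<longlonglongrightarrow> trunc h M s"
  unfolding trunc_approx_def trunc_def diff_divide_distrib add_divide_distrib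
  by (intro tendsto_add tendsto_diff softplus_scaled_tendsto)

lemma dtrunc_approx_tendsto: "(\<lambda>n. dtrunc_approx (real (Suc n)) h M s) \<longlonglongrightarrow> dtrunc h M s"
  unfolding dtrunc_approx_def dtrunc_def
  by (intro tendsto_add tendsto_diff logistic_scaled_tendsto)

text \<open>The delicate case is \<open>h = 0\<close>, where the kinks at \<open>h\<close> and
  \<open>- h\<close> merge: the two values 1/2 then add up to 1, still within the bounds.\<close>

lemma dtrunc_bounds:
  assumes "h \<ge> 0" "M > 0"
  shows "0 \<le> dtrunc h M s" "dtrunc h M s \<le> 1"
  using assms by (auto simp: dtrunc_def half_step_def)

lemma abs_trunc:
  assumes "h \<ge> 0" "M > 0"
  shows "\<bar>trunc h M s\<bar> = min (max (\<bar>s\<bar> - h) 0) M"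
  using assms unfolding trunc_def by (auto simp: max_def min_def abs_if)

lemma trunc_sign:
  assumes "h \<ge> 0" "M > 0"
  shows "\<bar>s\<bar> \<le> h \<Longrightarrow> trunc h M s = 0" "s > 0 \<Longrightarrow> trunc h M s \<ge> 0" "s < 0 \<Longrightarrow> trunc h M s \<le> 0"
  using assms unfolding trunc_def by (auto simp: max_def)

lemma continuous_trunc_approx: "m > 0 \<Longrightarrow> continuous_on UNIV (trunc_approx m h M)"
  by (rule DERIV_continuous_on[OF has_field_derivative_at_within[OF has_real_derivative_trunc_approx]])

lemma continuous_logistic: "continuous_on UNIV logistic"
  by (rule DERIV_continuous_on[OF has_field_derivative_at_within[OF has_real_derivative_logistic]])

lemma continuous_softplus: "continuous_on UNIV softplus"
  by (rule DERIV_continuous_on[OF has_field_derivative_at_within[OF has_real_derivative_softplus]])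

lemma continuous_dtrunc_approx: "continuous_on UNIV (dtrunc_approx m h M)"
  unfolding dtrunc_approx_def
  by (intro continuous_intros continuous_on_compose2[OF continuous_logistic]) auto

lemma borel_measurable_trunc [measurable]: "trunc h M \<in> borel_measurable borel"
  unfolding trunc_def[abs_def] by measurable

lemma borel_measurable_dtrunc [measurable]: "dtrunc h M \<in> borel_measurable borel"
  unfolding dtrunc_def[abs_def] half_step_def by measurable

inductive_set comp_class :: "(real^'n::finite \<Rightarrow> real) \<Rightarrow> (real^'n \<Rightarrow> real) set"
  for \<phi> :: "real^'n \<Rightarrow> real" where
  comp_class_partial: "iter_pd is \<phi> \<in> comp_class \<phi>"
| comp_class_const: "(\<lambda>x. c) \<in> comp_class \<phi>"
| comp_class_logistic: "(\<lambda>x. logistic (a * \<phi> x + b)) \<in> comp_class \<phi>"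
| comp_class_softplus: "(\<lambda>x. softplus (a * \<phi> x + b)) \<in> comp_class \<phi>"
| comp_class_add: "f \<in> comp_class \<phi> \<Longrightarrow> g \<in> comp_class \<phi> \<Longrightarrow> (\<lambda>x. f x + g x) \<in> comp_class \<phi>"
| comp_class_mult: "f \<in> comp_class \<phi> \<Longrightarrow> g \<in> comp_class \<phi> \<Longrightarrow> (\<lambda>x. f x * g x) \<in> comp_class \<phi>"

lemma comp_class_diff:
  assumes "f \<in> comp_class \<phi>" "g \<in> comp_class \<phi>"
  shows "(\<lambda>x. f x - g x) \<in> comp_class \<phi>"
  using comp_class_add[OF assms(1) comp_class_mult[OF comp_class.intros(2)[of "-1"] assms(2)]] by simp

lemma comp_class_continuous:
  assumes \<phi>: "smooth_fun \<phi>" and "f \<in> comp_class \<phi>"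
  shows "continuous_on UNIV f"
  using assms(2)
proof induction
  case (comp_class_partial "is")
  show ?case using \<phi> by (simp add: smooth_fun_def)
next
  case (comp_class_logistic a b)
  then show ?case
    by (intro continuous_on_compose2[OF continuous_logistic] continuous_intros smooth_fun_continuous[OF \<phi>]) auto
next
  case (comp_class_softplus a b)
  then show ?case
    by (intro continuous_on_compose2[OF continuous_softplus] continuous_intros smooth_fun_continuous[OF \<phi>]) auto
next
  case (comp_class_add f g)
  then show ?case by (intro continuous_on_add)
next
  case (comp_class_mult f g)
  then show ?case by (intro continuous_on_mult)
qed (rule continuous_on_const)

lemma comp_class_has_partial:
  assumes \<phi>: "smooth_fun \<phi>" and "f \<in> comp_class \<phi>"
  shows "\<exists>f'\<in>comp_class \<phi>. \<forall>x. ((\<lambda>t. f (x + t *\<^sub>R axis i 1)) has_real_derivative f' x) (at 0)"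
  using assms(2)
proof induction
  case (comp_class_partial "is")
  show ?case
    using has_real_derivative_iter_pd[OF \<phi>] comp_class.comp_class_partial[of "i # is" \<phi>] by blast
next
  case (comp_class_const c)
  show ?case using comp_class.intros(2)[of 0 \<phi>] by (intro bexI[of _ "\<lambda>x. 0"]) auto
next
  case (comp_class_logistic a b)
  let ?l = "\<lambda>x. logistic (a * \<phi> x + b)"
  show ?case
  proof (intro bexI[of _ "\<lambda>x. (?l x * (1 - ?l x)) * (a * iter_pd [i] \<phi> x)"] allI)
    show "(\<lambda>x. (?l x * (1 - ?l x)) * (a * iter_pd [i] \<phi> x)) \<in> comp_class \<phi>"
    by (intro comp_class_mult comp_class_diff comp_class.intros(1-3))
    fix x show "((\<lambda>t. ?l (x + t *\<^sub>R axis i 1)) has_real_derivative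
      (?l x * (1 - ?l x)) * (a * iter_pd [i] \<phi> x)) (at 0)"
    using has_real_derivative_along_axis[OF \<phi>, of x i 0]
    by (auto intro!: derivative_eq_intros)
  qed
next
  case (comp_class_softplus a b)
  let ?l = "\<lambda>x. logistic (a * \<phi> x + b)"
  show ?case
  proof (intro bexI[of _ "\<lambda>x. ?l x * (a * iter_pd [i] \<phi> x)"] allI)
    show "(\<lambda>x. ?l x * (a * iter_pd [i] \<phi> x)) \<in> comp_class \<phi>"
    by (intro comp_class_mult comp_class.intros(1-3))
    fix x show "((\<lambda>t. softplus (a * \<phi> (x + t *\<^sub>R axis i 1) + b)) has_real_derivative
      ?l x * (a * iter_pd [i] \<phi> x)) (at 0)"
    using has_real_derivative_along_axis[OF \<phi>, of x i 0]
    by (auto intro!: derivative_eq_intros)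
  qed
next
  case (comp_class_add f g)
  then obtain f' g' where "f' \<in> comp_class \<phi>" "g' \<in> comp_class \<phi>"
    "\<And>x. ((\<lambda>t. f (x + t *\<^sub>R axis i 1)) has_real_derivative f' x) (at 0)"
    "\<And>x. ((\<lambda>t. g (x + t *\<^sub>R axis i 1)) has_real_derivative g' x) (at 0)" by blast
  then show ?case
    by (intro bexI[of _ "\<lambda>x. f' x + g' x"] allI DERIV_add comp_class.comp_class_add)
next
  case (comp_class_mult f g)
  then obtain f' g' where *: "f' \<in> comp_class \<phi>" "g' \<in> comp_class \<phi>"
    "\<And>x. ((\<lambda>t. f (x + t *\<^sub>R axis i 1)) has_real_derivative f' x) (at 0)"
    "\<And>x. ((\<lambda>t. g (x + t *\<^sub>R axis i 1)) has_real_derivative g' x) (at 0)" by blast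
  have "((\<lambda>t. f (x + t *\<^sub>R axis i 1) * g (x + t *\<^sub>R axis i 1)) has_real_derivative f' x * g x + g' x * f x) (at 0)" for x
    using DERIV_mult[OF *(3,4)[of x]] by simp
  with * comp_class_mult.hyps show ?case
    by (intro bexI[of _ "\<lambda>x. f' x * g x + g' x * f x"] allI comp_class.comp_class_add comp_class.comp_class_mult)
qed

text \<open>Smoothness comes from membership in \<open>comp_class\<close>. The support does not grow
  because \<open>trunc_approx\<close> vanishes at 0, the \<open>softplus\<close> terms being paired
  oddly.\<close>

lemma test_fun_trunc_approx:
  assumes \<phi>: "test_fun \<Omega> \<phi>"
  shows "test_fun \<Omega> (\<lambda>x. trunc_approx m h M (\<phi> x))"
proof -
  have sp: "(\<lambda>x. softplus (m * (c * \<phi> x - b))) \<in> comp_class \<phi>" for c b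
    using comp_class.intros(4)[of "m * c" \<phi> "- m * b"] by (simp add: algebra_simps)
  have "(\<lambda>x. (softplus (m * (1 * \<phi> x - h)) - softplus (m * (1 * \<phi> x - (h + M)))
     - softplus (m * (-1 * \<phi> x - h)) + softplus (m * (-1 * \<phi> x - (h + M)))) * (1 / m)) \<in> comp_class \<phi>"
    by (intro comp_class_mult comp_class_diff comp_class_add sp comp_class.intros(2))
  then have "(\<lambda>x. trunc_approx m h M (\<phi> x)) \<in> comp_class \<phi>"
    by (simp add: trunc_approx_def diff_diff_eq)
  then have "smooth_fun (\<lambda>x. trunc_approx m h M (\<phi> x))"
    using comp_class_continuous[OF test_fun_smooth[OF \<phi>]] comp_class_has_partial[OF test_fun_smooth[OF \<phi>]]
    by (intro smooth_funI_coinduct[of _ "comp_class \<phi>"]) auto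
  moreover have "tsupp (\<lambda>x. trunc_approx m h M (\<phi> x)) \<subseteq> tsupp \<phi>"
    unfolding tsupp_def by (intro closure_mono) auto
  moreover from this have "compact (tsupp (\<lambda>x. trunc_approx m h M (\<phi> x)))"
    using compact_Int_closed[OF test_fun_compact[OF \<phi>], of "tsupp (\<lambda>x. trunc_approx m h M (\<phi> x))"]
    by (simp add: inf.absorb2) (simp add: tsupp_def)
  ultimately show ?thesis using \<phi> unfolding test_fun_def by blast
qed

lemma grad_trunc_approx:
  assumes \<phi>: "test_fun \<Omega> \<phi>" and m: "m > 0"
  shows "grad_fun (\<lambda>x. trunc_approx m h M (\<phi> x)) x = dtrunc_approx m h M (\<phi> x) *\<^sub>R grad_fun \<phi> x"
proof -
  have "iter_pd [i] (\<lambda>x. trunc_approx m h M (\<phi> x)) x = dtrunc_approx m h M (\<phi> x) * iter_pd [i] \<phi> x" for i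
    using has_real_derivative_along_axis[OF test_fun_smooth[OF \<phi>], of x i 0]
    by (intro partial_eqI DERIV_chain2[OF has_real_derivative_trunc_approx[OF m], THEN DERIV_cong]) auto
  then show ?thesis by (simp add: grad_fun_def vec_eq_iff)
qed

section \<open>Approximation by test functions\<close>

lemma set_borel_measurable_iff_lebesgue_on:
  fixes f :: "'a::euclidean_space \<Rightarrow> 'b::real_normed_vector"
  assumes "\<Omega> \<in> sets lebesgue"
  shows "set_borel_measurable lebesgue \<Omega> f \<longleftrightarrow> f \<in> borel_measurable (lebesgue_on \<Omega>)"
  using assms by (simp add: set_borel_measurable_def borel_measurable_restrict_space_iff)

lemma set_integrable_iff_lebesgue_on:
  fixes f :: "'a::euclidean_space \<Rightarrow> 'b::{banach, second_countable_topology}"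
  assumes "\<Omega> \<in> sets lebesgue"
  shows "set_integrable lebesgue \<Omega> f \<longleftrightarrow> integrable (lebesgue_on \<Omega>) f"
  using assms by (simp add: set_integrable_def integrable_restrict_space)

lemma set_lebesgue_integral_eq_lebesgue_on:
  fixes f :: "'a::euclidean_space \<Rightarrow> 'b::{banach, second_countable_topology}"
  assumes "\<Omega> \<in> sets lebesgue"
  shows "(LINT x:\<Omega>|lebesgue. f x) = (\<integral>x. f x \<partial>lebesgue_on \<Omega>)"
  using assms by (simp add: set_lebesgue_integral_def integral_restrict_space)

lemma AE_iff_lebesgue_on:
  assumes "\<Omega> \<in> sets lebesgue"
  shows "(AE x in lebesgue. x \<in> \<Omega> \<longrightarrow> P x) \<longleftrightarrow> (AE x in lebesgue_on \<Omega>. P x)"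
  using assms by (simp add: AE_restrict_space_iff)

lemma continuous_borel_measurable_lebesgue_on:
  fixes f :: "'a::euclidean_space \<Rightarrow> 'b::topological_space"
  assumes "continuous_on UNIV f"
  shows "f \<in> borel_measurable (lebesgue_on \<Omega>)"
  using borel_measurable_continuous_onI[OF assms]
  by (intro measurable_restrict_space1 measurable_completion) auto

lemma lebesgue_on_support:
  fixes f :: "'a::euclidean_space \<Rightarrow> real"
  assumes "\<Omega> \<in> sets lebesgue" "continuous_on UNIV f" "compact K" "K \<subseteq> \<Omega>" "\<And>x. x \<notin> K \<Longrightarrow> f x = 0"
  shows "integrable (lebesgue_on \<Omega>) f" "(\<integral>x. f x \<partial>lebesgue_on \<Omega>) = (\<integral>x. f x \<partial>lborel)"
proof -
  have *: "(\<lambda>x. indicat_real \<Omega> x * f x) = f" using assms(4,5) by (force simp: indicator_def)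
  have [measurable]: "f \<in> borel_measurable borel" using assms(2) by (rule borel_measurable_continuous_onI)
  have "integrable lborel f" by (rule continuous_compact_support_integrable[OF assms(2,3,5)])
  then have "integrable lebesgue f" by (subst integrable_completion) auto
  then show "integrable (lebesgue_on \<Omega>) f" using assms(1) by (subst integrable_restrict_space) (auto simp: *)
  show "(\<integral>x. f x \<partial>lebesgue_on \<Omega>) = (\<integral>x. f x \<partial>lborel)"
    using assms(1) by (subst integral_restrict_space) (auto simp: * integral_completion)
qed

lemma test_fun_powr_lebesgue_on:
  assumes \<Omega>: "\<Omega> \<in> sets lebesgue" and \<phi>: "test_fun \<Omega> \<phi>" and p: "p > 0"
  shows "integrable (lebesgue_on \<Omega>) (\<lambda>x. \<bar>\<phi> x\<bar> powr p)"
    "(\<integral>x. \<bar>\<phi> x\<bar> powr p \<partial>lebesgue_on \<Omega>) = (\<integral>x. \<bar>\<phi> x\<bar> powr p \<partial>lborel)"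
    "integrable (lebesgue_on \<Omega>) (\<lambda>x. norm (grad_fun \<phi> x) powr p)"
    "(\<integral>x. norm (grad_fun \<phi> x) powr p \<partial>lebesgue_on \<Omega>) = (\<integral>x. norm (grad_fun \<phi> x) powr p \<partial>lborel)"
proof -
  have c1: "continuous_on UNIV (\<lambda>x. \<bar>\<phi> x\<bar> powr p)"
    using p by (intro continuous_on_powr' continuous_on_rabs test_fun_continuous[OF \<phi>] continuous_on_const) auto
  have c2: "continuous_on UNIV (\<lambda>x. norm (grad_fun \<phi> x) powr p)"
    using p by (intro continuous_on_powr' continuous_on_norm test_fun_continuous_grad[OF \<phi>] continuous_on_const) auto
  note * = lebesgue_on_support[OF \<Omega> _ test_fun_compact[OF \<phi>] test_fun_subset[OF \<phi>]]
  show "integrable (lebesgue_on \<Omega>) (\<lambda>x. \<bar>\<phi> x\<bar> powr p)"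
    "(\<integral>x. \<bar>\<phi> x\<bar> powr p \<partial>lebesgue_on \<Omega>) = (\<integral>x. \<bar>\<phi> x\<bar> powr p \<partial>lborel)"
    by (rule *[OF c1]; simp add: eq_0_outside_tsupp)+
  show "integrable (lebesgue_on \<Omega>) (\<lambda>x. norm (grad_fun \<phi> x) powr p)"
    "(\<integral>x. norm (grad_fun \<phi> x) powr p \<partial>lebesgue_on \<Omega>) = (\<integral>x. norm (grad_fun \<phi> x) powr p \<partial>lborel)"
    by (rule *[OF c2]; simp add: grad_eq_0_outside_tsupp)+
qed

lemma powr_add_le:
  fixes a b p :: real
  assumes "a \<ge> 0" "b \<ge> 0" "p > 0"
  shows "(a + b) powr p \<le> 2 powr p * (a powr p + b powr p)"
proof -
  have "(a + b) powr p \<le> (2 * max a b) powr p" using assms by (intro powr_mono2) auto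
  also have "\<dots> = 2 powr p * max a b powr p" by (simp add: powr_mult)
  also have "max a b powr p \<le> a powr p + b powr p" by (auto simp: max_def)
  finally show ?thesis by simp
qed

lemma norm_diff_powr_le:
  fixes a b :: "'a::real_normed_vector"
  assumes "p > 0"
  shows "norm (a - b) powr p \<le> 2 powr p * (norm a powr p + norm b powr p)"
proof -
  have "norm (a - b) powr p \<le> (norm a + norm b) powr p"
    using assms by (intro powr_mono2 norm_triangle_ineq4) auto
  also have "\<dots> \<le> 2 powr p * (norm a powr p + norm b powr p)" using assms by (intro powr_add_le) auto
  finally show ?thesis .
qed

text \<open>Indices with integrals below \<open>(1 / 2) ^ n\<close> make the sum \<open>S\<close> of
  the selected functions integrable. It dominates each of them, and almost everywhere convergence of
  the series sends its terms to 0. The selection \<open>r\<close> need not be increasing.\<close>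

lemma L1_tendsto_0_dominated_subsequence:
  fixes d :: "nat \<Rightarrow> 'a \<Rightarrow> real"
  assumes int: "\<And>n. integrable M (d n)" and nonneg: "\<And>n x. d n x \<ge> 0"
    and lim: "(\<lambda>n. \<integral>x. d n x \<partial>M) \<longlonglongrightarrow> 0"
  obtains r :: "nat \<Rightarrow> nat" and S where "integrable M S"
    "AE x in M. (\<forall>n. d (r n) x \<le> S x) \<and> (\<lambda>n. d (r n) x) \<longlonglongrightarrow> 0"
proof -
  have "\<exists>m. (\<integral>x. d m x \<partial>M) < (1 / 2) ^ n" for n :: nat
  proof -
    have "\<forall>\<^sub>F m in sequentially. (\<integral>x. d m x \<partial>M) < (1 / 2) ^ n"
      by (rule order_tendstoD(2)[OF lim]) simp
    then show ?thesis using eventually_happens trivial_limit_sequentially by blast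
  qed
  then obtain r :: "nat \<Rightarrow> nat" where r: "\<And>n. (\<integral>x. d (r n) x \<partial>M) < (1 / 2) ^ n" by metis
  define S where "S = (\<lambda>x. \<Sum>n. d (r n) x)"
  have summ: "summable (\<lambda>n. \<integral>x. norm (d (r n) x) \<partial>M)"
    by (rule summable_comparison_test[OF _ summable_geometric[of "1 / 2 :: real"]])
       (use r nonneg in \<open>auto intro!: exI[of _ 0] less_imp_le\<close>)
  have [measurable]: "d n \<in> borel_measurable M" for n using int by auto
  have "(\<integral>\<^sup>+x. (\<Sum>n. ennreal (d (r n) x)) \<partial>M) = (\<Sum>n. \<integral>\<^sup>+x. ennreal (d (r n) x) \<partial>M)"
    by (rule nn_integral_suminf) measurable
  also have "\<dots> = (\<Sum>n. ennreal (\<integral>x. d (r n) x \<partial>M))"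
    using int nonneg by (intro suminf_cong nn_integral_eq_integral) auto
  also have "\<dots> \<noteq> \<infinity>"
    using summ nonneg by (subst suminf_ennreal2) auto
  finally have "AE x in M. (\<Sum>n. ennreal (d (r n) x)) \<noteq> \<infinity>"
    by (intro nn_integral_noteq_infinite) auto
  then have AEs: "AE x in M. summable (\<lambda>n. d (r n) x)"
    by eventually_elim (use nonneg in \<open>auto intro: summable_suminf_not_top\<close>)
  have "integrable M S"
    unfolding S_def using summ AEs nonneg by (intro integrable_suminf int) auto
  moreover have "AE x in M. (\<forall>n. d (r n) x \<le> S x) \<and> (\<lambda>n. d (r n) x) \<longlonglongrightarrow> 0"
    using AEs
  proof eventually_elim
    case (elim x)
    have "d (r n) x \<le> S x" for n
      using sum_le_suminf[OF elim, of "{n}"] nonneg by (simp add: S_def)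
    then show ?case using summable_LIMSEQ_zero[OF elim] by blast
  qed
  ultimately show ?thesis using that by blast
qed

lemma tendsto_0_if_powr_tendsto_0:
  fixes f :: "nat \<Rightarrow> 'a::real_normed_vector"
  assumes "(\<lambda>n. norm (f n) powr p) \<longlonglongrightarrow> 0" "p > 0"
  shows "f \<longlonglongrightarrow> 0"
proof (rule tendsto_norm_zero_cancel)
  have "(\<lambda>n. (norm (f n) powr p) powr (1 / p)) \<longlonglongrightarrow> 0 powr (1 / p)"
    using assms by (intro tendsto_powr') auto
  then show "(\<lambda>n. norm (f n)) \<longlonglongrightarrow> 0" using assms by (simp add: powr_powr)
qed

text \<open>Replaces convergence in norm by the hypotheses of dominated convergence. The errors of
  function and gradient are added into one \<open>d\<close>, so that a single selection of indices
  serves both.\<close>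

lemma W01p_approximation:
  fixes \<Omega> :: "(real^'n::finite) set"
  assumes \<Omega>: "\<Omega> \<in> sets lebesgue" and W: "W01p \<Omega> p f Df" and p: "p > 0"
  obtains \<phi> :: "nat \<Rightarrow> real^'n \<Rightarrow> real" and H where "\<And>n. test_fun \<Omega> (\<phi> n)" "integrable (lebesgue_on \<Omega>) H"
    "AE x in lebesgue_on \<Omega>. (\<lambda>n. \<phi> n x) \<longlonglongrightarrow> f x \<and> (\<lambda>n. grad_fun (\<phi> n) x) \<longlonglongrightarrow> Df x
       \<and> (\<forall>n. norm (grad_fun (\<phi> n) x) powr p \<le> H x)"
proof -
  define M where "M = lebesgue_on \<Omega>"
  note eqs = set_borel_measurable_iff_lebesgue_on[OF \<Omega>] set_integrable_iff_lebesgue_on[OF \<Omega>]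
    set_lebesgue_integral_eq_lebesgue_on[OF \<Omega>] M_def[symmetric]
  have f[measurable]: "f \<in> borel_measurable M" and fi: "integrable M (\<lambda>x. \<bar>f x\<bar> powr p)"
    and Df[measurable]: "Df \<in> borel_measurable M" and Dfi: "integrable M (\<lambda>x. norm (Df x) powr p)"
    using W unfolding W01p_def W1p_def Lp_fun_def eqs by auto
  obtain \<phi> where \<phi>: "\<And>n. test_fun \<Omega> (\<phi> n)"
    and l1: "(\<lambda>n. \<integral>x. \<bar>\<phi> n x - f x\<bar> powr p \<partial>M) \<longlonglongrightarrow> 0"
    and l2: "(\<lambda>n. \<integral>x. norm (grad_fun (\<phi> n) x - Df x) powr p \<partial>M) \<longlonglongrightarrow> 0"
    using W unfolding W01p_def eqs by blast
  have [measurable]: "\<phi> n \<in> borel_measurable M" "grad_fun (\<phi> n) \<in> borel_measurable M" for n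
    unfolding M_def using test_fun_continuous[OF \<phi>] test_fun_continuous_grad[OF \<phi>]
    by (auto intro: continuous_borel_measurable_lebesgue_on)
  have i1: "integrable M (\<lambda>x. \<bar>\<phi> n x - f x\<bar> powr p)" for n
  proof (rule Bochner_Integration.integrable_bound)
    show "integrable M (\<lambda>x. 2 powr p * (\<bar>\<phi> n x\<bar> powr p + \<bar>f x\<bar> powr p))"
      using fi test_fun_powr_lebesgue_on(1)[OF \<Omega> \<phi> p] unfolding M_def by simp
    have "norm (\<bar>\<phi> n x - f x\<bar> powr p) \<le> norm (2 powr p * (\<bar>\<phi> n x\<bar> powr p + \<bar>f x\<bar> powr p))" for x
      using norm_diff_powr_le[OF p, of "\<phi> n x" "f x"] by simp
    then show "AE x in M. norm (\<bar>\<phi> n x - f x\<bar> powr p) \<le> norm (2 powr p * (\<bar>\<phi> n x\<bar> powr p + \<bar>f x\<bar> powr p))" by simp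
  qed measurable
  have i2: "integrable M (\<lambda>x. norm (grad_fun (\<phi> n) x - Df x) powr p)" for n
  proof (rule Bochner_Integration.integrable_bound)
    show "integrable M (\<lambda>x. 2 powr p * (norm (grad_fun (\<phi> n) x) powr p + norm (Df x) powr p))"
      using Dfi test_fun_powr_lebesgue_on(3)[OF \<Omega> \<phi> p] unfolding M_def by simp
    have "norm (norm (grad_fun (\<phi> n) x - Df x) powr p)
        \<le> norm (2 powr p * (norm (grad_fun (\<phi> n) x) powr p + norm (Df x) powr p))" for x
      using norm_diff_powr_le[OF p, of "grad_fun (\<phi> n) x" "Df x"] by simp
    then show "AE x in M. norm (norm (grad_fun (\<phi> n) x - Df x) powr p)
        \<le> norm (2 powr p * (norm (grad_fun (\<phi> n) x) powr p + norm (Df x) powr p))" by simp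
  qed measurable
  define d where "d = (\<lambda>n x. \<bar>\<phi> n x - f x\<bar> powr p + norm (grad_fun (\<phi> n) x - Df x) powr p)"
  have "(\<lambda>n. \<integral>x. d n x \<partial>M) \<longlonglongrightarrow> 0"
    using tendsto_add[OF l1 l2] i1 i2 by (simp add: d_def)
  moreover have "integrable M (d n)" for n unfolding d_def using i1 i2 by simp
  moreover have "d n x \<ge> 0" for n x by (simp add: d_def)
  ultimately obtain r :: "nat \<Rightarrow> nat" and S where S: "integrable M S"
    "AE x in M. (\<forall>n. d (r n) x \<le> S x) \<and> (\<lambda>n. d (r n) x) \<longlonglongrightarrow> 0"
    using L1_tendsto_0_dominated_subsequence[of M d] by blast
  define H where "H = (\<lambda>x. 2 powr p * (S x + norm (Df x) powr p))"
  have "integrable M H" unfolding H_def using S Dfi by simp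
  moreover have "AE x in M. (\<lambda>n. \<phi> (r n) x) \<longlonglongrightarrow> f x \<and> (\<lambda>n. grad_fun (\<phi> (r n)) x) \<longlonglongrightarrow> Df x
       \<and> (\<forall>n. norm (grad_fun (\<phi> (r n)) x) powr p \<le> H x)"
    using S(2)
  proof eventually_elim
    case (elim x)
    have "(\<lambda>n. \<bar>\<phi> (r n) x - f x\<bar> powr p) \<longlonglongrightarrow> 0" "(\<lambda>n. norm (grad_fun (\<phi> (r n)) x - Df x) powr p) \<longlonglongrightarrow> 0"
      using elim
        tendsto_sandwich[of "\<lambda>_. 0" "\<lambda>n. \<bar>\<phi> (r n) x - f x\<bar> powr p" sequentially "\<lambda>n. d (r n) x" 0]
        tendsto_sandwich[of "\<lambda>_. 0" "\<lambda>n. norm (grad_fun (\<phi> (r n)) x - Df x) powr p" sequentially "\<lambda>n. d (r n) x" 0]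
      by (simp_all add: d_def)
    then have "(\<lambda>n. \<phi> (r n) x - f x) \<longlonglongrightarrow> 0" "(\<lambda>n. grad_fun (\<phi> (r n)) x - Df x) \<longlonglongrightarrow> 0"
      using tendsto_0_if_powr_tendsto_0[OF _ p] by (auto simp flip: real_norm_def)
    moreover have "norm (grad_fun (\<phi> (r n)) x) powr p \<le> H x" for n
    proof -
      have "norm (grad_fun (\<phi> (r n)) x) \<le> norm (grad_fun (\<phi> (r n)) x - Df x) + norm (Df x)"
        using norm_triangle_ineq[of "grad_fun (\<phi> (r n)) x - Df x" "Df x"] by simp
      then have "norm (grad_fun (\<phi> (r n)) x) powr p \<le> (norm (grad_fun (\<phi> (r n)) x - Df x) + norm (Df x)) powr p"
        using p by (intro powr_mono2) auto
      also have "\<dots> \<le> 2 powr p * (norm (grad_fun (\<phi> (r n)) x - Df x) powr p + norm (Df x) powr p)"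
        using p by (intro powr_add_le) auto
      also have "norm (grad_fun (\<phi> (r n)) x - Df x) powr p \<le> d (r n) x" by (simp add: d_def)
      also have "d (r n) x \<le> S x" using elim by blast
      finally show ?thesis by (simp add: H_def)
    qed
    ultimately show ?case by (simp add: LIM_zero_iff)
  qed
  ultimately show ?thesis using that[of "\<lambda>n. \<phi> (r n)" H] \<phi> unfolding M_def by blast
qed

section \<open>Testing with truncations of the solution\<close>

text \<open>The left integral converges because bounded functions on a finite measure space are
  dominated by a constant; no q-th power integrability of the limit is presupposed, since this is
  what the inequality will later establish.\<close>

lemma sobolev_limit:
  fixes v :: "nat \<Rightarrow> 'a \<Rightarrow> real" and w :: "nat \<Rightarrow> 'a \<Rightarrow> real"
  assumes M: "finite_measure M"
    and [measurable]: "\<And>n. v n \<in> borel_measurable M" "\<And>n. w n \<in> borel_measurable M"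
      "v' \<in> borel_measurable M" "w' \<in> borel_measurable M"
    and lim: "AE x in M. (\<lambda>n. v n x) \<longlonglongrightarrow> v' x \<and> (\<lambda>n. w n x) \<longlonglongrightarrow> w' x"
    and bound: "\<And>n x. \<bar>v n x\<bar> \<le> B" "integrable M H" "AE x in M. \<forall>n. \<bar>w n x\<bar> powr p \<le> H x"
    and p: "p > 0" "q > 0"
    and ineq: "\<And>n. (\<integral>x. \<bar>v n x\<bar> powr q \<partial>M) \<le> K * (\<integral>x. \<bar>w n x\<bar> powr p \<partial>M) powr (q / p)"
  shows "(\<integral>x. \<bar>v' x\<bar> powr q \<partial>M) \<le> K * (\<integral>x. \<bar>w' x\<bar> powr p \<partial>M) powr (q / p)"
proof (rule LIMSEQ_le)
  interpret finite_measure M by fact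
  show "(\<lambda>n. \<integral>x. \<bar>v n x\<bar> powr q \<partial>M) \<longlonglongrightarrow> (\<integral>x. \<bar>v' x\<bar> powr q \<partial>M)"
  proof (rule integral_dominated_convergence[where w="\<lambda>_. B powr q"])
    show "AE x in M. (\<lambda>n. \<bar>v n x\<bar> powr q) \<longlonglongrightarrow> \<bar>v' x\<bar> powr q"
      using lim by eventually_elim (use p in \<open>auto intro!: tendsto_powr' tendsto_rabs\<close>)
    show "AE x in M. norm (\<bar>v n x\<bar> powr q) \<le> B powr q" for n
      using bound(1) p by (auto intro!: powr_mono2)
  qed auto
  have "(\<lambda>n. \<integral>x. \<bar>w n x\<bar> powr p \<partial>M) \<longlonglongrightarrow> (\<integral>x. \<bar>w' x\<bar> powr p \<partial>M)"
  proof (rule integral_dominated_convergence[where w=H])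
    show "AE x in M. (\<lambda>n. \<bar>w n x\<bar> powr p) \<longlonglongrightarrow> \<bar>w' x\<bar> powr p"
      using lim by eventually_elim (use p in \<open>auto intro!: tendsto_powr' tendsto_rabs\<close>)
    show "AE x in M. norm (\<bar>w n x\<bar> powr p) \<le> H x" for n
      using bound(3) by eventually_elim auto
  qed (use bound in auto)
  then show "(\<lambda>n. K * (\<integral>x. \<bar>w n x\<bar> powr p \<partial>M) powr (q / p)) \<longlonglongrightarrow> K * (\<integral>x. \<bar>w' x\<bar> powr p \<partial>M) powr (q / p)"
    using p by (intro tendsto_mult_left tendsto_powr') auto
qed (use ineq in auto)

text \<open>The weak form of one equation, with coefficients \<open>a = A(x,u)\<close>, \<open>b = D\<^sub>sA(x,u)\<close>, \<open>\<gamma> = g(x,u)\<close>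
  frozen along the solution, tested with \<open>v\<close> of gradient \<open>V\<close>.\<close>

definition weak_form :: "'x measure \<Rightarrow> real \<Rightarrow> ('x \<Rightarrow> real) \<Rightarrow> ('x \<Rightarrow> real) \<Rightarrow> ('x \<Rightarrow> real) \<Rightarrow>
    ('x \<Rightarrow> 'v::euclidean_space) \<Rightarrow> ('x \<Rightarrow> real) \<Rightarrow> ('x \<Rightarrow> 'v) \<Rightarrow> bool" where
  "weak_form M p a b \<gamma> Du v V \<longleftrightarrow>
     (\<integral>x. a x * norm (Du x) powr (p - 2) * (Du x \<bullet> V x) \<partial>M) + 1 / p * (\<integral>x. b x * norm (Du x) powr p * v x \<partial>M)
     = (\<integral>x. \<gamma> x * v x \<partial>M)"

lemma powr_mult_le_sum:
  fixes s t p :: real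
  assumes "s \<ge> 0" "t \<ge> 0" "p \<ge> 1"
  shows "s powr (p - 1) * t \<le> s powr p + t powr p"
proof -
  define m where "m = max s t"
  have "s powr (p - 1) * t \<le> m powr (p - 1) * m"
    using assms by (intro mult_mono powr_mono2) (auto simp: m_def)
  also have "\<dots> = m powr p"
    using assms by (cases "m = 0") (auto simp: powr_diff m_def)
  also have "\<dots> \<le> s powr p + t powr p" by (auto simp: m_def max_def)
  finally show ?thesis .
qed

lemma weak_form_integrand_bound:
  fixes D V :: "'v::euclidean_space"
  assumes "\<bar>a\<bar> \<le> c" "p > 1"
  shows "\<bar>a * norm D powr (p - 2) * (D \<bullet> V)\<bar> \<le> c * (norm D powr p + norm V powr p)"
proof -
  have "\<bar>a * norm D powr (p - 2) * (D \<bullet> V)\<bar> \<le> c * (norm D powr (p - 2) * (norm D * norm V))"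
    unfolding abs_mult mult.assoc using assms Cauchy_Schwarz_ineq2[of D V]
    by (intro mult_mono) auto
  also have "norm D powr (p - 2) * (norm D * norm V) = norm D powr (p - 1) * norm V"
  \<comment> \<open>For \<open>p < 2\<close> the exponent \<open>p - 2\<close> is negative, but
    \<open>0 powr r = 0\<close> for every \<open>r\<close>, so both sides vanish at
    \<open>D = 0\<close>.\<close>
  proof (cases "D = 0")
    case False
    then have "norm D powr (p - 2) * norm D powr 1 = norm D powr (p - 1)"
      unfolding powr_add[symmetric] by simp
    then show ?thesis using False by (simp add: mult.assoc[symmetric])
  qed simp
  also have "c * (norm D powr (p - 1) * norm V) \<le> c * (norm D powr p + norm V powr p)"
    using assms by (intro mult_left_mono powr_mult_le_sum) auto
  finally show ?thesis .
qed

text \<open>Three applications of dominated convergence. The leading term uses the majorant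
  \<open>H\<close> of the gradients; in the other two the factor of \<open>v n\<close> is merely
  integrable, whence the uniform bound \<open>B\<close>.\<close>

lemma weak_form_limit:
  fixes V :: "nat \<Rightarrow> 'x \<Rightarrow> 'v::euclidean_space"
  assumes [measurable]: "a \<in> borel_measurable M" "b \<in> borel_measurable M" "Du \<in> borel_measurable M"
    and bnd: "AE x in M. \<bar>a x\<bar> \<le> c \<and> \<bar>b x\<bar> \<le> c"
    and \<gamma>: "integrable M \<gamma>" and Du: "integrable M (\<lambda>x. norm (Du x) powr p)" and p: "p > 1"
    and [measurable]: "\<And>n. v n \<in> borel_measurable M" "\<And>n. V n \<in> borel_measurable M"
      "v' \<in> borel_measurable M" "V' \<in> borel_measurable M"
    and lim: "AE x in M. (\<lambda>n. v n x) \<longlonglongrightarrow> v' x \<and> (\<lambda>n. V n x) \<longlonglongrightarrow> V' x"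
    and bound: "\<And>n x. \<bar>v n x\<bar> \<le> B" "integrable M H" "AE x in M. \<forall>n. norm (V n x) powr p \<le> H x"
    and eq: "\<And>n. weak_form M p a b \<gamma> Du (v n) (V n)"
  shows "weak_form M p a b \<gamma> Du v' V'"
proof -
  have [measurable]: "\<gamma> \<in> borel_measurable M" using \<gamma> by auto
  have "(\<lambda>n. \<integral>x. a x * norm (Du x) powr (p - 2) * (Du x \<bullet> V n x) \<partial>M)
      \<longlonglongrightarrow> (\<integral>x. a x * norm (Du x) powr (p - 2) * (Du x \<bullet> V' x) \<partial>M)"
  proof (rule integral_dominated_convergence[where w="\<lambda>x. c * (norm (Du x) powr p + H x)"])
    show "AE x in M. (\<lambda>n. a x * norm (Du x) powr (p - 2) * (Du x \<bullet> V n x))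
        \<longlonglongrightarrow> a x * norm (Du x) powr (p - 2) * (Du x \<bullet> V' x)"
      using lim by eventually_elim (auto intro!: tendsto_intros)
    show "AE x in M. norm (a x * norm (Du x) powr (p - 2) * (Du x \<bullet> V n x)) \<le> c * (norm (Du x) powr p + H x)" for n
      using bnd bound(3)
    proof eventually_elim
      case (elim x)
      then have "\<bar>a x * norm (Du x) powr (p - 2) * (Du x \<bullet> V n x)\<bar> \<le> c * (norm (Du x) powr p + norm (V n x) powr p)"
        using p by (intro weak_form_integrand_bound) auto
      also have "\<dots> \<le> c * (norm (Du x) powr p + H x)" using elim by (intro mult_left_mono add_left_mono) auto
      finally show ?case by simp
    qed
  qed (use Du bound in auto)
  moreover have "(\<lambda>n. \<integral>x. b x * norm (Du x) powr p * v n x \<partial>M) \<longlonglongrightarrow> (\<integral>x. b x * norm (Du x) powr p * v' x \<partial>M)"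
  proof (rule integral_dominated_convergence[where w="\<lambda>x. c * norm (Du x) powr p * B"])
    show "AE x in M. (\<lambda>n. b x * norm (Du x) powr p * v n x) \<longlonglongrightarrow> b x * norm (Du x) powr p * v' x"
      using lim by eventually_elim (auto intro!: tendsto_intros)
    show "AE x in M. norm (b x * norm (Du x) powr p * v n x) \<le> c * norm (Du x) powr p * B" for n
      using bnd by eventually_elim (use bound(1) in \<open>auto simp: abs_mult intro!: mult_mono\<close>)
  qed (use Du in auto)
  moreover have "(\<lambda>n. \<integral>x. \<gamma> x * v n x \<partial>M) \<longlonglongrightarrow> (\<integral>x. \<gamma> x * v' x \<partial>M)"
  proof (rule integral_dominated_convergence[where w="\<lambda>x. \<bar>\<gamma> x\<bar> * B"])
    show "AE x in M. (\<lambda>n. \<gamma> x * v n x) \<longlonglongrightarrow> \<gamma> x * v' x"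
      using lim by eventually_elim (auto intro!: tendsto_intros)
    show "AE x in M. norm (\<gamma> x * v n x) \<le> \<bar>\<gamma> x\<bar> * B" for n
      using bound(1) by (auto simp: abs_mult intro!: mult_left_mono)
  qed (use \<gamma> in auto)
  ultimately have "(\<lambda>n. \<integral>x. \<gamma> x * v n x \<partial>M) \<longlonglongrightarrow>
    (\<integral>x. a x * norm (Du x) powr (p - 2) * (Du x \<bullet> V' x) \<partial>M) + 1 / p * (\<integral>x. b x * norm (Du x) powr p * v' x \<partial>M)"
    unfolding eq[unfolded weak_form_def, symmetric] by (intro tendsto_add tendsto_mult_left)
  then show ?thesis
    unfolding weak_form_def using \<open>(\<lambda>n. \<integral>x. \<gamma> x * v n x \<partial>M) \<longlonglongrightarrow> (\<integral>x. \<gamma> x * v' x \<partial>M)\<close>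
    by (rule LIMSEQ_unique)
qed

section \<open>Transfer of estimates from test functions to truncations\<close>

lemma finite_measure_lebesgue_on:
  fixes \<Omega> :: "'a::euclidean_space set"
  assumes "\<Omega> \<in> sets lebesgue" "bounded \<Omega>"
  shows "finite_measure (lebesgue_on \<Omega>)"
proof
  have "emeasure lebesgue \<Omega> < \<infinity>"
    using bounded_set_imp_lmeasurable[OF assms(2,1)] by (auto dest: fmeasurableD2 simp: less_top simp del: emeasure_completion)
  then show "emeasure (lebesgue_on \<Omega>) (space (lebesgue_on \<Omega>)) \<noteq> \<infinity>"
    using assms(1) by (simp add: emeasure_restrict_space del: emeasure_completion)
qed

lemma W01p_measurable:
  assumes "\<Omega> \<in> sets lebesgue" "W01p \<Omega> p f Df"
  shows "f \<in> borel_measurable (lebesgue_on \<Omega>)" "Df \<in> borel_measurable (lebesgue_on \<Omega>)"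
    "integrable (lebesgue_on \<Omega>) (\<lambda>x. norm (Df x) powr p)"
  using assms unfolding W01p_def W1p_def Lp_fun_def
  by (auto simp: set_borel_measurable_iff_lebesgue_on set_integrable_iff_lebesgue_on)

locale W01p_function =
  fixes \<Omega> :: "(real^'n::finite) set" and p :: real and f :: "real^'n \<Rightarrow> real" and Df :: "real^'n \<Rightarrow> real^'n"
  assumes \<Omega>: "\<Omega> \<in> sets lebesgue" "bounded \<Omega>" and W: "W01p \<Omega> p f Df" and p: "p > 1"
begin

abbreviation "M \<equiv> lebesgue_on \<Omega>"

sublocale finite_measure M by (rule finite_measure_lebesgue_on[OF \<Omega>])

lemmas measurable_f [measurable] = W01p_measurable(1)[OF \<Omega>(1) W]
lemmas measurable_Df [measurable] = W01p_measurable(2)[OF \<Omega>(1) W]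
lemmas integrable_Df = W01p_measurable(3)[OF \<Omega>(1) W]

text \<open>An induction principle in place of a chain rule: \<open>P\<close> concerns a function
  paired with a candidate gradient, holds for test functions and survives bounded, dominated limits.
  The Sobolev inequality and the weak form are both obtained as instances.\<close>

lemma trunc_induct:
  fixes P :: "(real^'n \<Rightarrow> real) \<Rightarrow> (real^'n \<Rightarrow> real^'n) \<Rightarrow> bool"
  assumes test: "\<And>\<phi>. test_fun \<Omega> \<phi> \<Longrightarrow> P \<phi> (grad_fun \<phi>)"
    and limit: "\<And>v V v' V' B H. (\<And>n. v n \<in> borel_measurable M) \<Longrightarrow> (\<And>n. V n \<in> borel_measurable M) \<Longrightarrow>
      v' \<in> borel_measurable M \<Longrightarrow> V' \<in> borel_measurable M \<Longrightarrow>
      (AE x in M. (\<lambda>n::nat. v n x) \<longlonglongrightarrow> v' x \<and> (\<lambda>n. V n x) \<longlonglongrightarrow> V' x) \<Longrightarrow>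
      (\<And>n x. \<bar>v n x\<bar> \<le> B) \<Longrightarrow> integrable M H \<Longrightarrow> (AE x in M. \<forall>n. norm (V n x) powr p \<le> H x) \<Longrightarrow>
      (\<And>n. P (v n) (V n)) \<Longrightarrow> P v' V'"
    and h: "h \<ge> 0" "L > 0"
  shows "P (\<lambda>x. trunc h L (f x)) (\<lambda>x. dtrunc h L (f x) *\<^sub>R Df x)"
proof -
  obtain \<phi> H where \<phi>: "\<And>n. test_fun \<Omega> (\<phi> n)" and H: "integrable M H"
    and ae: "AE x in M. (\<lambda>n. \<phi> n x) \<longlonglongrightarrow> f x \<and> (\<lambda>n. grad_fun (\<phi> n) x) \<longlonglongrightarrow> Df x
       \<and> (\<forall>n. norm (grad_fun (\<phi> n) x) powr p \<le> H x)"
    using W01p_approximation[OF \<Omega>(1) W less_trans[OF zero_less_one p]] by blast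
  have [measurable]: "\<phi> n \<in> borel_measurable M" "grad_fun (\<phi> n) \<in> borel_measurable M" for n
    using test_fun_continuous[OF \<phi>] test_fun_continuous_grad[OF \<phi>]
    by (auto intro: continuous_borel_measurable_lebesgue_on)
  have [measurable]: "dtrunc_approx m h L \<in> borel_measurable borel" for m
    by (intro borel_measurable_continuous_onI continuous_dtrunc_approx)
  have tm: "trunc_approx m h L \<in> borel_measurable borel" if "m > 0" for m
    by (intro borel_measurable_continuous_onI continuous_trunc_approx that)
  have scale: "norm (d *\<^sub>R z) powr p \<le> 2 powr p * norm z powr p" if "\<bar>d\<bar> \<le> 2" for d and z :: "real^'n"
  proof -
    have "norm (d *\<^sub>R z) powr p \<le> (2 * norm z) powr p"
      using p that by (intro powr_mono2) (auto intro!: mult_right_mono)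
    then show ?thesis by (simp add: powr_mult)
  qed
  \<comment> \<open>First limit, at fixed steepness \<open>m\<close>: the approximants of
    \<open>f\<close> are composed with a smooth truncation, whose continuity together with that of
    its derivative carries the pointwise convergence over.\<close>
  have smooth: "P (\<lambda>x. trunc_approx m h L (f x)) (\<lambda>x. dtrunc_approx m h L (f x) *\<^sub>R Df x)" if m: "m > 0" for m
  proof (rule limit[where v="\<lambda>n x. trunc_approx m h L (\<phi> n x)" and V="\<lambda>n x. dtrunc_approx m h L (\<phi> n x) *\<^sub>R grad_fun (\<phi> n) x"
        and B=L and H="\<lambda>x. 2 powr p * H x"])
    note [measurable] = tm[OF m]
    show "(\<lambda>x. trunc_approx m h L (\<phi> n x)) \<in> borel_measurable M" for n by measurable
    show "(\<lambda>x. dtrunc_approx m h L (\<phi> n x) *\<^sub>R grad_fun (\<phi> n) x) \<in> borel_measurable M" for n by measurable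
    show "(\<lambda>x. trunc_approx m h L (f x)) \<in> borel_measurable M" by measurable
    show "(\<lambda>x. dtrunc_approx m h L (f x) *\<^sub>R Df x) \<in> borel_measurable M" by measurable
    show "AE x in M. (\<lambda>n. trunc_approx m h L (\<phi> n x)) \<longlonglongrightarrow> trunc_approx m h L (f x) \<and>
        (\<lambda>n. dtrunc_approx m h L (\<phi> n x) *\<^sub>R grad_fun (\<phi> n) x) \<longlonglongrightarrow> dtrunc_approx m h L (f x) *\<^sub>R Df x"
      using ae
    proof eventually_elim
      case (elim x)
      have c: "isCont (trunc_approx m h L) (f x)" "isCont (dtrunc_approx m h L) (f x)"
        using continuous_trunc_approx[OF m] continuous_dtrunc_approx
        by (auto simp: continuous_on_eq_continuous_at)
      show ?case
        using elim by (intro conjI tendsto_scaleR isCont_tendsto_compose[OF c(1)] isCont_tendsto_compose[OF c(2)]) auto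
    qed
    show "\<bar>trunc_approx m h L (\<phi> n x)\<bar> \<le> L" for n x using abs_trunc_approx_le[OF m] h by simp
    show "integrable M (\<lambda>x. 2 powr p * H x)" using H by simp
    show "AE x in M. \<forall>n. norm (dtrunc_approx m h L (\<phi> n x) *\<^sub>R grad_fun (\<phi> n) x) powr p \<le> 2 powr p * H x"
      using ae
    proof eventually_elim
      case (elim x)
      show ?case
      proof
        fix n
        have "norm (dtrunc_approx m h L (\<phi> n x) *\<^sub>R grad_fun (\<phi> n) x) powr p \<le> 2 powr p * norm (grad_fun (\<phi> n) x) powr p"
          by (intro scale abs_dtrunc_approx_le)
        also have "\<dots> \<le> 2 powr p * H x" using elim by (intro mult_left_mono) auto
        finally show "norm (dtrunc_approx m h L (\<phi> n x) *\<^sub>R grad_fun (\<phi> n) x) powr p \<le> 2 powr p * H x" .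
      qed
    qed
    show "P (\<lambda>x. trunc_approx m h L (\<phi> n x)) (\<lambda>x. dtrunc_approx m h L (\<phi> n x) *\<^sub>R grad_fun (\<phi> n) x)" for n
    proof -
      have "grad_fun (\<lambda>x. trunc_approx m h L (\<phi> n x)) = (\<lambda>x. dtrunc_approx m h L (\<phi> n x) *\<^sub>R grad_fun (\<phi> n) x)"
        by (rule ext) (rule grad_trunc_approx[OF \<phi> m])
      then show ?thesis using test[OF test_fun_trunc_approx[OF \<phi>, of m h L n]] by simp
    qed
  qed
  show ?thesis
  \<comment> \<open>Second limit, in the steepness, now with \<open>f\<close> itself inside.
    Convergence holds at every point, the kinks included.\<close>
  proof (rule limit[where v="\<lambda>n x. trunc_approx (real (Suc n)) h L (f x)"
        and V="\<lambda>n x. dtrunc_approx (real (Suc n)) h L (f x) *\<^sub>R Df x"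
        and B=L and H="\<lambda>x. 2 powr p * norm (Df x) powr p"])
    note [measurable] = tm[OF of_nat_0_less_iff[THEN iffD2, OF zero_less_Suc]]
    show "(\<lambda>x. trunc_approx (real (Suc n)) h L (f x)) \<in> borel_measurable M" for n by measurable
    show "(\<lambda>x. dtrunc_approx (real (Suc n)) h L (f x) *\<^sub>R Df x) \<in> borel_measurable M" for n by measurable
    show "(\<lambda>x. trunc h L (f x)) \<in> borel_measurable M" by measurable
    show "(\<lambda>x. dtrunc h L (f x) *\<^sub>R Df x) \<in> borel_measurable M" by measurable
    show "AE x in M. (\<lambda>n. trunc_approx (real (Suc n)) h L (f x)) \<longlonglongrightarrow> trunc h L (f x) \<and>
        (\<lambda>n. dtrunc_approx (real (Suc n)) h L (f x) *\<^sub>R Df x) \<longlonglongrightarrow> dtrunc h L (f x) *\<^sub>R Df x"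
      by (intro AE_I2 conjI trunc_approx_tendsto tendsto_scaleR dtrunc_approx_tendsto tendsto_const)
    show "\<bar>trunc_approx (real (Suc n)) h L (f x)\<bar> \<le> L" for n x using h by (intro abs_trunc_approx_le) auto
    show "integrable M (\<lambda>x. 2 powr p * norm (Df x) powr p)" using integrable_Df by simp
    show "AE x in M. \<forall>n. norm (dtrunc_approx (real (Suc n)) h L (f x) *\<^sub>R Df x) powr p \<le> 2 powr p * norm (Df x) powr p"
      by (intro AE_I2 allI scale abs_dtrunc_approx_le)
    show "P (\<lambda>x. trunc_approx (real (Suc n)) h L (f x)) (\<lambda>x. dtrunc_approx (real (Suc n)) h L (f x) *\<^sub>R Df x)" for n
      by (intro smooth) simp
  qed
qed

end

context W01p_function
begin

lemma sobolev_trunc: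
  assumes sob: "\<And>\<phi>. test_fun \<Omega> \<phi> \<Longrightarrow>
      (\<integral>x. \<bar>\<phi> x\<bar> powr q \<partial>M) \<le> K * (\<integral>x. norm (grad_fun \<phi> x) powr p \<partial>M) powr (q / p)"
    and K: "K \<ge> 0" and q: "q > 0" and h: "h \<ge> 0" "L > 0"
  shows "(\<integral>x. min (max (\<bar>f x\<bar> - h) 0) L powr q \<partial>M)
    \<le> K * (\<integral>x. dtrunc h L (f x) * norm (Df x) powr p \<partial>M) powr (q / p)"
proof -
  have "(\<integral>x. \<bar>trunc h L (f x)\<bar> powr q \<partial>M) \<le> K * (\<integral>x. norm (dtrunc h L (f x) *\<^sub>R Df x) powr p \<partial>M) powr (q / p)"
  proof (rule trunc_induct[where P="\<lambda>v V. (\<integral>x. \<bar>v x\<bar> powr q \<partial>M) \<le> K * (\<integral>x. norm (V x) powr p \<partial>M) powr (q / p)", OF sob _ h])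
    fix v V v' V' B H
    assume [measurable]: "\<And>n. v n \<in> borel_measurable M" "\<And>n. V n \<in> borel_measurable M"
      "v' \<in> borel_measurable M" "V' \<in> borel_measurable M"
      and lim: "AE x in M. (\<lambda>n::nat. v n x) \<longlonglongrightarrow> v' x \<and> (\<lambda>n. V n x) \<longlonglongrightarrow> V' x"
      and B: "\<And>n x. \<bar>v n x\<bar> \<le> B" and H: "integrable M H" "AE x in M. \<forall>n. norm (V n x) powr p \<le> H x"
      and le: "\<And>n. (\<integral>x. \<bar>v n x\<bar> powr q \<partial>M) \<le> K * (\<integral>x. norm (V n x) powr p \<partial>M) powr (q / p)"
    have lim': "AE x in M. (\<lambda>n. v n x) \<longlonglongrightarrow> v' x \<and> (\<lambda>n. norm (V n x)) \<longlonglongrightarrow> norm (V' x)"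
      using lim by eventually_elim (auto intro: tendsto_norm)
    show "(\<integral>x. \<bar>v' x\<bar> powr q \<partial>M) \<le> K * (\<integral>x. norm (V' x) powr p \<partial>M) powr (q / p)"
      using sobolev_limit[OF finite_measure_axioms _ _ _ _ lim' B H(1), of p q K] H(2) le p q by simp
  qed
  also have "\<dots> \<le> K * (\<integral>x. dtrunc h L (f x) * norm (Df x) powr p \<partial>M) powr (q / p)"
  proof (intro mult_left_mono powr_mono2 integral_mono)
    \<comment> \<open>As the factor lies between 0 and 1, its p-th power may be replaced by itself;
      this matches the quantity that the weak form controls, where the factor occurs
      linearly.\<close>
    have "dtrunc h L s powr p \<le> dtrunc h L s" for s
      using powr_mono'[of 1 p "dtrunc h L s"] dtrunc_bounds[OF h, of s] p by (cases "dtrunc h L s = 0") auto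
    then show le: "norm (dtrunc h L (f x) *\<^sub>R Df x) powr p \<le> dtrunc h L (f x) * norm (Df x) powr p" for x
      using dtrunc_bounds[OF h, of "f x"] by (simp add: powr_mult mult_right_mono)
    show int: "integrable M (\<lambda>x. dtrunc h L (f x) * norm (Df x) powr p)"
      by (rule Bochner_Integration.integrable_bound[OF integrable_Df])
         (use dtrunc_bounds[OF h] in \<open>auto simp: mult_left_le_one_le\<close>)
    show "integrable M (\<lambda>x. norm (dtrunc h L (f x) *\<^sub>R Df x) powr p)"
      by (rule Bochner_Integration.integrable_bound[OF int])
         (use le dtrunc_bounds[OF h] in \<open>auto simp: abs_mult\<close>)
  qed (use p q K in auto)
  finally show ?thesis by (simp add: abs_trunc[OF h])
qed

text \<open>With \<open>h = 0\<close> the truncation merely caps \<open>\<bar>f\<bar>\<close>, and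
  the Sobolev bound does not depend on the cap, so Fatou's lemma removes it.\<close>

lemma integrable_powr_if_sobolev:
  assumes sob: "\<And>\<phi>. test_fun \<Omega> \<phi> \<Longrightarrow>
      (\<integral>x. \<bar>\<phi> x\<bar> powr q \<partial>M) \<le> K * (\<integral>x. norm (grad_fun \<phi> x) powr p \<partial>M) powr (q / p)"
    and K: "K \<ge> 0" and q: "q > 0"
  shows "integrable M (\<lambda>x. \<bar>f x\<bar> powr q)"
proof -
  define C where "C = K * (\<integral>x. norm (Df x) powr p \<partial>M) powr (q / p)"
  define v where "v = (\<lambda>n x. ennreal (min \<bar>f x\<bar> (real (Suc n)) powr q))"
  have [measurable]: "v n \<in> borel_measurable M" for n unfolding v_def by measurable
  have vC: "(\<integral>\<^sup>+x. v n x \<partial>M) \<le> ennreal C" for n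
  proof -
    have "integrable M (\<lambda>x. min \<bar>f x\<bar> (real (Suc n)) powr q)"
      by (rule integrable_const_bound[where B="real (Suc n) powr q"]) (use q in \<open>auto intro!: powr_mono2\<close>)
    then have "(\<integral>\<^sup>+x. v n x \<partial>M) = ennreal (\<integral>x. min \<bar>f x\<bar> (real (Suc n)) powr q \<partial>M)"
      unfolding v_def by (intro nn_integral_eq_integral) auto
    also have "(\<integral>x. min \<bar>f x\<bar> (real (Suc n)) powr q \<partial>M)
        \<le> K * (\<integral>x. dtrunc 0 (real (Suc n)) (f x) * norm (Df x) powr p \<partial>M) powr (q / p)"
      using sobolev_trunc[OF sob K q, of 0 "real (Suc n)"] by simp
    also have "\<dots> \<le> C" unfolding C_def
    proof (intro mult_left_mono powr_mono2 integral_mono)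
      show "dtrunc 0 (real (Suc n)) (f x) * norm (Df x) powr p \<le> norm (Df x) powr p" for x
        using dtrunc_bounds[of 0 "real (Suc n)" "f x"] by (intro mult_left_le_one_le) auto
      show "integrable M (\<lambda>x. dtrunc 0 (real (Suc n)) (f x) * norm (Df x) powr p)"
        by (rule Bochner_Integration.integrable_bound[OF integrable_Df])
           (use dtrunc_bounds[of 0 "real (Suc n)"] in \<open>auto simp: mult_left_le_one_le\<close>)
      show "0 \<le> (\<integral>x. dtrunc 0 (real (Suc n)) (f x) * norm (Df x) powr p \<partial>M)"
        by (intro integral_nonneg_AE AE_I2) (use dtrunc_bounds[of 0 "real (Suc n)"] in auto)
    qed (use integrable_Df K p q in auto)
    finally show ?thesis by (simp add: ennreal_leI)
  qed
  have "(\<integral>\<^sup>+x. ennreal (\<bar>f x\<bar> powr q) \<partial>M) = (\<integral>\<^sup>+x. liminf (\<lambda>n. v n x) \<partial>M)"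
  proof (rule nn_integral_cong)
    fix x
    obtain N where N: "\<bar>f x\<bar> < real N" using reals_Archimedean2 by blast
    have "\<forall>\<^sub>F n in sequentially. v n x = ennreal (\<bar>f x\<bar> powr q)"
      unfolding eventually_sequentially v_def using N by (intro exI[of _ N]) (auto simp: min_def)
    then have "(\<lambda>n. v n x) \<longlonglongrightarrow> ennreal (\<bar>f x\<bar> powr q)" by (rule tendsto_eventually)
    then show "ennreal (\<bar>f x\<bar> powr q) = liminf (\<lambda>n. v n x)"
      by (simp add: lim_imp_Liminf)
  qed
  also have "\<dots> \<le> liminf (\<lambda>n. \<integral>\<^sup>+x. v n x \<partial>M)" by (rule nn_integral_liminf) measurable
  also have "\<dots> \<le> ennreal C"
    by (rule order_trans[OF Liminf_mono[OF always_eventually, of _ "\<lambda>_. ennreal C"]]) (auto simp: vC Liminf_const)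
  also have "\<dots> < \<infinity>" by simp
  finally show ?thesis by (intro integrableI_bounded) auto
qed

lemma energy_estimate:
  assumes [measurable]: "a \<in> borel_measurable M" "b \<in> borel_measurable M"
    and bnd: "AE x in M. \<bar>a x\<bar> \<le> c \<and> \<bar>b x\<bar> \<le> c" and \<gamma>: "integrable M \<gamma>"
    and lower: "AE x in M. \<nu> \<le> a x" and sign: "AE x in M. h \<le> \<bar>f x\<bar> \<longrightarrow> 0 \<le> f x * b x"
    and h: "h \<ge> 0" "L > 0"
    and weak: "\<And>\<phi>. test_fun \<Omega> \<phi> \<Longrightarrow> weak_form M p a b \<gamma> Df \<phi> (grad_fun \<phi>)"
  shows "\<nu> * (\<integral>x. dtrunc h L (f x) * norm (Df x) powr p \<partial>M)
    \<le> (\<integral>x. \<bar>\<gamma> x\<bar> * min (max (\<bar>f x\<bar> - h) 0) L \<partial>M)"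
proof -
  have [measurable]: "\<gamma> \<in> borel_measurable M" using \<gamma> by auto
  have tL: "\<bar>trunc h L s\<bar> \<le> L" for s using abs_trunc[OF h, of s] by simp
  have wf: "weak_form M p a b \<gamma> Df (\<lambda>x. trunc h L (f x)) (\<lambda>x. dtrunc h L (f x) *\<^sub>R Df x)"
  proof (rule trunc_induct[where P="weak_form M p a b \<gamma> Df", OF weak _ h])
    fix v V v' V' B H
    assume [measurable]: "\<And>n. v n \<in> borel_measurable M" "\<And>n. V n \<in> borel_measurable M"
      "v' \<in> borel_measurable M" "V' \<in> borel_measurable M"
      and hyps: "AE x in M. (\<lambda>n::nat. v n x) \<longlonglongrightarrow> v' x \<and> (\<lambda>n. V n x) \<longlonglongrightarrow> V' x"
        "\<And>n x. \<bar>v n x\<bar> \<le> B" "integrable M H" "AE x in M. \<forall>n. norm (V n x) powr p \<le> H x"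
        "\<And>n. weak_form M p a b \<gamma> Df (v n) (V n)"
    show "weak_form M p a b \<gamma> Df v' V'"
      by (rule weak_form_limit[OF _ _ _ bnd \<gamma> integrable_Df p _ _ _ _ hyps]) measurable
  qed
  \<comment> \<open>The gradient of the truncation is a multiple of \<open>Df\<close>, so the
    leading term becomes a pure p-th power; \<open>D = 0\<close> is again settled by the value of
    \<open>powr\<close> at 0.\<close>
  have "norm D powr (p - 2) * (D \<bullet> t *\<^sub>R D) = t * norm D powr p" for t and D :: "real^'n"
  proof (cases "D = 0")
    case False
    then have "norm D powr (p - 2) * (norm D)\<^sup>2 = norm D powr p" by (simp add: powr_diff)
    then show ?thesis using False by (simp add: power2_norm_eq_inner[symmetric] mult_ac)
  qed (use p in auto)
  then have "(\<integral>x. a x * (dtrunc h L (f x) * norm (Df x) powr p) \<partial>M)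
      + 1 / p * (\<integral>x. b x * norm (Df x) powr p * trunc h L (f x) \<partial>M) = (\<integral>x. \<gamma> x * trunc h L (f x) \<partial>M)"
    using wf unfolding weak_form_def by (simp only: mult.assoc)
  moreover have "(\<integral>x. b x * norm (Df x) powr p * trunc h L (f x) \<partial>M) \<ge> 0"
  proof (rule integral_nonneg_AE)
    show "AE x in M. 0 \<le> b x * norm (Df x) powr p * trunc h L (f x)"
      using sign
    proof eventually_elim
      case (elim x)
      have "0 \<le> b x * trunc h L (f x)"
      proof (cases "\<bar>f x\<bar> \<le> h")
        case True
        then show ?thesis using trunc_sign(1)[OF h] by simp
      next
        case False
        then consider "f x > 0" "b x \<ge> 0" | "f x < 0" "b x \<le> 0"
          using elim h by (auto simp: zero_le_mult_iff)
        then show ?thesis using trunc_sign(2,3)[OF h, of "f x"]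
          by cases (auto simp: zero_le_mult_iff)
      qed
      then have "0 \<le> norm (Df x) powr p * (b x * trunc h L (f x))" by simp
      then show ?case by (simp add: mult_ac)
    qed
  qed
  ultimately have 1: "(\<integral>x. a x * (dtrunc h L (f x) * norm (Df x) powr p) \<partial>M) \<le> (\<integral>x. \<gamma> x * trunc h L (f x) \<partial>M)"
    using p by (smt (verit, best) divide_nonneg_pos mult_nonneg_nonneg)
  have int: "integrable M (\<lambda>x. dtrunc h L (f x) * norm (Df x) powr p)"
    by (rule Bochner_Integration.integrable_bound[OF integrable_Df])
       (use dtrunc_bounds[OF h] in \<open>auto simp: mult_left_le_one_le\<close>)
  have "\<nu> * (\<integral>x. dtrunc h L (f x) * norm (Df x) powr p \<partial>M) = (\<integral>x. \<nu> * (dtrunc h L (f x) * norm (Df x) powr p) \<partial>M)"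
    by simp
  also have "\<dots> \<le> (\<integral>x. a x * (dtrunc h L (f x) * norm (Df x) powr p) \<partial>M)"
  proof (rule integral_mono_AE)
    show "integrable M (\<lambda>x. \<nu> * (dtrunc h L (f x) * norm (Df x) powr p))" using int by simp
    have "integrable M (\<lambda>x. c * (dtrunc h L (f x) * norm (Df x) powr p))" using int by simp
    then show "integrable M (\<lambda>x. a x * (dtrunc h L (f x) * norm (Df x) powr p))"
    proof (rule Bochner_Integration.integrable_bound)
      show "AE x in M. norm (a x * (dtrunc h L (f x) * norm (Df x) powr p)) \<le> norm (c * (dtrunc h L (f x) * norm (Df x) powr p))"
        using bnd by eventually_elim (auto simp: abs_mult intro!: mult_right_mono)
    qed measurable
    show "AE x in M. \<nu> * (dtrunc h L (f x) * norm (Df x) powr p) \<le> a x * (dtrunc h L (f x) * norm (Df x) powr p)"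
      using lower by eventually_elim (use dtrunc_bounds[OF h] in \<open>auto intro!: mult_right_mono\<close>)
  qed
  also note 1
  also have "(\<integral>x. \<gamma> x * trunc h L (f x) \<partial>M) \<le> (\<integral>x. \<bar>\<gamma> x\<bar> * min (max (\<bar>f x\<bar> - h) 0) L \<partial>M)"
  proof (rule integral_mono)
    have i: "integrable M (\<lambda>x. \<bar>\<gamma> x\<bar> * L)" using \<gamma> by simp
    show "integrable M (\<lambda>x. \<gamma> x * trunc h L (f x))"
      by (rule Bochner_Integration.integrable_bound[OF i])
         (use tL h in \<open>auto simp: abs_mult intro!: mult_left_mono\<close>)
    show "integrable M (\<lambda>x. \<bar>\<gamma> x\<bar> * min (max (\<bar>f x\<bar> - h) 0) L)"
      by (rule Bochner_Integration.integrable_bound[OF i])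
         (use h in \<open>auto simp: abs_mult intro!: mult_left_mono\<close>)
    show "\<gamma> x * trunc h L (f x) \<le> \<bar>\<gamma> x\<bar> * min (max (\<bar>f x\<bar> - h) 0) L" for x
      unfolding abs_trunc[OF h, symmetric] abs_mult[symmetric] by simp
  qed
  finally show ?thesis .
qed

text \<open>On the right the cap \<open>L\<close> is discarded at once, which is legitimate because
  \<open>\<bar>\<gamma>\<bar> * \<bar>f\<bar>\<close> is integrable. On the left it tends to
  infinity with majorant \<open>\<bar>f\<bar> powr q\<close>, integrable by the Sobolev
  inequality.\<close>

lemma level_estimate:
  assumes "a \<in> borel_measurable M" "b \<in> borel_measurable M"
    "AE x in M. \<bar>a x\<bar> \<le> c \<and> \<bar>b x\<bar> \<le> c" and \<gamma>: "integrable M \<gamma>"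
    and "AE x in M. \<nu> \<le> a x" "AE x in M. h \<le> \<bar>f x\<bar> \<longrightarrow> 0 \<le> f x * b x"
    and h: "h \<ge> 0" and \<nu>: "\<nu> > 0"
    and "\<And>\<phi>. test_fun \<Omega> \<phi> \<Longrightarrow> weak_form M p a b \<gamma> Df \<phi> (grad_fun \<phi>)"
    and sob: "\<And>\<phi>. test_fun \<Omega> \<phi> \<Longrightarrow>
      (\<integral>x. \<bar>\<phi> x\<bar> powr q \<partial>M) \<le> K * (\<integral>x. norm (grad_fun \<phi> x) powr p \<partial>M) powr (q / p)"
    and K: "K \<ge> 0" and q: "q > 0" and \<gamma>f: "integrable M (\<lambda>x. \<bar>\<gamma> x\<bar> * \<bar>f x\<bar>)"
  shows "(\<integral>x. max (\<bar>f x\<bar> - h) 0 powr q \<partial>M) \<le> K * ((\<integral>x. \<bar>\<gamma> x\<bar> * max (\<bar>f x\<bar> - h) 0 \<partial>M) / \<nu>) powr (q / p)"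
proof -
  have [measurable]: "\<gamma> \<in> borel_measurable M" using \<gamma> by auto
  have le: "(\<integral>x. min (max (\<bar>f x\<bar> - h) 0) L powr q \<partial>M) \<le> K * ((\<integral>x. \<bar>\<gamma> x\<bar> * max (\<bar>f x\<bar> - h) 0 \<partial>M) / \<nu>) powr (q / p)"
    if L: "L > 0" for L
  proof -
    have i1: "integrable M (\<lambda>x. \<bar>\<gamma> x\<bar> * min (max (\<bar>f x\<bar> - h) 0) L)"
      by (rule Bochner_Integration.integrable_bound[OF \<gamma>f])
         (use h L in \<open>auto simp: abs_mult intro!: mult_left_mono\<close>)
    have i2: "integrable M (\<lambda>x. \<bar>\<gamma> x\<bar> * max (\<bar>f x\<bar> - h) 0)"
      by (rule Bochner_Integration.integrable_bound[OF \<gamma>f])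
         (use h in \<open>auto simp: abs_mult intro!: mult_left_mono\<close>)
    have "\<nu> * (\<integral>x. dtrunc h L (f x) * norm (Df x) powr p \<partial>M)
      \<le> (\<integral>x. \<bar>\<gamma> x\<bar> * min (max (\<bar>f x\<bar> - h) 0) L \<partial>M)"
      using assms(1-7,9) L by (intro energy_estimate)
    also have "\<dots> \<le> (\<integral>x. \<bar>\<gamma> x\<bar> * max (\<bar>f x\<bar> - h) 0 \<partial>M)"
      using i1 i2 by (intro integral_mono mult_left_mono) auto
    finally have *: "(\<integral>x. dtrunc h L (f x) * norm (Df x) powr p \<partial>M) \<le> (\<integral>x. \<bar>\<gamma> x\<bar> * max (\<bar>f x\<bar> - h) 0 \<partial>M) / \<nu>"
      using \<nu> by (simp add: field_simps)
    have "(\<integral>x. min (max (\<bar>f x\<bar> - h) 0) L powr q \<partial>M)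
        \<le> K * (\<integral>x. dtrunc h L (f x) * norm (Df x) powr p \<partial>M) powr (q / p)"
      using sobolev_trunc[OF sob K q h L] by simp
    also have "\<dots> \<le> K * ((\<integral>x. \<bar>\<gamma> x\<bar> * max (\<bar>f x\<bar> - h) 0 \<partial>M) / \<nu>) powr (q / p)"
      using * K p q dtrunc_bounds[OF h L]
      by (intro mult_left_mono powr_mono2) (auto intro!: integral_nonneg_AE)
    finally show ?thesis .
  qed
  have "(\<lambda>n. \<integral>x. min (max (\<bar>f x\<bar> - h) 0) (real (Suc n)) powr q \<partial>M) \<longlonglongrightarrow> (\<integral>x. max (\<bar>f x\<bar> - h) 0 powr q \<partial>M)"
  proof (rule integral_dominated_convergence[where w="\<lambda>x. \<bar>f x\<bar> powr q"])
    show "integrable M (\<lambda>x. \<bar>f x\<bar> powr q)" by (rule integrable_powr_if_sobolev[OF sob K q])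
    show "AE x in M. (\<lambda>n. min (max (\<bar>f x\<bar> - h) 0) (real (Suc n)) powr q) \<longlonglongrightarrow> max (\<bar>f x\<bar> - h) 0 powr q"
    proof (rule AE_I2)
      fix x
      obtain N where "max (\<bar>f x\<bar> - h) 0 < real N" using reals_Archimedean2 by blast
      then have "\<forall>\<^sub>F n in sequentially. min (max (\<bar>f x\<bar> - h) 0) (real (Suc n)) powr q = max (\<bar>f x\<bar> - h) 0 powr q"
        unfolding eventually_sequentially by (intro exI[of _ N]) (auto simp: min_def)
      then show "(\<lambda>n. min (max (\<bar>f x\<bar> - h) 0) (real (Suc n)) powr q) \<longlonglongrightarrow> max (\<bar>f x\<bar> - h) 0 powr q"
        by (rule tendsto_eventually)
    qed
    show "AE x in M. norm (min (max (\<bar>f x\<bar> - h) 0) (real (Suc n)) powr q) \<le> \<bar>f x\<bar> powr q" for n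
      using q h by (auto intro!: powr_mono2)
  qed measurable
  then show ?thesis by (rule LIMSEQ_le_const2) (use le in auto)
qed

end

section \<open>Measurability of Caratheodory compositions\<close>

lemma borel_measurable_lebesgue_on_AE:
  fixes f g :: "'a::euclidean_space \<Rightarrow> 'b::euclidean_space"
  assumes \<Omega>: "\<Omega> \<in> sets lebesgue" and f: "f \<in> borel_measurable (lebesgue_on \<Omega>)"
    and ae: "AE x in lebesgue_on \<Omega>. f x = g x"
  shows "g \<in> borel_measurable (lebesgue_on \<Omega>)"
proof -
  have "(\<lambda>x. indicator \<Omega> x *\<^sub>R f x) \<in> borel_measurable lebesgue"
    using f \<Omega> by (simp add: borel_measurable_restrict_space_iff)
  moreover have "AE x in lebesgue. indicator \<Omega> x *\<^sub>R f x = indicator \<Omega> x *\<^sub>R g x"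
    using ae unfolding AE_iff_lebesgue_on[OF \<Omega>, symmetric] by eventually_elim (auto simp: indicator_def)
  ultimately have "(\<lambda>x. indicator \<Omega> x *\<^sub>R g x) \<in> borel_measurable lebesgue"
    by (rule borel_measurable_AE)
  then show ?thesis using \<Omega> by (simp add: borel_measurable_restrict_space_iff)
qed

lemma borel_measurable_lebesgue_on_AE_limit:
  fixes f :: "nat \<Rightarrow> 'a::euclidean_space \<Rightarrow> real"
  assumes \<Omega>: "\<Omega> \<in> sets lebesgue" and [measurable]: "\<And>n. f n \<in> borel_measurable (lebesgue_on \<Omega>)"
    and ae: "AE x in lebesgue_on \<Omega>. (\<lambda>n. f n x) \<longlonglongrightarrow> g x"
  shows "g \<in> borel_measurable (lebesgue_on \<Omega>)"
proof (rule borel_measurable_lebesgue_on_AE[OF \<Omega>])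
  show "(\<lambda>x. lim (\<lambda>n. f n x)) \<in> borel_measurable (lebesgue_on \<Omega>)" by measurable
  show "AE x in lebesgue_on \<Omega>. lim (\<lambda>n. f n x) = g x"
    using ae by eventually_elim (rule limI)
qed

text \<open>Along simple functions converging to \<open>u\<close> the composition is measurable
  because only finitely many values of the second argument occur. Continuity passes to the limit
  almost everywhere, and completeness of Lebesgue measure absorbs the exceptional set.\<close>

lemma caratheodory_measurable:
  fixes F :: "'a::euclidean_space \<Rightarrow> 'b::euclidean_space \<Rightarrow> real"
  assumes \<Omega>: "\<Omega> \<in> sets lebesgue" and F: "\<And>s. (\<lambda>x. F x s) \<in> borel_measurable (lebesgue_on \<Omega>)"
    and cont: "AE x in lebesgue_on \<Omega>. continuous_on UNIV (F x)"
    and u: "u \<in> borel_measurable (lebesgue_on \<Omega>)"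
  shows "(\<lambda>x. F x (u x)) \<in> borel_measurable (lebesgue_on \<Omega>)"
proof -
  obtain s where s: "\<And>n. simple_function (lebesgue_on \<Omega>) (s n)"
    "\<And>x. x \<in> space (lebesgue_on \<Omega>) \<Longrightarrow> (\<lambda>n. s n x) \<longlonglongrightarrow> u x"
    using borel_measurable_implies_sequence_metric[OF u, of 0] by blast
  show ?thesis
  proof (rule borel_measurable_lebesgue_on_AE_limit[OF \<Omega>])
    show "(\<lambda>x. F x (s n x)) \<in> borel_measurable (lebesgue_on \<Omega>)" for n
    proof (rule measurable_compose_countable'[where I="s n ` space (lebesgue_on \<Omega>)" and g="s n"])
      show "s n \<in> measurable (lebesgue_on \<Omega>) (count_space (s n ` space (lebesgue_on \<Omega>)))"
        using s(1)[of n] by (simp add: simple_function_def measurable_count_space_eq2)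
      show "countable (s n ` space (lebesgue_on \<Omega>))"
        using s(1)[of n] by (simp add: simple_function_def countable_finite)
    qed (rule F)
    show "AE x in lebesgue_on \<Omega>. (\<lambda>n. F x (s n x)) \<longlonglongrightarrow> F x (u x)"
      using cont AE_space
    proof eventually_elim
      case (elim x)
      then have "isCont (F x) (u x)" by (simp add: continuous_on_eq_continuous_at)
      then show ?case by (rule isCont_tendsto_compose) (rule s(2)[OF elim(2)])
    qed
  qed
qed

lemma deriv_caratheodory_measurable:
  fixes F :: "'a::euclidean_space \<Rightarrow> real \<Rightarrow> real"
  assumes \<Omega>: "\<Omega> \<in> sets lebesgue" and F[measurable]: "\<And>s. (\<lambda>x. F x s) \<in> borel_measurable (lebesgue_on \<Omega>)"
    and diff: "AE x in lebesgue_on \<Omega>. \<forall>s. F x differentiable (at s)"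
  shows "(\<lambda>x. deriv (F x) s) \<in> borel_measurable (lebesgue_on \<Omega>)"
proof (rule borel_measurable_lebesgue_on_AE_limit[OF \<Omega>])
  show "(\<lambda>x. (F x (s + inverse (real (Suc n))) - F x s) / inverse (real (Suc n))) \<in> borel_measurable (lebesgue_on \<Omega>)" for n
    by measurable
  show "AE x in lebesgue_on \<Omega>. (\<lambda>n. (F x (s + inverse (real (Suc n))) - F x s) / inverse (real (Suc n))) \<longlonglongrightarrow> deriv (F x) s"
    using diff
  proof eventually_elim
    case (elim x)
    then have "(F x has_real_derivative deriv (F x) s) (at s)"
      by (simp add: DERIV_deriv_iff_real_differentiable)
    then have *: "((\<lambda>h. (F x (s + h) - F x s) / h) \<longlongrightarrow> deriv (F x) s) (at 0)"
      by (simp add: DERIV_def)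
    have "filterlim (\<lambda>n. inverse (real (Suc n))) (at 0) sequentially"
      by (intro filterlim_atI LIMSEQ_inverse_real_of_nat) auto
    from filterlim_compose[OF * this] show ?case .
  qed
qed

text \<open>The ratio \<open>l\<close> solves \<open>b * l powr \<delta> = 1\<close>: the geometric
  growth of the coefficient is cancelled exactly by the superlinear gain, and the smallness of
  \<open>U 0\<close> supplies one more factor \<open>l\<close>. The induction also keeps
  \<open>U n \<le> 1\<close>, below which alone the recursion is assumed.\<close>

lemma de_giorgi_decay:
  fixes U :: "nat \<Rightarrow> real"
  assumes \<delta>: "\<delta> > 0" and b: "b > 1" and C: "C > 0"
    and nonneg: "\<And>n. U n \<ge> 0"
    and step: "\<And>n. U n \<le> 1 \<Longrightarrow> U (Suc n) \<le> C * b ^ n * U n powr (1 + \<delta>)"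
    and start: "U 0 \<le> 1" "C * U 0 powr \<delta> \<le> b powr (- 1 / \<delta>)"
  shows "U \<longlonglongrightarrow> 0"
proof -
  define l where "l = b powr (- 1 / \<delta>)"
  have l: "0 < l" "l < 1" using b \<delta> by (auto simp: l_def powr_less_one)
  have "l powr \<delta> = b powr (- 1 / \<delta> * \<delta>)" unfolding l_def by (rule powr_powr)
  then have bl: "b * l powr \<delta> = 1" using b \<delta> by (simp add: powr_minus)
  have U: "U n \<le> U 0 * l ^ n" for n
  proof (induction n)
    case (Suc n)
    have "l ^ n \<le> 1" using l by (simp add: power_le_one)
    then have "U 0 * l ^ n \<le> 1 * 1" using nonneg[of 0] start(1) l by (intro mult_mono) auto
    then have "U (Suc n) \<le> C * b ^ n * U n powr (1 + \<delta>)" using Suc by (intro step) simp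
    also have "\<dots> \<le> C * b ^ n * (U 0 * l ^ n) powr (1 + \<delta>)"
      using Suc nonneg C b \<delta> by (intro mult_left_mono powr_mono2) auto
    also have "(U 0 * l ^ n) powr (1 + \<delta>) = (U 0 * l ^ n) * (U 0 powr \<delta> * (l powr \<delta>) ^ n)"
    proof -
      have "(l ^ n) powr \<delta> = (l powr \<delta>) ^ n"
        using l by (simp add: powr_realpow[symmetric] powr_powr mult.commute)
      then show ?thesis using l nonneg[of 0] by (cases "U 0 = 0") (auto simp: powr_add powr_mult)
    qed
    also have "C * b ^ n * ((U 0 * l ^ n) * (U 0 powr \<delta> * (l powr \<delta>) ^ n))
        = (C * U 0 powr \<delta>) * (U 0 * l ^ n) * (b * l powr \<delta>) ^ n"
      by (simp add: power_mult_distrib mult_ac)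
    also have "\<dots> \<le> l * (U 0 * l ^ n)"
      using start(2) nonneg[of 0] l unfolding bl l_def[symmetric] by (simp add: mult_right_mono)
    finally show ?case by (simp add: mult_ac)
  qed simp
  have "(\<lambda>n. U 0 * l ^ n) \<longlonglongrightarrow> U 0 * 0"
    using l by (intro tendsto_mult_left LIMSEQ_power_zero) auto
  then have "(\<lambda>n. U 0 * l ^ n) \<longlonglongrightarrow> 0" by simp
  then show ?thesis
    using tendsto_sandwich[of "\<lambda>_. 0" U sequentially "\<lambda>n. U 0 * l ^ n" 0] U nonneg by simp
qed

section \<open>De Giorgi iteration\<close>

text \<open>Each power in the growth condition equals \<open>(t j powr q j) powr \<theta>\<close>
  with \<open>\<theta> = (q k - 1) / q k\<close>, hence is at most
  \<open>(D * Z) powr \<theta>\<close>, while \<open>w\<close> is at most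
  \<open>Z powr (1 / q k)\<close>. The exponents add up to 1, so the product is linear in
  \<open>D * Z\<close>. The condition \<open>1 \<le> D * Z\<close> absorbs the constant 1.\<close>

lemma growth_product_bound:
  fixes t q :: "'d::finite \<Rightarrow> real"
  assumes q: "q k > 1" and t: "\<And>j. t j \<ge> 0" and C: "C \<ge> 0"
    and \<gamma>: "\<bar>\<gamma>\<bar> \<le> C * (1 + (\<Sum>j\<in>UNIV. t j powr (q j * (q k - 1) / q k)))"
    and D: "D \<ge> 1" and Z: "Z \<ge> 0" "1 \<le> D * Z" "\<And>j. t j powr q j \<le> D * Z"
    and w: "w \<ge> 0" "w powr q k \<le> Z"
  shows "\<bar>\<gamma>\<bar> * w \<le> C * (1 + CARD('d)) * D * Z"
proof -
  define \<theta> where "\<theta> = (q k - 1) / q k"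
  have \<theta>: "0 < \<theta>" "\<theta> \<le> 1" "\<theta> + 1 / q k = 1" using q by (auto simp: \<theta>_def field_simps)
  define Y where "Y = (D * Z) powr \<theta>"
  have Y: "Y \<ge> 1" unfolding Y_def using Z \<theta> by (intro ge_one_powr_ge_zero) auto
  have "t j powr (q j * (q k - 1) / q k) \<le> Y" for j
  proof -
    have "t j powr (q j * (q k - 1) / q k) = (t j powr q j) powr \<theta>" by (simp add: \<theta>_def powr_powr)
    also have "\<dots> \<le> Y" unfolding Y_def using Z \<theta> by (intro powr_mono2) auto
    finally show ?thesis .
  qed
  then have "(\<Sum>j\<in>UNIV. t j powr (q j * (q k - 1) / q k)) \<le> CARD('d) * Y"
    using sum_bounded_above[of UNIV "\<lambda>j. t j powr (q j * (q k - 1) / q k)" Y] by simp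
  then have "C * (1 + (\<Sum>j\<in>UNIV. t j powr (q j * (q k - 1) / q k))) \<le> C * (Y + CARD('d) * Y)"
    using Y C by (intro mult_left_mono add_mono) auto
  then have g: "\<bar>\<gamma>\<bar> \<le> C * (1 + CARD('d)) * Y" using \<gamma> by (simp add: algebra_simps)
  have "w = (w powr q k) powr (1 / q k)" using w q by (simp add: powr_powr)
  also have "\<dots> \<le> Z powr (1 / q k)" using w q by (intro powr_mono2) auto
  also have "\<dots> \<le> (D * Z) powr (1 / q k)"
    using mult_right_mono[OF D Z(1)] Z q by (intro powr_mono2) auto
  finally have "\<bar>\<gamma>\<bar> * w \<le> (C * (1 + CARD('d)) * Y) * (D * Z) powr (1 / q k)"
    using g C Y w by (intro mult_mono) auto
  also have "\<dots> = C * (1 + CARD('d)) * ((D * Z) powr \<theta> * (D * Z) powr (1 / q k))"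
    by (simp add: Y_def mult.assoc)
  also have "(D * Z) powr \<theta> * (D * Z) powr (1 / q k) = D * Z"
    unfolding powr_add[symmetric] \<theta>(3) using D Z by simp
  finally show ?thesis by (simp add: mult.assoc)
qed

text \<open>The levels \<open>L powr (1/q) * (2 - 2 powr (-n))\<close> are scaled so that the \<open>q\<close>-th powers of all
  components of the system are truncated at comparable heights.\<close>

definition excess :: "real \<Rightarrow> real \<Rightarrow> nat \<Rightarrow> real \<Rightarrow> real" where
  "excess L q n s = max (\<bar>s\<bar> - L powr (1 / q) * (2 - (1 / 2) ^ n)) 0"

lemma excess_nonneg: "excess L q n s \<ge> 0"
  by (simp add: excess_def)

lemma excess_le_abs: "excess L q n s \<le> \<bar>s\<bar>"
proof -
  have "(1 / 2 :: real) ^ n \<le> 1" by (simp add: power_le_one)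
  then have "L powr (1 / q) * (2 - (1 / 2) ^ n) \<ge> 0" by (intro mult_nonneg_nonneg) auto
  then show ?thesis by (simp add: excess_def)
qed

lemma excess_Suc_le: "excess L q (Suc n) s \<le> excess L q n s"
proof -
  have "L powr (1 / q) * (2 - (1 / 2) ^ n) \<le> L powr (1 / q) * (2 - (1 / 2) ^ Suc n)"
    by (intro mult_left_mono) auto
  then show ?thesis by (simp add: excess_def)
qed

lemma excess_limit_le: "max (\<bar>s\<bar> - 2 * L powr (1 / q)) 0 \<le> excess L q n s"
proof -
  have "L powr (1 / q) * (2 - (1 / 2) ^ n) \<le> L powr (1 / q) * 2"
    by (intro mult_left_mono) auto
  then show ?thesis by (simp add: excess_def)
qed

lemma borel_measurable_excess [measurable]: "excess L q n \<in> borel_measurable borel"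
  unfolding excess_def[abs_def] by measurable

text \<open>The point is a constant independent of \<open>L\<close>. Where component
  \<open>k\<close> exceeds the next level, the gap between consecutive levels bounds
  \<open>L\<close> itself by a multiple of the sum of excess powers; this in turn bounds all
  components, because their levels are tied to the same \<open>L\<close>.\<close>

lemma excess_growth_bound:
  fixes s q :: "'d::finite \<Rightarrow> real"
  assumes q: "\<And>j. q j > 1" "\<And>j. q j \<le> Q" and C: "C \<ge> 0" and L: "L \<ge> 1"
    and \<gamma>: "\<bar>\<gamma>\<bar> \<le> C * (1 + (\<Sum>j\<in>UNIV. \<bar>s j\<bar> powr (q j * (q k - 1) / q k)))"
  shows "\<bar>\<gamma>\<bar> * excess L (q k) (Suc n) (s k)
    \<le> C * (1 + CARD('d)) * (2 powr (2 * Q + 1) * (2 powr Q) ^ Suc n) * (\<Sum>j\<in>UNIV. excess L (q j) n (s j) powr q j)"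
proof (cases "excess L (q k) (Suc n) (s k) = 0")
  case True
  have "0 \<le> C * (1 + CARD('d)) * (2 powr (2 * Q + 1) * (2 powr Q) ^ Suc n) * (\<Sum>j\<in>UNIV. excess L (q j) n (s j) powr q j)"
    using C by (intro mult_nonneg_nonneg sum_nonneg) auto
  then show ?thesis using True by simp
next
  case False
  define Z where "Z = (\<Sum>j\<in>UNIV. excess L (q j) n (s j) powr q j)"
  define B where "B = (2 powr Q) ^ Suc n"
  have Q: "Q > 1" using q[of k] by simp
  have B: "B \<ge> 1" unfolding B_def using Q by (intro one_le_power ge_one_powr_ge_zero) auto
  have Z: "excess L (q j) n (s j) powr q j \<le> Z" for j
    unfolding Z_def by (rule member_le_sum) auto
  have Z0: "Z \<ge> 0" unfolding Z_def by (intro sum_nonneg) auto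
  \<comment> \<open>The gap \<open>e\<close> between the levels \<open>n\<close> and
    \<open>n + 1\<close> is \<open>L powr (1 / q k)\<close> divided by \<open>2 ^ Suc n\<close>,
    whence the power \<open>Suc n\<close> in \<open>B\<close>.\<close>
  have LZ: "L \<le> B * Z"
  proof -
    define e where "e = L powr (1 / q k) * (1 / 2) ^ Suc n"
    have "L powr (1 / q k) * (2 - (1 / 2) ^ Suc n) < \<bar>s k\<bar>"
      using False unfolding excess_def by (auto simp: max_def split: if_splits)
    then have e: "e \<le> excess L (q k) n (s k)"
      unfolding excess_def e_def by (intro max.coboundedI1) (simp add: algebra_simps)
    have "L = (L powr (1 / q k)) powr q k" using L q(1)[of k] by (simp add: powr_powr)
    also have "L powr (1 / q k) = e * 2 ^ Suc n" by (simp add: e_def power_one_over)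
    also have "(e * 2 ^ Suc n) powr q k = (2 powr q k) ^ Suc n * e powr q k"
    proof -
      have "(2 ^ Suc n) powr q k = (2 powr q k) ^ Suc n"
        by (simp only: powr_realpow[symmetric] zero_less_numeral powr_gt_zero powr_powr mult.commute)
      then show ?thesis by (simp only: powr_mult mult.commute)
    qed
    also have "\<dots> \<le> B * Z"
    proof (rule mult_mono)
      show "(2 powr q k) ^ Suc n \<le> B" unfolding B_def using q(2)[of k] by (intro power_mono powr_mono) auto
      have "e powr q k \<le> excess L (q k) n (s k) powr q k"
        using e q(1)[of k] by (intro powr_mono2) (auto simp: e_def)
      then show "e powr q k \<le> Z" using Z[of k] by simp
    qed (use B in auto)
    finally show ?thesis .
  qed
  have D1: "2 powr (2 * Q + 1) \<ge> (1::real)" using Q by (intro ge_one_powr_ge_zero) auto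
  have D: "2 powr (2 * Q + 1) * B \<ge> 1" using D1 B by (metis mult_mono' mult_1 zero_le_one)
  have BZ: "B * Z \<le> 2 powr (2 * Q + 1) * B * Z"
    using mult_right_mono[OF D1, of "B * Z"] B Z0 by (simp add: mult.assoc)
  \<comment> \<open>Every level is below \<open>2 * L powr (1 / q j)\<close>. In the constant, one
    \<open>2 powr Q\<close> comes from the power of a sum, one from the factor 2 of the level, and
    the last 2 from adding two equal bounds.\<close>
  have sZ: "\<bar>s j\<bar> powr q j \<le> 2 powr (2 * Q + 1) * B * Z" for j
  proof -
    have "L powr (1 / q j) * (2 - (1 / 2) ^ n) \<le> L powr (1 / q j) * 2"
      by (intro mult_left_mono) auto
    then have "\<bar>s j\<bar> \<le> excess L (q j) n (s j) + 2 * L powr (1 / q j)"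
      unfolding excess_def by (simp add: max_def)
    then have "\<bar>s j\<bar> powr q j \<le> (excess L (q j) n (s j) + 2 * L powr (1 / q j)) powr q j"
      using q(1)[of j] by (intro powr_mono2) auto
    also have "\<dots> \<le> 2 powr q j * (excess L (q j) n (s j) powr q j + (2 * L powr (1 / q j)) powr q j)"
      using q(1)[of j] by (intro powr_add_le) (auto simp: excess_nonneg)
    also have "(2 * L powr (1 / q j)) powr q j = 2 powr q j * L"
      using q(1)[of j] L by (simp add: powr_mult powr_powr)
    also have "2 powr q j * (excess L (q j) n (s j) powr q j + 2 powr q j * L)
       \<le> 2 powr Q * (2 powr Q * (B * Z) + 2 powr Q * (B * Z))"
    proof -
      have 1: "2 powr q j \<le> 2 powr Q" using q(2)[of j] by (intro powr_mono) auto
      have 2: "(1::real) \<le> 2 powr Q" using Q by (intro ge_one_powr_ge_zero) auto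
      have "1 * Z \<le> B * Z" using B Z0 by (intro mult_right_mono)
      moreover have "1 * (B * Z) \<le> 2 powr Q * (B * Z)" using 2 B Z0 by (intro mult_right_mono) auto
      ultimately have "excess L (q j) n (s j) powr q j \<le> 2 powr Q * (B * Z)" using Z[of j] by simp
      then show ?thesis using 1 LZ L by (intro mult_mono add_mono) auto
    qed
    also have "\<dots> = 2 powr (2 * Q + 1) * B * Z"
    proof -
      have "2 powr (2 * Q + 1) = 2 * (2 powr Q * 2 powr Q)" by (simp add: powr_add[symmetric] powr_add)
      then show ?thesis by (simp add: algebra_simps)
    qed
    finally show ?thesis .
  qed
  have "excess L (q k) (Suc n) (s k) powr q k \<le> excess L (q k) n (s k) powr q k"
    using q(1)[of k] by (intro powr_mono2 excess_Suc_le) (auto simp: excess_nonneg)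
  then have wZ: "excess L (q k) (Suc n) (s k) powr q k \<le> Z" using Z[of k] by simp
  have "\<bar>\<gamma>\<bar> * excess L (q k) (Suc n) (s k) \<le> C * (1 + CARD('d)) * (2 powr (2 * Q + 1) * B) * Z"
    by (rule growth_product_bound[OF q(1) _ C \<gamma> D Z0 _ sZ _ wZ])
       (use LZ L BZ in \<open>auto simp: excess_nonneg\<close>)
  then show ?thesis by (simp add: Z_def B_def)
qed

lemma powr_root_ge:
  fixes s q L :: real
  assumes "s \<ge> 0" "q > 0" "s powr q \<le> L"
  shows "s \<le> L powr (1 / q)"
proof -
  have "s = (s powr q) powr (1 / q)" using assms by (simp add: powr_powr)
  also have "\<dots> \<le> L powr (1 / q)" using assms by (intro powr_mono2) auto
  finally show ?thesis .
qed

text \<open>\<open>growth_product_bound\<close> with \<open>D = 1\<close> and \<open>Z\<close> equal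
  to 1 plus the sum of the integrable powers; the choices \<open>w = 1\<close> and
  \<open>w = \<bar>u k x\<bar>\<close> give the two claims.\<close>

lemma growth_integrable:
  fixes u \<gamma> :: "'d::finite \<Rightarrow> 'x \<Rightarrow> real"
  assumes M: "finite_measure M" and [measurable]: "\<And>k. u k \<in> borel_measurable M" "\<And>k. \<gamma> k \<in> borel_measurable M"
    and q: "\<And>k. q k > 1" and C: "C \<ge> 0"
    and uq: "\<And>k. integrable M (\<lambda>x. \<bar>u k x\<bar> powr q k)"
    and growth: "\<And>k. AE x in M. \<bar>\<gamma> k x\<bar> \<le> C * (1 + (\<Sum>j\<in>UNIV. \<bar>u j x\<bar> powr (q j * (q k - 1) / q k)))"
  shows "integrable M (\<gamma> k)" "integrable M (\<lambda>x. \<bar>\<gamma> k x\<bar> * \<bar>u k x\<bar>)"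
proof -
  interpret finite_measure M by fact
  define F where "F = (\<lambda>x. 1 + (\<Sum>j\<in>UNIV. \<bar>u j x\<bar> powr q j))"
  have F: "1 \<le> F x" "\<bar>u j x\<bar> powr q j \<le> F x" for j x
  proof -
    have "\<bar>u j x\<bar> powr q j \<le> (\<Sum>j\<in>UNIV. \<bar>u j x\<bar> powr q j)" by (rule member_le_sum) auto
    then show "\<bar>u j x\<bar> powr q j \<le> F x" by (simp add: F_def)
    show "1 \<le> F x" by (simp add: F_def sum_nonneg)
  qed
  have F_int: "integrable M (\<lambda>x. C * (1 + CARD('d)) * 1 * F x)"
    unfolding F_def using uq by (intro integrable_mult_right Bochner_Integration.integrable_add Bochner_Integration.integrable_sum) auto
  have bound: "AE x in M. \<forall>w\<ge>0. w powr q k \<le> F x \<longrightarrow> \<bar>\<gamma> k x\<bar> * w \<le> C * (1 + CARD('d)) * 1 * F x"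
    using growth[of k]
  proof eventually_elim
    case (elim x)
    have "F x \<ge> 0" using F(1)[of x] by linarith
    then show ?case using F(1)[of x] F(2)[where x=x]
      by (intro allI impI growth_product_bound[OF q _ C elim]) auto
  qed
  show "integrable M (\<gamma> k)"
  proof (rule Bochner_Integration.integrable_bound[OF F_int])
    show "AE x in M. norm (\<gamma> k x) \<le> norm (C * (1 + CARD('d)) * 1 * F x)"
      using bound
    proof eventually_elim
      case (elim x)
      then have "\<bar>\<gamma> k x\<bar> \<le> C * (1 + CARD('d)) * 1 * F x" using F(1)[of x] elim[rule_format, of 1] by simp
      also have "\<dots> \<le> norm (C * (1 + CARD('d)) * 1 * F x)" unfolding real_norm_def by (rule abs_ge_self)
      finally show ?case by simp
    qed
  qed simp
  show "integrable M (\<lambda>x. \<bar>\<gamma> k x\<bar> * \<bar>u k x\<bar>)"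
  proof (rule Bochner_Integration.integrable_bound[OF F_int])
    show "AE x in M. norm (\<bar>\<gamma> k x\<bar> * \<bar>u k x\<bar>) \<le> norm (C * (1 + CARD('d)) * 1 * F x)"
      using bound
    proof eventually_elim
      case (elim x)
      then have "\<bar>\<gamma> k x\<bar> * \<bar>u k x\<bar> \<le> C * (1 + CARD('d)) * 1 * F x" using F(2) by simp
      also have "\<dots> \<le> norm (C * (1 + CARD('d)) * 1 * F x)" unfolding real_norm_def by (rule abs_ge_self)
      finally show ?case by (simp add: abs_mult)
    qed
  qed simp
qed

lemma AE_bounded_if_level_estimates:
  fixes u \<gamma> :: "'d::finite \<Rightarrow> 'x \<Rightarrow> real" and p q K :: "'d \<Rightarrow> real"
  assumes M: "finite_measure M" and [measurable]: "\<And>k. u k \<in> borel_measurable M" "\<And>k. \<gamma> k \<in> borel_measurable M"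
    and p: "\<And>k. p k > 1" "\<And>k. p k < q k" and C: "C \<ge> 0" and \<nu>: "\<nu> > 0" and K: "\<And>k. K k \<ge> 0" and R: "R \<ge> 0"
    and uq: "\<And>k. integrable M (\<lambda>x. \<bar>u k x\<bar> powr q k)"
    and growth: "\<And>k. AE x in M. \<bar>\<gamma> k x\<bar> \<le> C * (1 + (\<Sum>j\<in>UNIV. \<bar>u j x\<bar> powr (q j * (q k - 1) / q k)))"
    and level: "\<And>k h. h \<ge> R \<Longrightarrow> (\<integral>x. max (\<bar>u k x\<bar> - h) 0 powr q k \<partial>M)
        \<le> K k * ((\<integral>x. \<bar>\<gamma> k x\<bar> * max (\<bar>u k x\<bar> - h) 0 \<partial>M) / \<nu>) powr (q k / p k)"
  shows "\<exists>B. AE x in M. \<bar>u k x\<bar> \<le> B"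
proof -
  have q: "q k > 1" for k using p[of k] by linarith
  define Q where "Q = Max (range q)"
  have qQ: "q j \<le> Q" for j unfolding Q_def by (intro Max_ge) auto
  have Q: "Q > 1" using q[of undefined] qQ[of undefined] by linarith
  define B where "B = 2 powr Q"
  have B: "B > 1" unfolding B_def using Q by simp
  \<comment> \<open>One factor \<open>B\<close> is moved into the constant, since the growth bound
    carries \<open>B ^ Suc n\<close> and the recursion is to show \<open>B ^ n\<close>.\<close>
  define c0 where "c0 = C * (1 + CARD('d)) * (2 powr (2 * Q + 1) * B)"
  define c1 where "c1 = max 1 (c0 / \<nu>)"
  have c0: "c0 \<ge> 0" using C B by (simp add: c0_def)
  define r where "r = (\<lambda>k. q k / p k)"
  \<comment> \<open>The components have different exponents \<open>r k\<close>. The smallest is used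
    on \<open>U \<le> 1\<close> and the largest on the coefficient, which is at least 1 because
    \<open>c1\<close> is; both replacements enlarge the bound.\<close>
  define r0 where "r0 = Min (range r)"
  define r1 where "r1 = Max (range r)"
  have r: "r0 \<le> r k" "r k \<le> r1" for k unfolding r0_def r1_def by auto
  have "r k > 1" for k using p[of k] by (simp add: r_def)
  then have r0: "r0 > 1" unfolding r0_def by simp
  have r1: "r1 > 1" using r0 r[of undefined] by linarith
  define \<delta> where "\<delta> = r0 - 1"
  have \<delta>: "\<delta> > 0" using r0 by (simp add: \<delta>_def)
  \<comment> \<open>The summand 1 keeps the constant positive even when every \<open>K k\<close> is
    0.\<close>
  define C2 where "C2 = (\<Sum>k\<in>UNIV. K k) * c1 powr r1 + 1"
  have C2: "C2 > 0" unfolding C2_def using K by (simp add: sum_nonneg add_nonneg_pos)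
  define U where "U = (\<lambda>L n. \<Sum>k\<in>UNIV. \<integral>x. excess L (q k) n (u k x) powr q k \<partial>M)"
  have U0: "U L n \<ge> 0" for L n unfolding U_def by (intro sum_nonneg) simp
  have e_le: "excess L (q k) n s powr q k \<le> \<bar>s\<bar> powr q k" for L k n s
    using q[of k] by (intro powr_mono2 excess_le_abs excess_nonneg) auto
  have e_int: "integrable M (\<lambda>x. excess L (q k) n (u k x) powr q k)" for L k n
    by (rule Bochner_Integration.integrable_bound[OF uq[of k]]) (use e_le in auto)
  have \<gamma>u: "integrable M (\<lambda>x. \<bar>\<gamma> k x\<bar> * \<bar>u k x\<bar>)" for k
    by (rule growth_integrable[OF M _ _ q C uq growth]) auto
  have step: "U L (Suc n) \<le> C2 * (B powr r1) ^ n * U L n powr (1 + \<delta>)"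
    if L: "L \<ge> 1" "\<And>k. R \<le> L powr (1 / q k)" and U1: "U L n \<le> 1" for L n
  proof -
    have "(\<integral>x. excess L (q k) (Suc n) (u k x) powr q k \<partial>M) \<le> K k * (c1 powr r1 * (B powr r1) ^ n * U L n powr (1 + \<delta>))" for k
    proof -
      define h where "h = L powr (1 / q k) * (2 - (1 / 2) ^ Suc n)"
      \<comment> \<open>All levels lie above \<open>L powr (1 / q k)\<close>, hence above
        \<open>R\<close>, where the level estimate is available.\<close>
      have "L powr (1 / q k) * 1 \<le> h" unfolding h_def
        using power_le_one[of "1 / 2 :: real" "Suc n"] by (intro mult_left_mono) auto
      then have h: "R \<le> h" using L(2)[of k] by simp
      have ex: "excess L (q k) (Suc n) s = max (\<bar>s\<bar> - h) 0" for s by (simp add: excess_def h_def)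
      have "(\<integral>x. \<bar>\<gamma> k x\<bar> * excess L (q k) (Suc n) (u k x) \<partial>M)
          \<le> (\<integral>x. c0 * B ^ n * (\<Sum>j\<in>UNIV. excess L (q j) n (u j x) powr q j) \<partial>M)"
      proof (rule integral_mono_AE)
        show "integrable M (\<lambda>x. \<bar>\<gamma> k x\<bar> * excess L (q k) (Suc n) (u k x))"
          by (rule Bochner_Integration.integrable_bound[OF \<gamma>u[of k]])
             (auto simp: abs_mult excess_nonneg intro!: mult_left_mono excess_le_abs)
        show "integrable M (\<lambda>x. c0 * B ^ n * (\<Sum>j\<in>UNIV. excess L (q j) n (u j x) powr q j))"
          using e_int by (intro integrable_mult_right Bochner_Integration.integrable_sum)
        show "AE x in M. \<bar>\<gamma> k x\<bar> * excess L (q k) (Suc n) (u k x)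
            \<le> c0 * B ^ n * (\<Sum>j\<in>UNIV. excess L (q j) n (u j x) powr q j)"
          using growth[of k]
        proof eventually_elim
          case (elim x)
          then show ?case
            using excess_growth_bound[where s="\<lambda>j. u j x" and n=n, OF q qQ C L(1) elim]
            by (simp add: c0_def B_def mult_ac)
        qed
      qed
      also have "\<dots> = c0 * B ^ n * U L n"
        unfolding U_def using e_int by (simp add: Bochner_Integration.integral_sum)
      finally have "(\<integral>x. \<bar>\<gamma> k x\<bar> * excess L (q k) (Suc n) (u k x) \<partial>M) / \<nu> \<le> c0 / \<nu> * B ^ n * U L n"
        using \<nu> by (simp add: field_simps)
      also have "\<dots> \<le> c1 * B ^ n * U L n"
        using B U0 by (intro mult_right_mono) (auto simp: c1_def)
      finally have le: "(\<integral>x. \<bar>\<gamma> k x\<bar> * excess L (q k) (Suc n) (u k x) \<partial>M) / \<nu> \<le> c1 * B ^ n * U L n" .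
      have cB: "c1 * B ^ n \<ge> 1"
        using mult_mono[of 1 c1 1 "B ^ n"] B by (simp add: c1_def one_le_power)
      have "((\<integral>x. \<bar>\<gamma> k x\<bar> * excess L (q k) (Suc n) (u k x) \<partial>M) / \<nu>) powr r k \<le> (c1 * B ^ n * U L n) powr r k"
        using le r0 r[of k] \<nu> by (intro powr_mono2) (auto intro!: divide_nonneg_pos integral_nonneg_AE simp: excess_nonneg)
      also have "\<dots> = (c1 * B ^ n) powr r k * U L n powr r k" by (rule powr_mult)
      also have "\<dots> \<le> (c1 * B ^ n) powr r1 * U L n powr r0"
        using cB U0 U1 r[of k] by (intro mult_mono powr_mono powr_mono') auto
      also have "(c1 * B ^ n) powr r1 = c1 powr r1 * (B powr r1) ^ n"
        using B by (simp add: powr_mult powr_realpow[symmetric] powr_powr mult.commute)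
      finally have "K k * ((\<integral>x. \<bar>\<gamma> k x\<bar> * excess L (q k) (Suc n) (u k x) \<partial>M) / \<nu>) powr r k
          \<le> K k * (c1 powr r1 * (B powr r1) ^ n * U L n powr (1 + \<delta>))"
        using K[of k] by (intro mult_left_mono) (auto simp: \<delta>_def)
      then show ?thesis using level[OF h, of k] unfolding ex r_def by linarith
    qed
    then have "U L (Suc n) \<le> (\<Sum>k\<in>UNIV. K k * (c1 powr r1 * (B powr r1) ^ n * U L n powr (1 + \<delta>)))"
      unfolding U_def by (intro sum_mono) (simp add: U_def)
    also have "\<dots> = (\<Sum>k\<in>UNIV. K k) * c1 powr r1 * ((B powr r1) ^ n * U L n powr (1 + \<delta>))"
      by (simp add: sum_distrib_right[symmetric] mult.assoc)
    also have "\<dots> \<le> C2 * ((B powr r1) ^ n * U L n powr (1 + \<delta>))"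
      unfolding C2_def by (intro mult_right_mono) auto
    finally show ?thesis by (simp add: mult.assoc)
  qed
  \<comment> \<open>At \<open>n = 0\<close> the level is exactly \<open>m powr (1 / q k)\<close>, so
    the excess at a fixed point is 0 as soon as \<open>m\<close> passes
    \<open>\<bar>u k x\<bar> powr q k\<close>.\<close>
  have "(\<lambda>m. U (real m) 0) \<longlonglongrightarrow> (\<Sum>k\<in>(UNIV::'d set). 0)"
    unfolding U_def
  proof (rule tendsto_sum)
    fix k
    have "(\<lambda>m. \<integral>x. excess (real m) (q k) 0 (u k x) powr q k \<partial>M) \<longlonglongrightarrow> (\<integral>x. 0 \<partial>M)"
    proof (rule integral_dominated_convergence[where w="\<lambda>x. \<bar>u k x\<bar> powr q k"])
      show "AE x in M. (\<lambda>m. excess (real m) (q k) 0 (u k x) powr q k) \<longlonglongrightarrow> 0"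
      proof (rule AE_I2)
        fix x
        obtain N where N: "\<bar>u k x\<bar> powr q k < real N" using reals_Archimedean2 by blast
        have "excess (real m) (q k) 0 (u k x) powr q k = 0" if "m \<ge> N" for m
        proof -
          have "\<bar>u k x\<bar> powr q k \<le> real m" using N that by linarith
          then have "\<bar>u k x\<bar> \<le> real m powr (1 / q k)" using q[of k] by (intro powr_root_ge) auto
          then show ?thesis by (simp add: excess_def)
        qed
        then have "\<forall>\<^sub>F m in sequentially. excess (real m) (q k) 0 (u k x) powr q k = 0"
          unfolding eventually_sequentially by blast
        then show "(\<lambda>m. excess (real m) (q k) 0 (u k x) powr q k) \<longlonglongrightarrow> 0" by (rule tendsto_eventually)
      qed
      show "AE x in M. norm (excess (real m) (q k) 0 (u k x) powr q k) \<le> \<bar>u k x\<bar> powr q k" for m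
        using e_le by auto
    qed (use uq in auto)
    then show "(\<lambda>m. \<integral>x. excess (real m) (q k) 0 (u k x) powr q k \<partial>M) \<longlonglongrightarrow> 0" by simp
  qed
  then have U_start: "(\<lambda>m. U (real m) 0) \<longlonglongrightarrow> 0" by simp
  have "(\<lambda>m. C2 * U (real m) 0 powr \<delta>) \<longlonglongrightarrow> C2 * 0 powr \<delta>"
    using \<delta> U0 by (intro tendsto_mult_left tendsto_powr'[OF U_start]) auto
  then have "\<forall>\<^sub>F m in sequentially. C2 * U (real m) 0 powr \<delta> < (B powr r1) powr (- 1 / \<delta>)"
    using B by (intro order_tendstoD(2)) auto
  moreover have "\<forall>\<^sub>F m in sequentially. U (real m) 0 < 1"
    using U_start by (rule order_tendstoD(2)) simp
  moreover have "\<forall>\<^sub>F m in sequentially. 1 \<le> real m"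
    unfolding eventually_sequentially by (intro exI[of _ 1]) auto
  moreover have "\<forall>\<^sub>F m in sequentially. \<forall>k. R \<le> real m powr (1 / q k)"
  proof (rule eventually_all_finite)
    fix k
    obtain N where "R powr q k < real N" using reals_Archimedean2 by blast
    then have "R \<le> real m powr (1 / q k)" if "m \<ge> N" for m
      using that q[of k] R by (intro powr_root_ge) auto
    then show "\<forall>\<^sub>F m in sequentially. R \<le> real m powr (1 / q k)"
      unfolding eventually_sequentially by blast
  qed
  ultimately have "\<forall>\<^sub>F m in sequentially. C2 * U (real m) 0 powr \<delta> < (B powr r1) powr (- 1 / \<delta>) \<and> U (real m) 0 < 1
      \<and> 1 \<le> real m \<and> (\<forall>k. R \<le> real m powr (1 / q k))"
    by eventually_elim auto
  then obtain m where m: "C2 * U (real m) 0 powr \<delta> < (B powr r1) powr (- 1 / \<delta>)" "U (real m) 0 < 1"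
    "1 \<le> real m" "\<And>k. R \<le> real m powr (1 / q k)"
    using eventually_happens trivial_limit_sequentially by blast
  have lim: "U (real m) \<longlonglongrightarrow> 0"
    by (rule de_giorgi_decay[OF \<delta> _ C2 U0 step[OF m(3,4)]]) (use m B r1 in auto)
  \<comment> \<open>\<open>H\<close> is the limit of the levels from below, so the integral above it
    is bounded by every \<open>U (real m) n\<close> and must be 0.\<close>
  define H where "H = 2 * real m powr (1 / q k)"
  have le: "(\<integral>x. max (\<bar>u k x\<bar> - H) 0 powr q k \<partial>M) \<le> U (real m) n" for n
  proof -
    have "(\<integral>x. max (\<bar>u k x\<bar> - H) 0 powr q k \<partial>M) \<le> (\<integral>x. excess (real m) (q k) n (u k x) powr q k \<partial>M)"
      using q[of k] excess_limit_le unfolding H_def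
      by (intro integral_mono_AE' e_int AE_I2 powr_mono2) auto
    also have "\<dots> \<le> U (real m) n" unfolding U_def by (intro member_le_sum) auto
    finally show ?thesis .
  qed
  have "(\<integral>x. max (\<bar>u k x\<bar> - H) 0 powr q k \<partial>M) \<le> 0"
    using lim by (rule LIMSEQ_le_const) (use le in auto)
  then have "(\<integral>x. max (\<bar>u k x\<bar> - H) 0 powr q k \<partial>M) = 0"
    by (intro antisym) auto
  moreover have "integrable M (\<lambda>x. max (\<bar>u k x\<bar> - H) 0 powr q k)"
  proof (rule Bochner_Integration.integrable_bound[OF e_int[of "real m" k 0]])
    show "AE x in M. norm (max (\<bar>u k x\<bar> - H) 0 powr q k) \<le> norm (excess (real m) (q k) 0 (u k x) powr q k)"
      using q[of k] excess_limit_le unfolding H_def by (auto intro!: powr_mono2)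
  qed measurable
  ultimately have "AE x in M. max (\<bar>u k x\<bar> - H) 0 powr q k = 0"
    by (subst (asm) integral_nonneg_eq_0_iff_AE) auto
  then have "AE x in M. \<bar>u k x\<bar> \<le> H" by eventually_elim (auto simp: max_def split: if_splits)
  then show ?thesis by blast
qed

theorem theorem3p1:
  fixes \<Omega> :: "(real^'n::finite) set"
    and p q :: "'d::finite \<Rightarrow> real"
    and A :: "'d \<Rightarrow> real^'n \<Rightarrow> real \<Rightarrow> real"
    and G :: "real^'n \<Rightarrow> real^'d \<Rightarrow> real"
    and g :: "'d \<Rightarrow> real^'n \<Rightarrow> real^'d \<Rightarrow> real"
    and C0 \<nu> C R \<mu> \<gamma> :: real
    and u :: "'d \<Rightarrow> real^'n \<Rightarrow> real"
    and Du :: "'d \<Rightarrow> real^'n \<Rightarrow> real^'n"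
  assumes N2: "CARD('n) \<ge> 2"
    and dom: "open \<Omega>" "connected \<Omega>" "bounded \<Omega>"
    and p_gt1: "\<And>k. p k > 1"
    \<comment> \<open>A_k is C^1-Caratheodory\<close>
    and A_meas: "\<And>k s. set_borel_measurable lebesgue \<Omega> (\<lambda>x. A k x s)"
    and A_C1: "\<And>k. AE x in lebesgue. x \<in> \<Omega> \<longrightarrow>
                 (\<forall>s. A k x differentiable (at s)) \<and> continuous_on UNIV (deriv (A k x))"
    and C0_pos: "C0 > 0" and nu_pos: "\<nu> > 0"
    and a1: "\<And>k. AE x in lebesgue. x \<in> \<Omega> \<longrightarrow>
                 (\<forall>s. \<bar>A k x s\<bar> \<le> C0 \<and> \<bar>deriv (A k x) s\<bar> \<le> C0)"
    and a2: "\<And>k. AE x in lebesgue. x \<in> \<Omega> \<longrightarrow> (\<forall>s. A k x s \<ge> \<nu>)"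
    \<comment> \<open>G is C^1-Caratheodory with partial derivatives g k\<close>
    and G_meas: "\<And>s. set_borel_measurable lebesgue \<Omega> (\<lambda>x. G x s)"
    and g_meas: "\<And>k s. set_borel_measurable lebesgue \<Omega> (\<lambda>x. g k x s)"
    and G_C1: "AE x in lebesgue. x \<in> \<Omega> \<longrightarrow>
                 (\<forall>s. (G x has_derivative (\<lambda>h. \<Sum>k\<in>UNIV. g k x s * h $ k)) (at s)) \<and>
                 (\<forall>k. continuous_on UNIV (g k x))"
    and G0: "AE x in lebesgue. x \<in> \<Omega> \<longrightarrow> G x 0 = 0 \<and> (\<forall>k. g k x 0 = 0)"
    \<comment> \<open>(g.1)\<close>
    and C_pos: "C > 0"
    and q_range: "\<And>k. p k < q k \<and> (real CARD('n) > p k \<longrightarrow>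
                     q k < real CARD('n) * p k / (real CARD('n) - p k))"
    and g1: "AE x in lebesgue. x \<in> \<Omega> \<longrightarrow> (\<forall>s k.
               \<bar>g k x s\<bar> \<le> C * (1 + \<bar>s $ k\<bar> powr (q k - 1) +
                  (\<Sum>j\<in>UNIV - {k}. \<bar>s $ j\<bar> powr (q j * (q k - 1) / q k))))"
    \<comment> \<open>(g.2) and (a.3)\<close>
    and R_pos: "R > 0"
    and mu: "\<mu> > Max (range p)"
    and gamma: "0 < \<gamma>" "\<gamma> < \<mu> - Max (range p)"
    and g2: "AE x in lebesgue. x \<in> \<Omega> \<longrightarrow> (\<forall>s. norm s \<ge> R \<longrightarrow>
               0 < \<mu> * G x s \<and> \<mu> * G x s \<le> (\<Sum>k\<in>UNIV. s $ k * g k x s))"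
    and a3: "\<And>k. AE x in lebesgue. x \<in> \<Omega> \<longrightarrow> (\<forall>s. \<bar>s\<bar> \<ge> R \<longrightarrow>
               0 \<le> s * deriv (A k x) s \<and> s * deriv (A k x) s \<le> \<gamma> * A k x s)"
    \<comment> \<open>u is a weak solution of (P)\<close>
    and u_W: "\<And>k. W01p \<Omega> (p k) (u k) (Du k)"
    and u_weak: "\<And>v k. (\<forall>j. test_fun \<Omega> (v j)) \<Longrightarrow>
        (LINT x:\<Omega>|lebesgue. A k x (u k x) * norm (Du k x) powr (p k - 2) *
                              (Du k x \<bullet> grad_fun (v k) x))
        + 1 / p k * (LINT x:\<Omega>|lebesgue. deriv (A k x) (u k x) * norm (Du k x) powr (p k) * v k x)
        = (LINT x:\<Omega>|lebesgue. g k x (\<chi> j. u j x) * v k x)"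
  shows "\<forall>k. Linf_fun \<Omega> (u k)"
proof
  fix k
  define M where "M = lebesgue_on \<Omega>"
  have \<Omega>: "\<Omega> \<in> sets lebesgue" using dom(1) by simp
  note eqs = set_borel_measurable_iff_lebesgue_on[OF \<Omega>] set_lebesgue_integral_eq_lebesgue_on[OF \<Omega>]
    AE_iff_lebesgue_on[OF \<Omega>] M_def[symmetric]
  have WF: "W01p_function \<Omega> (p k) (u k) (Du k)" for k
    by unfold_locales (use \<Omega> dom u_W p_gt1 in auto)
  have u_meas[measurable]: "u k \<in> borel_measurable M" for k
    using W01p_function.measurable_f[OF WF] by (simp add: M_def)
  have pq: "1 < p k" "p k < q k" "1 < q k" "0 < p k" "0 < q k" for k
    using p_gt1[of k] q_range[of k] by auto
  have finM: "finite_measure M" unfolding M_def by (rule finite_measure_lebesgue_on[OF \<Omega> dom(3)])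
  have "\<exists>K\<ge>0. \<forall>\<phi>. test_fun \<Omega> \<phi> \<longrightarrow>
      (\<integral>x. \<bar>\<phi> x\<bar> powr q k \<partial>M) \<le> K * (\<integral>x. norm (grad_fun \<phi> x) powr p k \<partial>M) powr (q k / p k)" for k
  proof -
    \<comment> \<open>Translation of the range of \<open>q k\<close> into the form used by the
      Sobolev inequality; in the second case it follows from \<open>real CARD('n) \<le> p k\<close>
      alone.\<close>
    have "real CARD('n) * (q k - p k) / p k < q k"
    proof (cases "p k < real CARD('n)")
      case True
      then have "q k * (real CARD('n) - p k) < real CARD('n) * p k"
        using q_range[of k] by (simp add: pos_less_divide_eq)
      then show ?thesis using pq[of k] by (simp add: field_simps)
    next
      case False
      then have "real CARD('n) * (q k - p k) \<le> p k * (q k - p k)" using pq[of k] by (intro mult_right_mono) auto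
      also have "\<dots> < p k * q k" using pq[of k] by simp
      finally show ?thesis using pq[of k] by (simp add: field_simps)
    qed
    from sobolev_test_fun[OF dom(3) pq(1,2)[of k] this] obtain K where "K \<ge> 0"
      "\<And>\<phi>. test_fun \<Omega> \<phi> \<Longrightarrow>
        (\<integral>x. \<bar>\<phi> x\<bar> powr q k \<partial>lborel) \<le> K * (\<integral>x. norm (grad_fun \<phi> x) powr p k \<partial>lborel) powr (q k / p k)"
      by blast
    then show ?thesis
      using test_fun_powr_lebesgue_on(2)[OF \<Omega> _ pq(5)[of k]] test_fun_powr_lebesgue_on(4)[OF \<Omega> _ pq(4)[of k]]
      unfolding M_def by (intro exI[of _ K]) auto
  qed
  then obtain K where K: "\<And>k. K k \<ge> 0" and sob: "\<And>k \<phi>. test_fun \<Omega> \<phi> \<Longrightarrow>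
      (\<integral>x. \<bar>\<phi> x\<bar> powr q k \<partial>M) \<le> K k * (\<integral>x. norm (grad_fun \<phi> x) powr p k \<partial>M) powr (q k / p k)"
    by metis
  \<comment> \<open>This uses only membership in the Sobolev space. It has to precede any use of the
    equation, because it makes the right-hand sides integrable and thereby the limits in the weak
    form legitimate.\<close>
  have uq: "integrable M (\<lambda>x. \<bar>u k x\<bar> powr q k)" for k
    unfolding M_def by (rule W01p_function.integrable_powr_if_sobolev[OF WF sob[unfolded M_def] K pq(5)])
  define a where "a = (\<lambda>k x. A k x (u k x))"
  define b where "b = (\<lambda>k x. deriv (A k x) (u k x))"
  define g' where "g' = (\<lambda>k x. g k x (\<chi> j. u j x))"
  have A_C1': "AE x in M. (\<forall>s. A k x differentiable (at s)) \<and> continuous_on UNIV (deriv (A k x))" for k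
    using A_C1[of k] unfolding eqs .
  have A_meas': "(\<lambda>x. A k x s) \<in> borel_measurable M" for k s using A_meas[of k s] unfolding eqs .
  have a_meas: "a k \<in> borel_measurable M" for k
    unfolding a_def M_def
  proof (rule caratheodory_measurable[OF \<Omega> A_meas'[unfolded M_def] _ u_meas[unfolded M_def]])
    show "AE x in lebesgue_on \<Omega>. continuous_on UNIV (A k x)"
      using A_C1'[of k] unfolding M_def
      by eventually_elim (simp add: continuous_on_eq_continuous_at differentiable_imp_continuous_within)
  qed
  have b_meas: "b k \<in> borel_measurable M" for k
    unfolding b_def M_def
  proof (rule caratheodory_measurable[OF \<Omega> _ _ u_meas[unfolded M_def]])
    show "(\<lambda>x. deriv (A k x) s) \<in> borel_measurable (lebesgue_on \<Omega>)" for s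
      using A_C1'[of k] unfolding M_def
      by (intro deriv_caratheodory_measurable[OF \<Omega> A_meas'[unfolded M_def]]) auto
    show "AE x in lebesgue_on \<Omega>. continuous_on UNIV (deriv (A k x))"
      using A_C1'[of k] unfolding M_def by eventually_elim simp
  qed
  have g_meas': "g' k \<in> borel_measurable M" for k
    unfolding g'_def M_def
  proof (rule caratheodory_measurable[OF \<Omega>, of "g k" "\<lambda>x. \<chi> j. u j x"])
    show "(\<lambda>x. g k x s) \<in> borel_measurable (lebesgue_on \<Omega>)" for s
      using g_meas[of k s] unfolding set_borel_measurable_iff_lebesgue_on[OF \<Omega>] .
    show "AE x in lebesgue_on \<Omega>. continuous_on UNIV (g k x)"
      using G_C1 unfolding AE_iff_lebesgue_on[OF \<Omega>] by eventually_elim simp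
    show "(\<lambda>x. \<chi> j. u j x) \<in> borel_measurable (lebesgue_on \<Omega>)"
      using u_meas unfolding M_def
      by (intro borel_measurable_euclidean_space[THEN iffD2]) (auto simp: Basis_vec_def inner_axis)
  qed
  have growth: "AE x in M. \<bar>g' k x\<bar> \<le> C * (1 + (\<Sum>j\<in>UNIV. \<bar>u j x\<bar> powr (q j * (q k - 1) / q k)))" for k
    using g1 unfolding eqs
  proof eventually_elim
    case (elim x)
    \<comment> \<open>The term that (g.1) singles out is the term \<open>j = k\<close> of the full
      sum, so the growth condition takes a form symmetric in the components.\<close>
    have "q k * (q k - 1) / q k = q k - 1" using pq(5)[of k] by simp
    then have "(\<Sum>j\<in>UNIV. \<bar>u j x\<bar> powr (q j * (q k - 1) / q k))
        = \<bar>u k x\<bar> powr (q k - 1) + (\<Sum>j\<in>UNIV - {k}. \<bar>u j x\<bar> powr (q j * (q k - 1) / q k))"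
      by (subst sum.remove[of UNIV k]) auto
    then show ?case using elim[rule_format, of k "\<chi> j. u j x"] by (simp add: g'_def add.assoc)
  qed
  have C0': "C \<ge> 0" using C_pos by simp
  have int: "integrable M (g' k)" "integrable M (\<lambda>x. \<bar>g' k x\<bar> * \<bar>u k x\<bar>)" for k
    using growth_integrable[OF finM u_meas g_meas' pq(3) C0' uq growth] by auto
  have bnd: "AE x in M. \<bar>a k x\<bar> \<le> C0 \<and> \<bar>b k x\<bar> \<le> C0" for k
    using a1[of k] unfolding eqs a_def b_def by eventually_elim blast
  have lower: "AE x in M. \<nu> \<le> a k x" for k
    using a2[of k] unfolding eqs a_def by eventually_elim blast
  have sign: "AE x in M. h \<le> \<bar>u k x\<bar> \<longrightarrow> 0 \<le> u k x * b k x" if "h \<ge> R" for h k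
    using a3[of k] unfolding eqs b_def by eventually_elim (use that in auto)
  \<comment> \<open>The same \<open>\<phi>\<close> is placed in every component of the vector test
    function; equation \<open>k\<close> sees only component \<open>k\<close>.\<close>
  have weak: "weak_form M (p k) (a k) (b k) (g' k) (Du k) \<phi> (grad_fun \<phi>)" if "test_fun \<Omega> \<phi>" for \<phi> k
    using u_weak[of "\<lambda>_. \<phi>" k] that unfolding eqs by (simp add: weak_form_def a_def b_def g'_def)
  have level: "(\<integral>x. max (\<bar>u k x\<bar> - h) 0 powr q k \<partial>M)
        \<le> K k * ((\<integral>x. \<bar>g' k x\<bar> * max (\<bar>u k x\<bar> - h) 0 \<partial>M) / \<nu>) powr (q k / p k)" if h: "h \<ge> R" for k h
  proof -
    have h0: "h \<ge> 0" using h R_pos by simp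
    show ?thesis unfolding M_def
      by (rule W01p_function.level_estimate[OF WF a_meas[unfolded M_def] b_meas[unfolded M_def]
          bnd[unfolded M_def] int(1)[unfolded M_def] lower[unfolded M_def] sign[OF h, unfolded M_def] h0 nu_pos
          weak[unfolded M_def] sob[unfolded M_def] K pq(5) int(2)[unfolded M_def]])
  qed
  have "\<exists>B. AE x in M. \<bar>u k x\<bar> \<le> B"
    using R_pos by (intro AE_bounded_if_level_estimates[OF finM u_meas g_meas' pq(1,2) C0' nu_pos K _ uq growth level]) auto
  then show "Linf_fun \<Omega> (u k)" using u_meas[of k] unfolding Linf_fun_def eqs by blast
qed

end
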